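(* Let $R$ be a commutative Noetherian ring with $1$. Let $Y$ be a set with an action of $\mathrm{Sym}(\mathbb{N})$ such that for each $y\in Y$ there is $k_y\in\mathbb{N}$ such that $y$ is fixed by every element of $\mathrm{Sym}(\mathbb{N})$ that fixes $[k_y]$ element-wise. Assume that $\mathrm{Sym}(\mathbb{N})$ has only finitely many orbits on $Y$. Let $k\in\mathbb{N}$, let $Z=\{z_{ij}\mid i\in[k],\,j\in\mathbb{N}\}$ be a set of variables with $\mathrm{Sym}(\mathbb{N})$-action $\pi z_{ij}=z_{i\,\pi(j)}$, and let $\phi:R[Y]\to R[Z]$ be a $\mathrm{Sym}(\mathbb{N})$-equivariant $R$-algebra homomorphism that maps each $y\in Y$ to a monomial in the $z_{ij}$. Then $\ker\phi$ is generated, as an ideal, by finitely many $\mathrm{Inc}(\mathbb{N})$-orbits of binomials, and $\operatorname{im}\phi\cong R[Y]/\ker\phi$ is an $\mathrm{Inc}(\mathbb{N})$-Noetherian ring.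
   Context: $\mathbb{N}=\{0,1,2,\ldots\}$ and $[k]=\{0,\ldots,k-1\}$. $\mathrm{Sym}(\mathbb{N})$ is the group of all bijections $\mathbb{N}\to\mathbb{N}$, and $\mathrm{Inc}(\mathbb{N})$ is the monoid of all strictly increasing maps $\mathbb{N}\to\mathbb{N}$. If $\mathrm{Sym}(\mathbb{N})$ acts on a set $Y$ such that each $y\in Y$ is fixed by all permutations fixing $[k_y]$ element-wise, then $\mathrm{Inc}(\mathbb{N})$ acts on $Y$ by $\pi y:=\pi' y$, where $\pi'\in\mathrm{Sym}(\mathbb{N})$ is any permutation that agrees with $\pi$ on $[k_y]$ (independent of the choice of $\pi'$). $R[Y]$ and $R[Z]$ are the commutative polynomial rings over $R$ whose variables are the elements of $Y$ and $Z$; the actions on variables extend to actions of $\mathrm{Sym}(\mathbb{N})$ by $R$-algebra automorphisms and of $\mathrm{Inc}(\mathbb{N})$ by $R$-algebra endomorphisms. A monomial is a product of variables with coefficient $1$; a binomial is a difference of two monomials. When a monoid $\Pi$ acts on a ring $S$ by endomorphisms, $S$ is called $\Pi$-Noetherian if every $\Pi$-stable ideal of $S$ is generated by the union of finitely many $\Pi$-orbits of elements. *)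

theory Defs
  imports "HOL-Algebra.Algebra" "HOL-Library.Poly_Mapping"
begin

section \<open>Polynomials in a set of variables\<close>

text \<open>
  A monomial in variables of type \<open>'v\<close> is its exponent vector, of type \<open>'v \<Rightarrow>\<^sub>0 nat\<close>.
  The coefficient ring is a type of sort \<open>{comm_ring, comm_monoid_mult}\<close>, that is, an arbitrary
  commutative ring with 1; the class \<open>comm_ring_1\<close> would exclude the zero ring.
\<close>

type_synonym ('v, 'r) mpoly = "('v \<Rightarrow>\<^sub>0 nat) \<Rightarrow>\<^sub>0 'r"

definition coeff_ring :: "'r::{comm_ring, comm_monoid_mult} ring" where
  "coeff_ring = \<lparr>carrier = UNIV, monoid.mult = (*), monoid.one = 1, ring.zero = 0, ring.add = (+)\<rparr>"

definition monomials :: "'v set \<Rightarrow> ('v \<Rightarrow>\<^sub>0 nat) set" where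
  "monomials V = {m. Poly_Mapping.keys m \<subseteq> V}"

abbreviation const :: "'r \<Rightarrow> ('v, 'r::{comm_ring, comm_monoid_mult}) mpoly" where
  "const c \<equiv> Poly_Mapping.single 0 c"

abbreviation mmonom :: "('v \<Rightarrow>\<^sub>0 nat) \<Rightarrow> ('v, 'r::{comm_ring, comm_monoid_mult}) mpoly" where
  "mmonom m \<equiv> Poly_Mapping.single m 1"

abbreviation mvar :: "'v \<Rightarrow> ('v, 'r::{comm_ring, comm_monoid_mult}) mpoly" where
  "mvar v \<equiv> mmonom (Poly_Mapping.single v 1)"

definition mpoly_ring :: "'v set \<Rightarrow> ('v, 'r::{comm_ring, comm_monoid_mult}) mpoly ring" where
  "mpoly_ring V = \<lparr>carrier = {p. Poly_Mapping.keys p \<subseteq> monomials V},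
                  monoid.mult = (*), monoid.one = const 1, ring.zero = 0, ring.add = (+)\<rparr>"

definition binomials :: "'v set \<Rightarrow> ('v, 'r::{comm_ring, comm_monoid_mult}) mpoly set" where
  "binomials V = {mmonom m - mmonom n | m n. m \<in> monomials V \<and> n \<in> monomials V}"

text \<open>The algebra homomorphism that sends each variable \<open>v\<close> to the variable \<open>f v\<close>.\<close>

definition map_vars ::
    "('v \<Rightarrow> 'w) \<Rightarrow> ('v, 'r::{comm_ring, comm_monoid_mult}) mpoly \<Rightarrow> ('w, 'r) mpoly" where
  "map_vars f p = (\<Sum>m \<in> Poly_Mapping.keys p.
     Poly_Mapping.single
       (\<Sum>v \<in> Poly_Mapping.keys m. Poly_Mapping.single (f v) (Poly_Mapping.lookup m v))
       (Poly_Mapping.lookup p m))"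

section \<open>Actions of permutations and of increasing maps\<close>

abbreviation SymN :: "(nat \<Rightarrow> nat) monoid" where
  "SymN \<equiv> BijGroup UNIV"

definition IncN :: "(nat \<Rightarrow> nat) monoid" where
  "IncN = \<lparr>carrier = {\<pi>. strict_mono \<pi>}, monoid.mult = (\<circ>), monoid.one = id\<rparr>"

definition supported_by :: "((nat \<Rightarrow> nat) \<Rightarrow> 'y \<Rightarrow> 'y) \<Rightarrow> 'y \<Rightarrow> nat \<Rightarrow> bool" where
  "supported_by act y k \<longleftrightarrow> (\<forall>\<sigma> \<in> carrier SymN. (\<forall>i<k. \<sigma> i = i) \<longrightarrow> act \<sigma> y = y)"

text \<open>
  Such a \<open>\<sigma>\<close> exists if \<open>\<pi>\<close> is injective and \<open>y\<close> has a support; lemma \<open>inc_act_eq\<close> below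
  shows that neither the choice of \<open>\<sigma>\<close> nor that of \<open>k\<close> matters.
\<close>

definition inc_act ::
    "((nat \<Rightarrow> nat) \<Rightarrow> 'y \<Rightarrow> 'y) \<Rightarrow> (nat \<Rightarrow> nat) \<Rightarrow> 'y \<Rightarrow> 'y" where
  "inc_act act \<pi> y =
     act (SOME \<sigma>. \<sigma> \<in> carrier SymN \<and> (\<exists>k. supported_by act y k \<and> (\<forall>i<k. \<sigma> i = \<pi> i))) y"

lemma inc_act_eq:
  assumes action: "group_action SymN E \<phi>" and y: "y \<in> E"
    and \<sigma>: "\<sigma> \<in> carrier SymN" and k: "supported_by \<phi> y k" and agree: "\<forall>i<k. \<sigma> i = \<pi> i"
  shows "inc_act \<phi> \<pi> y = \<phi> \<sigma> y"
proof -
  define \<tau> where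
    "\<tau> = (SOME \<sigma>. \<sigma> \<in> carrier SymN \<and> (\<exists>k. supported_by \<phi> y k \<and> (\<forall>i<k. \<sigma> i = \<pi> i)))"
  have "\<tau> \<in> carrier SymN \<and> (\<exists>k. supported_by \<phi> y k \<and> (\<forall>i<k. \<tau> i = \<pi> i))"
    unfolding \<tau>_def by (rule someI[of _ \<sigma>]) (use \<sigma> k agree in blast)
  then obtain l where \<tau>: "\<tau> \<in> carrier SymN"
    and l: "supported_by \<phi> y l" "\<forall>i<l. \<tau> i = \<pi> i" by blast
  define n where "n = min k l"
  have n: "supported_by \<phi> y n" "\<forall>i<n. \<sigma> i = \<tau> i"
    using k l agree by (auto simp: n_def min_def)
  have bij: "bij \<sigma>" "bij \<tau>"
    using \<sigma> \<tau> by (auto simp: BijGroup_def Bij_def)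
  define \<rho> where "\<rho> = the_inv \<tau> \<circ> \<sigma>"
  have \<rho>: "\<rho> \<in> carrier SymN"
    using bij by (auto simp: \<rho>_def BijGroup_def Bij_def bij_betw_the_inv_into intro: bij_comp)
  have "\<forall>i<n. \<rho> i = i"
    using n(2) bij by (auto simp: \<rho>_def bij_def the_inv_f_f)
  then have fix_y: "\<phi> \<rho> y = y"
    using n(1) \<rho> by (auto simp: supported_by_def)
  have "\<tau> \<otimes>\<^bsub>SymN\<^esub> \<rho> = \<sigma>"
    using bij \<rho> \<tau> by (auto simp: BijGroup_def \<rho>_def compose_def bij_def f_the_inv_into_f)
  then have "\<phi> \<sigma> y = \<phi> \<tau> (\<phi> \<rho> y)"
    using group_action.composition_rule[OF action y \<tau> \<rho>] by simp
  then show ?thesis by (simp add: fix_y inc_act_def \<tau>_def)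
qed

text \<open>The pair \<open>(i, j)\<close> stands for the variable $z_{ij}$.\<close>

definition z_vars :: "nat \<Rightarrow> (nat \<times> nat) set" where
  "z_vars k = {..<k} \<times> UNIV"

definition z_act :: "(nat \<Rightarrow> nat) \<Rightarrow> nat \<times> nat \<Rightarrow> nat \<times> nat" where
  "z_act \<pi> = (\<lambda>(i, j). (i, \<pi> j))"

section \<open>Noetherianity up to a monoid action\<close>

locale ring_action = monoid M + ring S
  for M :: "('m, 'n) monoid_scheme" and S :: "('a, 'b) ring_scheme"
  and \<alpha> :: "'m \<Rightarrow> 'a \<Rightarrow> 'a" +
  assumes endomorphism: "\<pi> \<in> carrier M \<Longrightarrow> \<alpha> \<pi> \<in> ring_hom S S"
    and act_one: "f \<in> carrier S \<Longrightarrow> \<alpha> \<one>\<^bsub>M\<^esub> f = f"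
    and act_mult: "\<pi> \<in> carrier M \<Longrightarrow> \<rho> \<in> carrier M \<Longrightarrow> f \<in> carrier S \<Longrightarrow>
                   \<alpha> (\<pi> \<otimes>\<^bsub>M\<^esub> \<rho>) f = \<alpha> \<pi> (\<alpha> \<rho> f)"

locale noetherian_ring_action = ring_action M S \<alpha>
  for M :: "('m, 'n) monoid_scheme" and S :: "('a, 'b) ring_scheme"
  and \<alpha> :: "'m \<Rightarrow> 'a \<Rightarrow> 'a" +
  assumes stable_ideal_fin_gen:
    "ideal I S \<Longrightarrow> (\<And>\<pi> f. \<pi> \<in> carrier M \<Longrightarrow> f \<in> I \<Longrightarrow> \<alpha> \<pi> f \<in> I) \<Longrightarrow>
     \<exists>F. finite F \<and> F \<subseteq> carrier S \<and> I = Idl\<^bsub>S\<^esub> (\<Union>f\<in>F. orbit M \<alpha> f)"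

end

theory Submission
  imports Defs "HOL-Library.Sublist" "HOL-Library.Multiset_Order" "HOL-Library.Product_Lexorder"
begin

text \<open>
Every variable has the form \<open>y = \<sigma> y\<^sub>p\<close> with \<open>y\<^sub>p\<close> one of finitely many orbit representatives, and \<open>y\<close>
depends only on the restriction of \<open>\<sigma>\<close> to \<open>{..<K}\<close>, where one \<open>K\<close> supports all representatives. So \<open>y\<close> is
described by a matching \<open>(p, J)\<close>: a colour \<open>p\<close> and a list \<open>J\<close> of \<open>K\<close> distinct numbers. By equivariance the
image of \<open>y\<close> only involves the columns in \<open>J\<close>, and the map on monomials factors as
\<open>(p, J) \<mapsto> \<Sum>\<^sub>l (p, l, J\<^sub>l)\<close>, followed by a homomorphism that is defined cell by cell. The image of the first
map, the matching monoid, consists of finite arrays of natural numbers with rows \<open>(p, l)\<close> and columns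
\<open>j\<close>. Both halves of the theorem reduce to facts about this monoid.

It is described by linear conditions (\<open>matching_monoid_iff\<close>): for each \<open>p\<close> the \<open>K\<close> rows have a common
sum \<open>d\<^sub>p\<close>, and no column sum exceeds \<open>d\<^sub>p\<close>. This is an edge-colouring theorem of Koenig type, proved here by
repeatedly balancing two colour classes.

Up to increasing maps, divisibility in the matching monoid is almost full (\<open>matching_monoid_almost_full\<close>).
The difficulty is that a quotient must satisfy the column conditions too, so columns that are not matched
have to leave enough room. Along a subsequence each \<open>d\<^sub>p\<close> is constant or at least doubles. Then only
boundedly many columns are too full to be left unmatched, and Higman's lemma, with letters that
record whether a column is one of these, produces the division. With a well-order on monomials that
increasing maps respect, a Groebner basis argument turns this into Noetherianity of the
algebra of the matching monoid (\<open>noetherian_if_almost_full\<close>), and Noetherianity passes to the image of \<open>\<phi>\<close>.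

For the kernel, two multisets of matchings with the same sum are connected by moves that exchange at most
\<open>2 K\<close> matchings at a time (\<open>connected_by_bounded_moves\<close>); up to increasing maps there are finitely many such
moves. Modulo these binomials a polynomial in \<open>R[Y]\<close> is a polynomial over the matching monoid, where
Noetherianity yields finitely many further binomials that generate the rest of the kernel.

If \<open>1 = 0\<close> in \<open>R\<close>, the exponent of a monomial cannot be recovered from \<open>\<phi>\<close>; then all rings in question are
zero.
\<close>

abbreviation (input) keys :: "('a \<Rightarrow>\<^sub>0 'b::zero) \<Rightarrow> 'a set" where
  "keys \<equiv> Poly_Mapping.keys"

abbreviation (input) lookup :: "('a \<Rightarrow>\<^sub>0 'b::zero) \<Rightarrow> 'a \<Rightarrow> 'b" where
  "lookup \<equiv> Poly_Mapping.lookup"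

abbreviation (input) single :: "'a \<Rightarrow> 'b \<Rightarrow> 'a \<Rightarrow>\<^sub>0 'b::zero" where
  "single \<equiv> Poly_Mapping.single"

section \<open>Almost full relations and Higman's lemma\<close>

definition almost_full_on :: "'a set \<Rightarrow> ('a \<Rightarrow> 'a \<Rightarrow> bool) \<Rightarrow> bool" where
  "almost_full_on A P \<longleftrightarrow> (\<forall>f :: nat \<Rightarrow> 'a. (\<forall>n. f n \<in> A) \<longrightarrow> (\<exists>i j. i < j \<and> P (f i) (f j)))"

abbreviation almost_full :: "('a \<Rightarrow> 'a \<Rightarrow> bool) \<Rightarrow> bool" where
  "almost_full \<equiv> almost_full_on UNIV"

lemma almost_full_onD: "almost_full_on A P \<Longrightarrow> (\<And>n. f n \<in> A) \<Longrightarrow> \<exists>i j :: nat. i < j \<and> P (f i) (f j)"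
  by (auto simp: almost_full_on_def)

text \<open>
Only finitely many terms have no later term above them, since these terms would form a sequence without
a good pair. Beyond them one always finds a next term.
\<close>

lemma almost_full_on_chain:
  fixes f :: "nat \<Rightarrow> 'a"
  assumes af: "almost_full_on A P" and tr: "transp P" and f: "\<And>n. f n \<in> A"
  shows "\<exists>r :: nat \<Rightarrow> nat. strict_mono r \<and> (\<forall>i j. i < j \<longrightarrow> P (f (r i)) (f (r j)))"
proof -
  define T where "T = {n. \<forall>m>n. \<not> P (f n) (f m)}"
  have "finite T"
  proof (rule ccontr)
    assume inf: "infinite T"
    obtain i j where ij: "i < j" "P (f (enumerate T i)) (f (enumerate T j))"
      using almost_full_onD[OF af, of "\<lambda>n. f (enumerate T n)"] f by blast
    moreover have "enumerate T i \<in> T" "enumerate T i < enumerate T j"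
      using inf ij by (auto simp: enumerate_in_set enumerate_mono)
    ultimately show False by (auto simp: T_def)
  qed
  then obtain b where b: "\<forall>n\<in>T. n < b"
    using finite_nat_set_iff_bounded by blast
  have "\<exists>r :: nat \<Rightarrow> nat. \<forall>n. b \<le> r n \<and> (r n < r (Suc n) \<and> P (f (r n)) (f (r (Suc n))))"
  proof (rule dependent_nat_choice)
    show "\<exists>x. b \<le> x" by blast
    fix x n assume "b \<le> x"
    then have "x \<notin> T" using b by auto
    then obtain m where "m > x" "P (f x) (f m)" by (auto simp: T_def)
    then show "\<exists>y. b \<le> y \<and> (x < y \<and> P (f x) (f y))" using \<open>b \<le> x\<close> by (intro exI[of _ m]) auto
  qed
  then obtain r :: "nat \<Rightarrow> nat" where r: "\<And>n. r n < r (Suc n)" "\<And>n. P (f (r n)) (f (r (Suc n)))" by blast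
  have "P (f (r i)) (f (r j))" if "i < j" for i j
    using that
  proof (induction j)
    case (Suc j)
    then show ?case using r(2)[of j] tr by (cases "i = j") (auto dest: transpD)
  qed simp
  then show ?thesis using r(1) by (auto simp: strict_mono_Suc_iff)
qed

lemma almost_full_prod:
  assumes P: "almost_full P" "transp P" and Q: "almost_full Q"
  shows "almost_full (\<lambda>x y. P (f x) (f y) \<and> Q (g x) (g y))"
  unfolding almost_full_on_def
proof (intro allI impI)
  fix s :: "nat \<Rightarrow> 'c"
  obtain r :: "nat \<Rightarrow> nat" where r: "strict_mono r" "\<And>i j. i < j \<Longrightarrow> P (f (s (r i))) (f (s (r j)))"
    using almost_full_on_chain[OF P, of "\<lambda>n. f (s n)"] by auto
  obtain i j where ij: "i < j" "Q (g (s (r i))) (g (s (r j)))"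
    using almost_full_onD[OF Q, of "\<lambda>n. g (s (r n))"] by auto
  then show "\<exists>i j. i < j \<and> P (f (s i)) (f (s j)) \<and> Q (g (s i)) (g (s j))"
    using r by (intro exI[of _ "r i"] exI[of _ "r j"]) (auto simp: strict_mono_less)
qed

lemma almost_full_nat_le: "almost_full ((\<le>) :: nat \<Rightarrow> nat \<Rightarrow> bool)"
  unfolding almost_full_on_def
proof (intro allI impI, rule ccontr)
  fix f :: "nat \<Rightarrow> nat"
  assume "\<nexists>i j. i < j \<and> f i \<le> f j"
  then have "\<And>i. f (Suc i) < f i" by (meson lessI not_less)
  then show False using wf_less_than unfolding wf_iff_no_infinite_down_chain by auto
qed

lemma almost_full_eq_bool: "almost_full ((=) :: bool \<Rightarrow> bool \<Rightarrow> bool)"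
  unfolding almost_full_on_def
proof (intro allI impI)
  fix f :: "nat \<Rightarrow> bool"
  have "f 0 = f 1 \<or> f 0 = f 2 \<or> f 1 = f 2" by auto
  then show "\<exists>i j. i < j \<and> f i = f j" by (metis one_less_numeral_iff semiring_norm(76) zero_less_numeral zero_less_one)
qed

lemma dickson:
  assumes "finite D"
  shows "almost_full (\<lambda>u v :: 'x \<Rightarrow> nat. \<forall>x\<in>D. u x \<le> v x)"
  using assms
proof (induction D)
  case empty
  show ?case by (auto simp: almost_full_on_def)
next
  case (insert x D)
  have "almost_full (\<lambda>u v :: 'x \<Rightarrow> nat. u x \<le> v x \<and> (\<forall>x\<in>D. u x \<le> v x))"
    using almost_full_prod[OF almost_full_nat_le _ insert.IH, of "\<lambda>u. u x" "\<lambda>u. u"] by (simp add: transp_def)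
  then show ?case by simp
qed

definition bad :: "('a \<Rightarrow> 'a \<Rightarrow> bool) \<Rightarrow> (nat \<Rightarrow> 'a) \<Rightarrow> bool" where
  "bad P f \<longleftrightarrow> (\<forall>i j. i < j \<longrightarrow> \<not> P (f i) (f j))"

text \<open>
Nash-Williams: choose the terms one after the other, each as small as possible among all bad sequences
with the same initial terms. The sequence \<open>s n\<close> is bad and agrees with the result below \<open>n\<close>.
\<close>

lemma minimal_bad_sequence:
  fixes f :: "nat \<Rightarrow> 'a" and w :: "'a \<Rightarrow> nat"
  assumes "bad P f"
  shows "\<exists>m. bad P m \<and> (\<forall>n g. bad P g \<longrightarrow> (\<forall>i<n. g i = m i) \<longrightarrow> w (m n) \<le> w (g n))"
proof -
  define nxt where "nxt s n t \<longleftrightarrow> bad P t \<and> (\<forall>i<n. t i = s i) \<and>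
     (\<forall>g. bad P g \<longrightarrow> (\<forall>i<n. g i = s i) \<longrightarrow> w (t n) \<le> w (g n))" for s n t
  have "\<exists>s :: nat \<Rightarrow> nat \<Rightarrow> 'a. \<forall>n. bad P (s n) \<and> nxt (s n) n (s (Suc n))"
  proof (rule dependent_nat_choice[where P = "\<lambda>n. bad P" and Q = "\<lambda>n s t. nxt s n t"])
    show "\<exists>s :: nat \<Rightarrow> 'a. bad P s" by (rule exI[of _ f]) (fact assms)
    fix s :: "nat \<Rightarrow> 'a" and n :: nat assume "bad P s"
    then have "bad P s \<and> (\<forall>i<n. s i = s i)" by simp
    from ex_has_least_nat[where P = "\<lambda>t. bad P t \<and> (\<forall>i<n. t i = s i)" and m = "\<lambda>t. w (t n)", OF this]
    obtain t where "bad P t \<and> (\<forall>i<n. t i = s i)"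
      and "\<forall>g. bad P g \<and> (\<forall>i<n. g i = s i) \<longrightarrow> w (t n) \<le> w (g n)" by (elim exE conjE) simp
    then show "\<exists>t. bad P t \<and> nxt s n t" by (auto simp: nxt_def)
  qed
  then obtain s :: "nat \<Rightarrow> nat \<Rightarrow> 'a" where s: "\<And>n. bad P (s n)" "\<And>n. nxt (s n) n (s (Suc n))" by blast
  have stable: "s n i = s (Suc i) i" if "i < n" for n i
    using that
  proof (induction n)
    case (Suc n)
    show ?case
    proof (cases "i = n")
      case False
      then have "i < n" using Suc by simp
      then show ?thesis using Suc.IH s(2)[of n] by (simp add: nxt_def)
    qed simp
  qed simp
  define m where "m n = s (Suc n) n" for n
  have m: "m i = s n i" if "i < n" for i n using stable[OF that] by (simp add: m_def)
  have "bad P m"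
    unfolding bad_def
  proof (intro allI impI)
    fix i j :: nat assume "i < j"
    then show "\<not> P (m i) (m j)"
      using s(1)[of "Suc j"] m[of i "Suc j"] m[of j "Suc j"] by (auto simp: bad_def)
  qed
  moreover have "w (m n) \<le> w (g n)" if g: "bad P g" "\<forall>i<n. g i = m i" for n g
  proof -
    have "\<forall>i<n. g i = s n i" using g m by auto
    then show ?thesis using s(2)[of n] g(1) by (auto simp: nxt_def m_def)
  qed
  ultimately show ?thesis by blast
qed

text \<open>
In a minimal bad sequence, the words whose heads form an ascending chain are replaced by their tails. This
gives a bad sequence that is smaller at its first change.
\<close>

theorem higman:
  assumes P: "almost_full P" "transp P"
  shows "almost_full (list_emb P)"
proof (rule ccontr)
  assume "\<not> almost_full (list_emb P)"
  then obtain f :: "nat \<Rightarrow> 'a list" where "bad (list_emb P) f" by (auto simp: almost_full_on_def bad_def)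
  from minimal_bad_sequence[OF this, of length]
  obtain m :: "nat \<Rightarrow> 'a list" where m: "bad (list_emb P) m"
    "\<And>n g. bad (list_emb P) g \<Longrightarrow> \<forall>i<n. g i = m i \<Longrightarrow> length (m n) \<le> length (g n)" by blast
  have ne: "m n \<noteq> []" for n
    using m(1) unfolding bad_def by (metis lessI list_emb_Nil)
  obtain r :: "nat \<Rightarrow> nat" where r: "strict_mono r" "\<And>i j. i < j \<Longrightarrow> P (hd (m (r i))) (hd (m (r j)))"
    using almost_full_on_chain[OF P, of "\<lambda>n. hd (m n)"] by auto
  define g where "g n = (if n < r 0 then m n else tl (m (r (n - r 0))))" for n
  have tl_emb: "list_emb P xs (m n)" if "list_emb P xs (tl (m n))" for xs n
    using that ne[of n] by (cases "m n") auto
  have r0: "r 0 \<le> r i" for i using r(1) by (simp add: strict_mono_less_eq)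
  have "bad (list_emb P) g"
    unfolding bad_def
  proof (intro allI impI notI)
    fix i j :: nat assume ij: "i < j" and emb: "list_emb P (g i) (g j)"
    show False
    proof (cases "j < r 0")
      case True
      then show False using emb ij m(1) by (auto simp: g_def bad_def)
    next
      case j: False
      show False
      proof (cases "i < r 0")
        case True
        then have "list_emb P (m i) (m (r (j - r 0)))" using emb j by (auto simp: g_def intro: tl_emb)
        moreover have "i < r (j - r 0)" using True r0 order.strict_trans2 by blast
        ultimately show False using m(1) by (auto simp: bad_def)
      next
        case False
        define a b where "a = r (i - r 0)" and "b = r (j - r 0)"
        have "a < b" using False j ij r(1) by (auto simp: a_def b_def strict_mono_less)
        moreover have "P (hd (m a)) (hd (m b))" using False j ij r(2) by (auto simp: a_def b_def)
        moreover have "list_emb P (tl (m a)) (tl (m b))" using emb False j by (simp add: g_def a_def b_def)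
        ultimately have "list_emb P (m a) (m b)"
          using ne[of a] ne[of b] by (cases "m a"; cases "m b") auto
        then show False using m(1) \<open>a < b\<close> by (auto simp: bad_def)
      qed
    qed
  qed
  then have "length (m (r 0)) \<le> length (g (r 0))" by (rule m(2)) (simp add: g_def)
  moreover have "length (g (r 0)) < length (m (r 0))" using ne[of "r 0"] by (simp add: g_def)
  ultimately show False by simp
qed

lemma list_emb_positions:
  assumes "list_emb P xs ys"
  shows "\<exists>h. strict_mono_on {..<length xs} h \<and> h ` {..<length xs} \<subseteq> {..<length ys} \<and>
             (\<forall>i<length xs. P (xs ! i) (ys ! (h i)))"
  using assms
proof induction
  case (list_emb_Nil ys)
  then show ?case by (simp add: strict_mono_on_def)
next
  case (list_emb_Cons xs ys y)
  then obtain h where "strict_mono_on {..<length xs} h" "h ` {..<length xs} \<subseteq> {..<length ys}"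
    "\<forall>i<length xs. P (xs ! i) (ys ! (h i))" by blast
  then show ?case by (intro exI[of _ "\<lambda>i. Suc (h i)"]) (auto simp: strict_mono_on_def)
next
  case (list_emb_Cons2 x y xs ys)
  then obtain h where "strict_mono_on {..<length xs} h" "h ` {..<length xs} \<subseteq> {..<length ys}"
    "\<forall>i<length xs. P (xs ! i) (ys ! (h i))" by blast
  then show ?case using list_emb_Cons2.hyps
    by (intro exI[of _ "\<lambda>i. case i of 0 \<Rightarrow> 0 | Suc i \<Rightarrow> Suc (h i)"])
      (auto simp: strict_mono_on_def nth_Cons image_subset_iff split: nat.splits)
qed

text \<open>
If no value is taken infinitely often, the sequence tends to infinity.
\<close>

lemma nat_seq_constant_or_doubling:
  fixes d :: "nat \<Rightarrow> nat"
  shows "\<exists>r :: nat \<Rightarrow> nat. strict_mono r \<and> ((\<forall>i j. d (r i) = d (r j)) \<or> (\<forall>i j. i < j \<longrightarrow> 2 * d (r i) \<le> d (r j)))"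
proof (cases "\<exists>v. infinite {n. d n = v}")
  case True
  then obtain v where v: "infinite {n. d n = v}" by blast
  then have "d (enumerate {n. d n = v} i) = v" for i
    using enumerate_in_set[OF v, of i] by simp
  moreover have "strict_mono (enumerate {n. d n = v})" using v by (rule strict_mono_enumerate)
  ultimately show ?thesis by (intro exI[of _ "enumerate {n. d n = v}"]) simp
next
  case False
  have step: "\<exists>m>n. b \<le> d m" for n b
  proof (rule ccontr)
    assume "\<not> ?thesis"
    then have "{n<..} \<subseteq> (\<Union>v<b. {n. d n = v})" by (auto simp: not_le)
    then have "finite {n<..}" using False by (meson finite_UN_I finite_lessThan finite_subset)
    then show False using infinite_Ioi by blast
  qed
  have "\<exists>r :: nat \<Rightarrow> nat. \<forall>n. True \<and> (r n < r (Suc n) \<and> 2 * d (r n) \<le> d (r (Suc n)))"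
    by (rule dependent_nat_choice) (use step in auto)
  then obtain r :: "nat \<Rightarrow> nat" where r: "\<And>n. r n < r (Suc n)" "\<And>n. 2 * d (r n) \<le> d (r (Suc n))" by blast
  have "2 * d (r i) \<le> d (r j)" if "i < j" for i j
    using that
  proof (induction j)
    case (Suc j)
    then show ?case using r(2)[of j] by (cases "i = j") auto
  qed simp
  then show ?thesis using r(1) by (auto simp: strict_mono_Suc_iff)
qed

lemma nat_seqs_constant_or_doubling:
  fixes d :: "'p \<Rightarrow> nat \<Rightarrow> nat"
  assumes "finite D"
  shows "\<exists>r :: nat \<Rightarrow> nat. strict_mono r \<and>
    (\<forall>p\<in>D. (\<forall>i j. d p (r i) = d p (r j)) \<or> (\<forall>i j. i < j \<longrightarrow> 2 * d p (r i) \<le> d p (r j)))"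
  using assms
proof (induction D)
  case empty
  show ?case by (intro exI[of _ "\<lambda>n. n"]) (simp add: strict_mono_def)
next
  case (insert q D)
  then obtain r :: "nat \<Rightarrow> nat" where r: "strict_mono r"
    "\<forall>p\<in>D. (\<forall>i j. d p (r i) = d p (r j)) \<or> (\<forall>i j. i < j \<longrightarrow> 2 * d p (r i) \<le> d p (r j))" by blast
  obtain s :: "nat \<Rightarrow> nat" where s: "strict_mono s"
    "(\<forall>i j. d q (r (s i)) = d q (r (s j))) \<or> (\<forall>i j. i < j \<longrightarrow> 2 * d q (r (s i)) \<le> d q (r (s j)))"
    using nat_seq_constant_or_doubling[of "\<lambda>n. d q (r n)"] by blast
  have "(\<forall>i j. d p (r (s i)) = d p (r (s j))) \<or> (\<forall>i j. i < j \<longrightarrow> 2 * d p (r (s i)) \<le> d p (r (s j)))"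
    if "p \<in> insert q D" for p
    using r(2) s that by (auto simp: strict_mono_less)
  moreover have "strict_mono (\<lambda>i. r (s i))" using r(1) s(1) by (simp add: strict_mono_def)
  ultimately show ?case
    by (intro exI[of _ "\<lambda>i. r (s i)"]) blast
qed

section \<open>Rearranging the rows of an array into injections\<close>

definition fibre_card :: "'l set \<Rightarrow> ('l \<Rightarrow> 'c) \<Rightarrow> 'c \<Rightarrow> nat" where
  "fibre_card L u c = card {l \<in> L. u l = c}"

lemma fibre_card_empty [simp]: "fibre_card {} u c = 0"
  by (simp add: fibre_card_def)

lemma fibre_card_insert:
  assumes "finite L" "l \<notin> L"
  shows "fibre_card (insert l L) u c = fibre_card L u c + (if u l = c then 1 else 0)"
proof -
  have "{x \<in> insert l L. u x = c} = (if u l = c then insert l {x \<in> L. u x = c} else {x \<in> L. u x = c})"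
    by auto
  then show ?thesis using assms by (simp add: fibre_card_def)
qed

lemma fibre_card_cong: "(\<And>l. l \<in> L \<Longrightarrow> u l = v l) \<Longrightarrow> fibre_card L u c = fibre_card L v c"
  unfolding fibre_card_def by (rule arg_cong[where f = card]) auto

definition reorients :: "'l set \<Rightarrow> ('l \<Rightarrow> 'c) \<Rightarrow> ('l \<Rightarrow> 'c) \<Rightarrow> ('l \<Rightarrow> 'c) \<Rightarrow> ('l \<Rightarrow> 'c) \<Rightarrow> bool" where
  "reorients L u v u' v' \<longleftrightarrow>
     (\<forall>l\<in>L. (u' l = u l \<and> v' l = v l) \<or> (u' l = v l \<and> v' l = u l))"

text \<open>
The index \<open>l\<close> is an edge between the vertices \<open>u l\<close> and \<open>v l\<close>, and an orientation is wanted in which in- and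
outdegree differ by at most one at every vertex. A loop contributes equally to both degrees of its vertex.
Two edges with a common vertex \<open>x\<close> can be replaced by a single edge that joins their other ends: orienting
it orients the path through \<open>x\<close>. If neither step applies, all degrees are at most one.
\<close>

lemma balanced_orientation:
  fixes u v :: "'l \<Rightarrow> 'c"
  assumes "finite L"
  shows "\<exists>u' v'. reorients L u v u' v' \<and>
    (\<forall>c. fibre_card L u' c \<le> fibre_card L v' c + 1 \<and> fibre_card L v' c \<le> fibre_card L u' c + 1)"
  using assms
proof (induction "card L" arbitrary: L u v rule: less_induct)
  case less
  consider (loop) l where "l \<in> L" "u l = v l"
    | (path) l l' where "l \<in> L" "l' \<in> L" "l \<noteq> l'" "{u l, v l} \<inter> {u l', v l'} \<noteq> {}"
    | (disjoint) "\<forall>l\<in>L. u l \<noteq> v l" "\<forall>l\<in>L. \<forall>l'\<in>L. l \<noteq> l' \<longrightarrow> {u l, v l} \<inter> {u l', v l'} = {}"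
    by metis
  then show ?case
  proof cases
    case loop
    define L0 where "L0 = L - {l}"
    have L: "L = insert l L0" "l \<notin> L0" "finite L0" using loop less.prems by (auto simp: L0_def)
    then have "card L0 < card L" by simp
    then obtain u' v' where IH: "reorients L0 u v u' v'" "\<And>c. fibre_card L0 u' c \<le> fibre_card L0 v' c + 1"
      "\<And>c. fibre_card L0 v' c \<le> fibre_card L0 u' c + 1" using less.hyps[of L0 u v] L by blast
    have eq: "fibre_card L0 (u'(l := x)) c = fibre_card L0 u' c" "fibre_card L0 (v'(l := x)) c = fibre_card L0 v' c" for x c
      by (rule fibre_card_cong; use L in auto)+
    have "reorients L u v (u'(l := u l)) (v'(l := v l))" using IH(1) L by (auto simp: reorients_def)
    moreover have "fibre_card L (u'(l := u l)) c \<le> fibre_card L (v'(l := v l)) c + 1"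
      "fibre_card L (v'(l := v l)) c \<le> fibre_card L (u'(l := u l)) c + 1" for c
      using IH(2,3)[of c] loop L by (simp_all add: fibre_card_insert eq)
    ultimately show ?thesis by blast
  next
    case path
    define L0 where "L0 = L - {l, l'}"
    have L: "L = insert l (insert l' L0)" "l \<notin> L0" "l' \<notin> L0" "finite L0" "l \<noteq> l'"
      using path less.prems by (auto simp: L0_def)
    then have "card (insert l L0) < card L" by simp
    obtain x a b where x: "u l = a \<and> v l = x \<or> u l = x \<and> v l = a" "u l' = x \<and> v l' = b \<or> u l' = b \<and> v l' = x"
      using path(4) by blast
    obtain u' v' where IH: "reorients (insert l L0) (u(l := a)) (v(l := b)) u' v'"
      "\<And>c. fibre_card (insert l L0) u' c \<le> fibre_card (insert l L0) v' c + 1"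
      "\<And>c. fibre_card (insert l L0) v' c \<le> fibre_card (insert l L0) u' c + 1"
      using less.hyps[OF \<open>card (insert l L0) < card L\<close>, of "u(l := a)" "v(l := b)"] L by blast
    have eq: "fibre_card L0 (u'(l := y, l' := z)) c = fibre_card L0 u' c"
      "fibre_card L0 (v'(l := y, l' := z)) c = fibre_card L0 v' c" for y z c
      by (rule fibre_card_cong; use L in auto)+
    have "u' l = a \<and> v' l = b \<or> u' l = b \<and> v' l = a" using IH(1) by (auto simp: reorients_def)
    then show ?thesis
    proof
      assume *: "u' l = a \<and> v' l = b"
      \<comment> \<open>the joined edge is oriented from \<open>a\<close> to \<open>b\<close>: orient the path as \<open>a \<rightarrow> x \<rightarrow> b\<close>\<close>
      let ?u = "u'(l := a, l' := x)" and ?v = "v'(l := x, l' := b)"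
      have "reorients L u v ?u ?v" using IH(1) x L by (auto simp: reorients_def)
      moreover have "fibre_card L ?u c \<le> fibre_card L ?v c + 1" "fibre_card L ?v c \<le> fibre_card L ?u c + 1" for c
        using IH(2,3)[of c] * L by (simp_all add: fibre_card_insert eq split: if_splits)
      ultimately show ?thesis by blast
    next
      assume *: "u' l = b \<and> v' l = a"
      let ?u = "u'(l := x, l' := b)" and ?v = "v'(l := a, l' := x)"
      have "reorients L u v ?u ?v" using IH(1) x L by (auto simp: reorients_def)
      moreover have "fibre_card L ?u c \<le> fibre_card L ?v c + 1" "fibre_card L ?v c \<le> fibre_card L ?u c + 1" for c
        using IH(2,3)[of c] * L by (simp_all add: fibre_card_insert eq split: if_splits)
      ultimately show ?thesis by blast
    qed
  next
    case disjoint
    have one: "fibre_card L u c \<le> 1" "fibre_card L v c \<le> 1" for c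
      unfolding fibre_card_def using disjoint(2) less.prems by (auto simp: card_le_Suc0_iff_eq)
    then have "fibre_card L u c \<le> fibre_card L v c + 1 \<and> fibre_card L v c \<le> fibre_card L u c + 1" for c
      using one[of c] by linarith
    then show ?thesis by (intro exI[of _ u] exI[of _ v]) (simp add: reorients_def)
  qed
qed

lemma reorients_fibre_card:
  assumes "finite L" "reorients L u v u' v'"
  shows "fibre_card L u' c + fibre_card L v' c = fibre_card L u c + fibre_card L v c"
  using assms
proof (induction L)
  case (insert l L)
  have IH: "fibre_card L u' c + fibre_card L v' c = fibre_card L u c + fibre_card L v c"
    using insert.prems by (intro insert.IH) (simp add: reorients_def)
  have "(u' l = u l \<and> v' l = v l) \<or> (u' l = v l \<and> v' l = u l)"
    using insert.prems by (simp add: reorients_def)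
  then show ?case using IH by (elim disjE conjE) (simp_all add: fibre_card_insert[OF insert.hyps])
qed simp

text \<open>
Since \<open>2 (a\<^sup>2 + b\<^sup>2) = (a + b)\<^sup>2 + (a - b)\<^sup>2\<close>, a sum of two squares with given total is least when
the difference is; parity excludes \<open>c = d\<close> if \<open>a\<close> and \<open>b\<close> differ by one.
\<close>

lemma sum_squares_balanced_le:
  fixes a b c d :: nat
  assumes "a + b = c + d" "a \<le> b + 1" "b \<le> a + 1"
  shows "a\<^sup>2 + b\<^sup>2 \<le> c\<^sup>2 + d\<^sup>2"
proof -
  define x y where "x = int a - int b" and "y = int c - int d"
  have squares: "2 * (int a ^ 2 + int b ^ 2) = (int a + int b)\<^sup>2 + x\<^sup>2" "2 * (int c ^ 2 + int d ^ 2) = (int c + int d)\<^sup>2 + y\<^sup>2"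
    by (simp_all add: x_def y_def power2_eq_square algebra_simps)
  have le: "x\<^sup>2 \<le> y\<^sup>2"
  proof (cases "x = 0")
    case False
    then have "x = 1 \<or> x = -1" using assms by (auto simp: x_def)
    have "y \<noteq> 0"
    proof
      assume "y = 0"
      then have "a + b = 2 * d" using assms(1) by (simp add: y_def)
      moreover have "a = b + 1 \<or> b = a + 1" using \<open>x = 1 \<or> x = -1\<close> by (auto simp: x_def)
      ultimately show False by presburger
    qed
    then have "0 < y\<^sup>2" by simp
    moreover have "x\<^sup>2 = 1" using \<open>x = 1 \<or> x = -1\<close> by auto
    ultimately show ?thesis by linarith
  qed simp
  have "int a + int b = int c + int d" using assms(1) by simp
  then have "2 * (int a ^ 2 + int b ^ 2) \<le> 2 * (int c ^ 2 + int d ^ 2)"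
    unfolding squares using le by simp
  then have "int a ^ 2 + int b ^ 2 \<le> int c ^ 2 + int d ^ 2" by simp
  then have "int (a\<^sup>2 + b\<^sup>2) \<le> int (c\<^sup>2 + d\<^sup>2)" by simp
  then show ?thesis by (simp only: of_nat_le_iff)
qed

lemma sum_squares_balanced_less:
  fixes a b c :: nat
  assumes "a + b = c" "a \<le> b + 1" "b \<le> a + 1" "2 \<le> c"
  shows "a\<^sup>2 + b\<^sup>2 < c\<^sup>2"
proof -
  have "0 < a" "0 < b" using assms by auto
  then show ?thesis unfolding assms(1)[symmetric] by (simp add: power2_sum)
qed

lemma count_image_mset_set:
  "finite A \<Longrightarrow> count (image_mset f (mset_set A)) c = card {a \<in> A. f a = c}"
proof (induction A rule: finite_induct)
  case (insert a A)
  have "{x \<in> insert a A. f x = c} = (if f a = c then insert a {x \<in> A. f x = c} else {x \<in> A. f x = c})" by auto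
  then show ?case using insert by simp
qed simp

text \<open>
Think of \<open>F i l\<close> as the column of the \<open>i\<close>-th entry in row \<open>l\<close>; entries may be permuted within each row. If
\<open>F' i\<close> uses a column \<open>c\<close> twice, then some \<open>F' i'\<close> does not use it, as \<open>c\<close> is used at most \<open>d\<close> times. Exchanging
entries between \<open>F' i\<close> and \<open>F' i'\<close> along a balanced orientation spreads every column evenly over the two and
so lowers the sum of the squared usage numbers. Hence an arrangement that minimises this sum is injective.
\<close>

lemma rearrange_into_injections:
  fixes F :: "nat \<Rightarrow> 'l \<Rightarrow> 'c"
  assumes L: "finite L" and cols: "\<And>c. (\<Sum>l\<in>L. card {i \<in> {..<d}. F i l = c}) \<le> d"
  shows "\<exists>F'. (\<forall>i<d. inj_on (F' i) L) \<and>
    (\<forall>l\<in>L. image_mset (\<lambda>i. F' i l) (mset_set {..<d}) = image_mset (\<lambda>i. F i l) (mset_set {..<d}))"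
proof -
  define C where "C = (\<lambda>(i, l). F i l) ` ({..<d} \<times> L)"
  have "finite C" using L by (simp add: C_def)
  define Q where "Q F' \<longleftrightarrow>
    (\<forall>l\<in>L. image_mset (\<lambda>i. F' i l) (mset_set {..<d}) = image_mset (\<lambda>i. F i l) (mset_set {..<d}))" for F'
  define \<Phi> where "\<Phi> F' = (\<Sum>i<d. \<Sum>c\<in>C. (fibre_card L (F' i) c)\<^sup>2)" for F'
  have "Q F" by (simp add: Q_def)
  from ex_has_least_nat[where P = Q and m = \<Phi>, OF this]
  obtain F' where F': "Q F'" and least: "\<And>F''. Q F'' \<Longrightarrow> \<Phi> F' \<le> \<Phi> F''" by blast
  have "inj_on (F' i) L" if i: "i < d" for i
  proof (rule ccontr)
    assume "\<not> inj_on (F' i) L"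
    then obtain l l' where l: "l \<in> L" "l' \<in> L" "l \<noteq> l'" "F' i l = F' i l'" by (auto simp: inj_on_def)
    define c where "c = F' i l"
    have two: "2 \<le> fibre_card L (F' i) c"
    proof -
      have "{l, l'} \<subseteq> {x \<in> L. F' i x = c}" using l by (auto simp: c_def)
      then have "card {l, l'} \<le> card {x \<in> L. F' i x = c}" using L by (intro card_mono) auto
      then show ?thesis using l(3) by (simp add: fibre_card_def)
    qed
    have "c \<in> C"
    proof -
      have "F' i l \<in># image_mset (\<lambda>i. F' i l) (mset_set {..<d})" using i by simp
      also have "image_mset (\<lambda>i. F' i l) (mset_set {..<d}) = image_mset (\<lambda>i. F i l) (mset_set {..<d})"
        using F' l(1) by (simp add: Q_def)
      finally show ?thesis using l(1) by (auto simp: c_def C_def)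
    qed
    have total: "(\<Sum>i'<d. fibre_card L (F' i') c) \<le> d"
    proof -
      have "(\<Sum>i'<d. fibre_card L (F' i') c) = (\<Sum>i'<d. \<Sum>l\<in>L. if F' i' l = c then 1 else 0)"
        using L by (simp add: fibre_card_def sum.If_cases Int_def)
      also have "\<dots> = (\<Sum>l\<in>L. \<Sum>i'<d. if F' i' l = c then 1 else 0)" by (rule sum.swap)
      also have "\<dots> = (\<Sum>l\<in>L. card {i' \<in> {..<d}. F' i' l = c})" by (simp add: sum.If_cases Int_def)
      also have "\<dots> = (\<Sum>l\<in>L. card {i' \<in> {..<d}. F i' l = c})"
      proof (rule sum.cong)
        fix l assume "l \<in> L"
        then have "count (image_mset (\<lambda>i. F' i l) (mset_set {..<d})) c = count (image_mset (\<lambda>i. F i l) (mset_set {..<d})) c"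
          using F' by (simp add: Q_def)
        then show "card {i' \<in> {..<d}. F' i' l = c} = card {i' \<in> {..<d}. F i' l = c}"
          by (simp only: count_image_mset_set finite_lessThan)
      qed simp
      also have "\<dots> \<le> d" by (rule cols)
      finally show ?thesis .
    qed
    have "\<exists>i'<d. fibre_card L (F' i') c = 0"
    proof (rule ccontr)
      assume "\<not> ?thesis"
      then have "1 \<le> fibre_card L (F' i') c" if "i' < d" for i' using that by (simp add: Suc_le_eq)
      then have "(\<Sum>i'\<in>{..<d} - {i}. 1) \<le> (\<Sum>i'\<in>{..<d} - {i}. fibre_card L (F' i') c)" by (intro sum_mono) auto
      moreover have "(\<Sum>i'<d. fibre_card L (F' i') c) = fibre_card L (F' i) c + (\<Sum>i'\<in>{..<d} - {i}. fibre_card L (F' i') c)"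
        using i by (simp add: sum.remove)
      ultimately show False using two total i by simp
    qed
    then obtain i' where i': "i' < d" "fibre_card L (F' i') c = 0" by blast
    with two have "i \<noteq> i'" by auto
    obtain u v where uv: "reorients L (F' i) (F' i') u v"
      "\<And>c. fibre_card L u c \<le> fibre_card L v c + 1" "\<And>c. fibre_card L v c \<le> fibre_card L u c + 1"
      using balanced_orientation[OF L, of "F' i" "F' i'"] by blast
    define F'' where "F'' = F'(i := u, i' := v)"
    define I where "I = {..<d} - {i, i'}"
    have I: "{..<d} = insert i (insert i' I)" "i \<notin> insert i' I" "i' \<notin> I" "finite I"
      using i i'(1) \<open>i \<noteq> i'\<close> by (auto simp: I_def)
    have old: "F'' j = F' j" if "j \<in> I" for j using that by (auto simp: F''_def I_def)
    have new: "F'' i = u" "F'' i' = v" using \<open>i \<noteq> i'\<close> by (auto simp: F''_def)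
    have "Q F''"
      unfolding Q_def
    proof
      fix l assume "l \<in> L"
      then have "(u l = F' i l \<and> v l = F' i' l) \<or> (u l = F' i' l \<and> v l = F' i l)" using uv(1) by (auto simp: reorients_def)
      then have swap: "{#u l, v l#} = {#F' i l, F' i' l#}" by auto
      have split: "image_mset (\<lambda>j. H j l) (mset_set {..<d}) = {#H i l, H i' l#} + image_mset (\<lambda>j. H j l) (mset_set I)"
        for H :: "nat \<Rightarrow> 'l \<Rightarrow> 'c" unfolding I(1) using I(2-4) by simp
      have "image_mset (\<lambda>j. F'' j l) (mset_set I) = image_mset (\<lambda>j. F' j l) (mset_set I)"
        by (rule image_mset_cong) (use old I(4) in auto)
      then have "image_mset (\<lambda>j. F'' j l) (mset_set {..<d}) = image_mset (\<lambda>j. F' j l) (mset_set {..<d})"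
        unfolding split new swap by simp
      then show "image_mset (\<lambda>j. F'' j l) (mset_set {..<d}) = image_mset (\<lambda>i. F i l) (mset_set {..<d})"
        using F' \<open>l \<in> L\<close> by (simp add: Q_def)
    qed
    have sum_eq: "fibre_card L u e + fibre_card L v e = fibre_card L (F' i) e + fibre_card L (F' i') e" for e
      using reorients_fibre_card[OF L uv(1)] .
    have "(\<Sum>e\<in>C. (fibre_card L u e)\<^sup>2 + (fibre_card L v e)\<^sup>2) < (\<Sum>e\<in>C. (fibre_card L (F' i) e)\<^sup>2 + (fibre_card L (F' i') e)\<^sup>2)"
    proof (rule sum_strict_mono_ex1[OF \<open>finite C\<close>])
      show "\<forall>e\<in>C. (fibre_card L u e)\<^sup>2 + (fibre_card L v e)\<^sup>2 \<le> (fibre_card L (F' i) e)\<^sup>2 + (fibre_card L (F' i') e)\<^sup>2"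
        by (intro ballI sum_squares_balanced_le sum_eq uv(2,3))
      have "(fibre_card L u c)\<^sup>2 + (fibre_card L v c)\<^sup>2 < (fibre_card L (F' i) c)\<^sup>2"
        using sum_eq[of c] uv(2,3)[of c] two i'(2) by (intro sum_squares_balanced_less) auto
      then show "\<exists>e\<in>C. (fibre_card L u e)\<^sup>2 + (fibre_card L v e)\<^sup>2 < (fibre_card L (F' i) e)\<^sup>2 + (fibre_card L (F' i') e)\<^sup>2"
        using \<open>c \<in> C\<close> by (intro bexI[of _ c]) auto
    qed
    moreover have \<Phi>: "\<Phi> H = (\<Sum>e\<in>C. (fibre_card L (H i) e)\<^sup>2 + (fibre_card L (H i') e)\<^sup>2)
        + (\<Sum>j\<in>I. \<Sum>c\<in>C. (fibre_card L (H j) c)\<^sup>2)" for H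
      unfolding \<Phi>_def I(1) using I(2-4) by (simp add: sum.distrib)
    moreover have "(\<Sum>j\<in>I. \<Sum>c\<in>C. (fibre_card L (F'' j) c)\<^sup>2) = (\<Sum>j\<in>I. \<Sum>c\<in>C. (fibre_card L (F' j) c)\<^sup>2)"
      by (rule sum.cong) (simp_all add: old)
    ultimately have "\<Phi> F'' < \<Phi> F'"
      unfolding \<Phi>[of F''] \<Phi>[of F'] new by linarith
    then show False using least[OF \<open>Q F''\<close>] by simp
  qed
  then show ?thesis using F' unfolding Q_def by (intro exI[of _ F'] conjI allI impI)
qed

section \<open>The matching monoid\<close>

text \<open>
The pair \<open>(p, J)\<close> is an injection of \<open>K\<close> rows into the columns, with colour \<open>p\<close>.
\<close>

definition matchings :: "nat \<Rightarrow> nat \<Rightarrow> (nat \<times> nat list) set" where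
  "matchings N K = {(p, J). p < N \<and> length J = K \<and> distinct J}"

definition cells :: "nat \<Rightarrow> nat \<times> nat list \<Rightarrow> (nat \<times> nat \<times> nat) multiset" where
  "cells K t = image_mset (\<lambda>l. (fst t, l, snd t ! l)) (mset_set {..<K})"

definition cell_sum :: "nat \<Rightarrow> (nat \<times> nat list) multiset \<Rightarrow> (nat \<times> nat \<times> nat) multiset" where
  "cell_sum K M = (\<Sum>t\<in>#M. cells K t)"

definition matching_monoid :: "nat \<Rightarrow> nat \<Rightarrow> (nat \<times> nat \<times> nat) multiset set" where
  "matching_monoid N K = cell_sum K ` {M. set_mset M \<subseteq> matchings N K}"

definition row :: "nat \<Rightarrow> nat \<Rightarrow> (nat \<times> nat \<times> nat) multiset \<Rightarrow> nat" where
  "row p l g = size (filter_mset (\<lambda>x. fst x = p \<and> fst (snd x) = l) g)"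

definition col :: "nat \<Rightarrow> nat \<Rightarrow> (nat \<times> nat \<times> nat) multiset \<Rightarrow> nat" where
  "col p j g = size (filter_mset (\<lambda>x. fst x = p \<and> snd (snd x) = j) g)"

lemma row_add [simp]: "row p l (g + h) = row p l g + row p l h"
  and col_add [simp]: "col p j (g + h) = col p j g + col p j h"
  and row_empty [simp]: "row p l {#} = 0"
  and col_empty [simp]: "col p j {#} = 0"
  by (simp_all add: row_def col_def)

lemma cell_sum_add [simp]: "cell_sum K (M + M') = cell_sum K M + cell_sum K M'"
  and cell_sum_add_mset [simp]: "cell_sum K (add_mset t M) = cells K t + cell_sum K M"
  and cell_sum_empty [simp]: "cell_sum K {#} = {#}"
  by (simp_all add: cell_sum_def)

lemma image_mset_mset_set: "finite A \<Longrightarrow> image_mset f (mset_set A) = (\<Sum>a\<in>A. {#f a#})"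
  by (induction A rule: finite_induct) simp_all

lemma size_filter_image_mset_set:
  "finite A \<Longrightarrow> size (filter_mset Q (image_mset f (mset_set A))) = card {a \<in> A. Q (f a)}"
  by (simp add: filter_mset_image_mset)

lemma row_cells: "row p l (cells K t) = (if fst t = p \<and> l < K then 1 else 0)"
proof -
  have "{l'. l' < K \<and> fst t = p \<and> l' = l} = (if fst t = p \<and> l < K then {l} else {})" by auto
  then show ?thesis by (simp add: row_def cells_def size_filter_image_mset_set)
qed

lemma col_cells:
  assumes "length (snd t) = K" "distinct (snd t)"
  shows "col p j (cells K t) = (if fst t = p \<and> j \<in> set (snd t) then 1 else 0)"
proof (cases "fst t = p \<and> j \<in> set (snd t)")
  case True
  then obtain l where l: "l < K" "snd t ! l = j" using assms(1) by (auto simp: in_set_conv_nth)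
  then have "{l'. l' < K \<and> fst t = p \<and> snd t ! l' = j} = {l}"
    using assms True by (auto simp: distinct_conv_nth)
  then show ?thesis using True by (simp add: col_def cells_def size_filter_image_mset_set)
next
  case False
  then have "{l'. l' < K \<and> fst t = p \<and> snd t ! l' = j} = {}" using assms(1) by auto
  then show ?thesis using False by (simp only: col_def cells_def size_filter_image_mset_set finite_lessThan) simp
qed

lemma row_cell_sum:
  "row p l (cell_sum K M) = (if l < K then size (filter_mset (\<lambda>t. fst t = p) M) else 0)"
  by (induction M) (auto simp: row_cells)

lemma col_cell_sum:
  assumes "set_mset M \<subseteq> matchings N K"
  shows "col p j (cell_sum K M) = size (filter_mset (\<lambda>t. fst t = p \<and> j \<in> set (snd t)) M)"
  using assms by (induction M) (auto simp: col_cells matchings_def)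

lemma in_cell_sum_iff: "x \<in># cell_sum K M \<longleftrightarrow> (\<exists>t\<in>#M. \<exists>l<K. x = (fst t, l, snd t ! l))"
  by (induction M) (auto simp: cells_def)

lemma col_eq_sum_count:
  assumes "\<And>x. x \<in># g \<Longrightarrow> fst x = p \<Longrightarrow> fst (snd x) < K"
  shows "col p j g = (\<Sum>l<K. count g (p, l, j))"
  using assms
proof (induction g)
  case (add x g)
  obtain q l i where x: "x = (q, l, i)" by (cases x)
  have IH: "col p j g = (\<Sum>l<K. count g (p, l, j))" using add.prems by (intro add.IH) auto
  have "col p j (add_mset x g) = col p j g + (if q = p \<and> i = j then 1 else 0)" by (simp add: col_def x)
  moreover have "(\<Sum>l'<K. count (add_mset x g) (p, l', j)) =
     (\<Sum>l'<K. count g (p, l', j) + (if l' = l then if q = p \<and> i = j then 1 else 0 else 0))"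
    by (rule sum.cong) (auto simp: x)
  moreover have "\<dots> = (\<Sum>l'<K. count g (p, l', j)) + (if q = p \<and> i = j then 1 else 0)"
    using add.prems[of x] by (auto simp: sum.distrib x)
  ultimately show ?case using IH by simp
qed (simp add: col_def)

lemma sum_row_parts:
  fixes g :: "(nat \<times> nat \<times> 'a) multiset"
  assumes "\<And>x. x \<in># g \<Longrightarrow> fst x < N \<and> fst (snd x) < K"
  shows "(\<Sum>p<N. \<Sum>l<K. filter_mset (\<lambda>x. fst x = p \<and> fst (snd x) = l) g) = g"
proof (rule multiset_eqI)
  fix x :: "nat \<times> nat \<times> 'a"
  have "count (\<Sum>p<N. \<Sum>l<K. filter_mset (\<lambda>x. fst x = p \<and> fst (snd x) = l) g) x =
      (\<Sum>p<N. \<Sum>l<K. if p = fst x then if l = fst (snd x) then count g x else 0 else 0)"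
    by (auto simp: count_sum intro!: sum.cong)
  also have "\<dots> = (\<Sum>p<N. if p = fst x then \<Sum>l<K. if l = fst (snd x) then count g x else 0 else 0)"
    by (rule sum.cong) auto
  also have "\<dots> = count g x"
    using assms[of x] by (cases "x \<in># g") (auto simp: count_eq_zero_iff)
  finally show "count (\<Sum>p<N. \<Sum>l<K. filter_mset (\<lambda>x. fst x = p \<and> fst (snd x) = l) g) x = count g x" .
qed

text \<open>
The condition on the columns is necessary because a matching uses each column at most once. Conversely,
the rows of one colour \<open>p\<close> list the columns of \<open>d\<^sub>p\<close> entries each, and rearranging these rows into injections
cuts the array into matchings.
\<close>

theorem matching_monoid_iff:
  "g \<in> matching_monoid N K \<longleftrightarrow>
     (\<forall>x\<in>#g. fst x < N \<and> fst (snd x) < K) \<and>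
     (\<exists>d. \<forall>p<N. (\<forall>l<K. row p l g = d p) \<and> (\<forall>j. col p j g \<le> d p))"
  (is "_ \<longleftrightarrow> ?R")
proof
  assume "g \<in> matching_monoid N K"
  then obtain M where M: "set_mset M \<subseteq> matchings N K" "g = cell_sum K M"
    by (auto simp: matching_monoid_def)
  let ?d = "\<lambda>p. size (filter_mset (\<lambda>t. fst t = p) M)"
  have "col p j g \<le> ?d p" for p j
    unfolding M(2) col_cell_sum[OF M(1)] by (intro size_mset_mono filter_mset_mono_strong) auto
  moreover have "\<forall>x\<in>#g. fst x < N \<and> fst (snd x) < K" using M by (fastforce simp: in_cell_sum_iff matchings_def)
  ultimately show ?R by (intro conjI exI[of _ ?d]) (auto simp: M(2) row_cell_sum)
next
  assume ?R
  then obtain d where g: "\<And>x. x \<in># g \<Longrightarrow> fst x < N \<and> fst (snd x) < K"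
    and rows: "\<And>p l. p < N \<Longrightarrow> l < K \<Longrightarrow> row p l g = d p" and cols: "\<And>p j. p < N \<Longrightarrow> col p j g \<le> d p" by blast
  define R where "R p l = image_mset (\<lambda>x. snd (snd x)) (filter_mset (\<lambda>x. fst x = p \<and> fst (snd x) = l) g)" for p l
  define F where "F p i l = sorted_list_of_multiset (R p l) ! i" for p i l
  have row_F: "image_mset (\<lambda>i. F p i l) (mset_set {..<d p}) = R p l" if "p < N" "l < K" for p l
  proof -
    let ?xs = "sorted_list_of_multiset (R p l)"
    have "size (mset ?xs) = d p" using rows[OF that] by (simp add: R_def row_def)
    then have len: "length ?xs = d p" by (simp only: size_mset)
    have "image_mset (\<lambda>i. ?xs ! i) (mset_set {..<d p}) = mset (map (\<lambda>i. ?xs ! i) [0..<d p])"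
      by (simp add: lessThan_atLeast0)
    also have "map (\<lambda>i. ?xs ! i) [0..<d p] = ?xs" unfolding len[symmetric] by (rule map_nth)
    finally show ?thesis by (simp add: F_def)
  qed
  have ex: "\<exists>F'. (\<forall>i<d p. inj_on (F' i) {..<K}) \<and>
      (\<forall>l\<in>{..<K}. image_mset (\<lambda>i. F' i l) (mset_set {..<d p}) = image_mset (\<lambda>i. F p i l) (mset_set {..<d p}))"
    if p: "p < N" for p
  proof (rule rearrange_into_injections)
    fix j
    have "count (R p l) j = count g (p, l, j)" for l
    proof -
      have "count (R p l) j = size (filter_mset (\<lambda>x. x = (p, l, j)) g)"
        by (auto simp: R_def count_conv_size_mset filter_mset_image_mset filter_filter_mset intro!: arg_cong[where f = size] filter_mset_cong)
      then show ?thesis by (simp add: filter_eq_replicate_mset)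
    qed
    moreover have "card {i \<in> {..<d p}. F p i l = j} = count (R p l) j" if "l < K" for l
      unfolding row_F[OF p that, symmetric] by (simp only: count_image_mset_set finite_lessThan)
    ultimately have "(\<Sum>l<K. card {i \<in> {..<d p}. F p i l = j}) = (\<Sum>l<K. count g (p, l, j))"
      by (intro sum.cong) auto
    also have "\<dots> = col p j g" using g by (intro col_eq_sum_count[symmetric]) auto
    also have "\<dots> \<le> d p" by (rule cols[OF p])
    finally show "(\<Sum>l<K. card {i \<in> {..<d p}. F p i l = j}) \<le> d p" .
  qed simp
  then obtain F' where inj: "\<And>p i. p < N \<Longrightarrow> i < d p \<Longrightarrow> inj_on (F' p i) {..<K}"
    and F': "\<And>p l. p < N \<Longrightarrow> l < K \<Longrightarrow> image_mset (\<lambda>i. F' p i l) (mset_set {..<d p}) = R p l"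
  proof -
    obtain F' where "\<forall>p<N. (\<forall>i<d p. inj_on (F' p i) {..<K}) \<and>
      (\<forall>l\<in>{..<K}. image_mset (\<lambda>i. F' p i l) (mset_set {..<d p}) = image_mset (\<lambda>i. F p i l) (mset_set {..<d p}))"
      using ex by metis
    then show thesis using row_F by (intro that[of F']) auto
  qed
  define M where "M = (\<Sum>p<N. image_mset (\<lambda>i. (p, map (F' p i) [0..<K])) (mset_set {..<d p}))"
  have "set_mset M \<subseteq> matchings N K"
    using inj by (auto simp: M_def set_mset_sum matchings_def distinct_map lessThan_atLeast0)
  moreover have "cell_sum K M = g"
  proof -
    have "cell_sum K M = (\<Sum>p<N. \<Sum>i<d p. cells K (p, map (F' p i) [0..<K]))"
    proof -
      have 1: "cell_sum K (\<Sum>p\<in>A. H p) = (\<Sum>p\<in>A. cell_sum K (H p))" if "finite A" for A :: "nat set" and H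
        using that by (induction A rule: finite_induct) simp_all
      have 2: "cell_sum K (image_mset h (mset_set A)) = (\<Sum>a\<in>A. cells K (h a))" if "finite A" for A :: "nat set" and h
        using that by (induction A rule: finite_induct) simp_all
      show ?thesis by (simp add: M_def 1 2)
    qed
    also have "\<dots> = (\<Sum>p<N. \<Sum>i<d p. \<Sum>l<K. {#(p, l, F' p i l)#})"
      by (intro sum.cong refl) (simp add: cells_def image_mset_mset_set)
    also have "\<dots> = (\<Sum>p<N. \<Sum>l<K. \<Sum>i<d p. {#(p, l, F' p i l)#})"
      by (rule sum.cong[OF refl sum.swap])
    also have "\<dots> = (\<Sum>p<N. \<Sum>l<K. image_mset (\<lambda>j. (p, l, j)) (image_mset (\<lambda>i. F' p i l) (mset_set {..<d p})))"
      unfolding multiset.map_comp comp_def by (simp add: image_mset_mset_set)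
    also have "\<dots> = (\<Sum>p<N. \<Sum>l<K. filter_mset (\<lambda>x. fst x = p \<and> fst (snd x) = l) g)"
    proof (intro sum.cong refl)
      fix p l assume "p \<in> {..<N}" "l \<in> {..<K}"
      then have "image_mset (\<lambda>j. (p, l, j)) (image_mset (\<lambda>i. F' p i l) (mset_set {..<d p})) = image_mset (\<lambda>j. (p, l, j)) (R p l)"
        by (simp add: F')
      also have "\<dots> = image_mset (\<lambda>x. x) (filter_mset (\<lambda>x. fst x = p \<and> fst (snd x) = l) g)"
        unfolding R_def multiset.map_comp by (rule image_mset_cong) auto
      finally show "image_mset (\<lambda>j. (p, l, j)) (image_mset (\<lambda>i. F' p i l) (mset_set {..<d p})) =
        filter_mset (\<lambda>x. fst x = p \<and> fst (snd x) = l) g" by simp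
    qed
    also have "\<dots> = g" by (rule sum_row_parts[OF g])
    finally show ?thesis .
  qed
  ultimately show "g \<in> matching_monoid N K" by (auto simp: matching_monoid_def)
qed

section \<open>Monoid algebras with an action of the increasing maps\<close>

text \<open>
The linear extension of a map of exponents; it is a ring homomorphism wherever the map is additive.
\<close>

definition push :: "('m \<Rightarrow> 'n) \<Rightarrow> ('m \<Rightarrow>\<^sub>0 'r) \<Rightarrow> ('n \<Rightarrow>\<^sub>0 'r::comm_monoid_add)" where
  "push h p = (\<Sum>m\<in>keys p. single (h m) (lookup p m))"

lemma push_superset:
  assumes "finite A" "keys p \<subseteq> A"
  shows "push h p = (\<Sum>m\<in>A. single (h m) (lookup p m))"
  unfolding push_def using assms by (intro sum.mono_neutral_left) (auto simp: in_keys_iff)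

lemma push_add [simp]: "push h (p + q) = push h p + push h q"
proof -
  let ?A = "keys p \<union> keys q"
  have "keys (p + q) \<subseteq> ?A" by (rule keys_add)
  then show ?thesis
    by (simp add: push_superset[of ?A] lookup_add single_add sum.distrib)
qed

lemma push_zero [simp]: "push h 0 = 0"
  by (simp add: push_def)

lemma push_single [simp]: "push h (single m c) = single (h m) c"
  by (cases "c = 0") (simp_all add: push_def)

lemma push_sum: "push h (sum f A) = (\<Sum>a\<in>A. push h (f a))"
  by (induction A rule: infinite_finite_induct) simp_all

lemma push_cong: "(\<And>m. m \<in> keys p \<Longrightarrow> h m = h' m) \<Longrightarrow> push h p = push h' p"
  by (simp add: push_def)

lemma push_push: "push h (push h' p) = push (\<lambda>m. h (h' m)) p"
  unfolding push_def[of h'] push_def[of "\<lambda>m. h (h' m)"] by (simp add: push_sum)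

lemma push_ident [simp]: "push (\<lambda>m. m) p = p"
proof (rule poly_mapping_eqI)
  fix m
  show "lookup (push (\<lambda>m. m) p) m = lookup p m"
    by (cases "m \<in> keys p")
      (auto simp: push_def lookup_sum lookup_single when_def in_keys_iff)
qed

lemma keys_push: "keys (push h p) \<subseteq> h ` keys p"
proof -
  have "keys (push h p) \<subseteq> (\<Union>m\<in>keys p. keys (single (h m) (lookup p m)))"
    unfolding push_def by (rule keys_sum)
  also have "\<dots> \<subseteq> h ` keys p" by (auto split: if_splits)
  finally show ?thesis .
qed

lemma push_uminus [simp]: "push h (- p) = - push h (p :: 'm \<Rightarrow>\<^sub>0 'r::ab_group_add)"
proof -
  have "push h p + push h (- p) = push h (p + - p)" by (simp only: push_add)
  then show ?thesis by (simp add: eq_neg_iff_add_eq_0 add.commute)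
qed

lemma push_diff [simp]: "push h (p - q) = push h p - push h (q :: 'm \<Rightarrow>\<^sub>0 'r::ab_group_add)"
  using push_add[of h p "- q"] by simp

lemma poly_mapping_induct_on [consumes 1, case_names zero single add]:
  fixes p :: "'m \<Rightarrow>\<^sub>0 'r::comm_monoid_add"
  assumes "keys p \<subseteq> G" and "P 0" and "\<And>m c. m \<in> G \<Longrightarrow> P (single m c)"
    and "\<And>p q. P p \<Longrightarrow> P q \<Longrightarrow> P (p + q)"
  shows "P p"
proof -
  have "P (\<Sum>m\<in>A. single m (lookup p m))" if "finite A" "A \<subseteq> G" for A
    using that by (induction A rule: finite_induct) (auto intro: assms(2-4))
  then have "P (push (\<lambda>m. m) p)" unfolding push_def using assms(1) by simp
  then show ?thesis by simp
qed

lemma push_mult: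
  fixes p q :: "'m::comm_monoid_add \<Rightarrow>\<^sub>0 'r::comm_ring" and h :: "'m \<Rightarrow> 'n::comm_monoid_add"
  assumes h: "\<And>a b. a \<in> G \<Longrightarrow> b \<in> G \<Longrightarrow> h (a + b) = h a + h b"
    and p: "keys p \<subseteq> G" and q: "keys q \<subseteq> G"
  shows "push h (p * q) = push h p * push h q"
  using p
proof (induction p rule: poly_mapping_induct_on)
  case (single m c)
  show ?case using q
    by (induction q rule: poly_mapping_induct_on) (simp_all add: mult_single h single distrib_left)
qed (simp_all add: distrib_right)

lemma single_zero_one_mult [simp]:
  fixes p :: "'m::comm_monoid_add \<Rightarrow>\<^sub>0 'r::{comm_ring, comm_monoid_mult}"
  shows "single 0 1 * p = p"
  using subset_UNIV by (induction p rule: poly_mapping_induct_on) (simp_all add: mult_single distrib_left)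

lemma mult_single_zero_one [simp]:
  fixes p :: "'m::comm_monoid_add \<Rightarrow>\<^sub>0 'r::{comm_ring, comm_monoid_mult}"
  shows "p * single 0 1 = p"
  using single_zero_one_mult[of p] by (simp only: mult.commute)

lemma map_vars_eq_push: "map_vars f = push (push f)"
  by (simp add: map_vars_def push_def fun_eq_iff)

definition monoid_algebra :: "'m set \<Rightarrow> ('m::comm_monoid_add \<Rightarrow>\<^sub>0 'r::{comm_ring, comm_monoid_mult}) ring" where
  "monoid_algebra G = \<lparr>carrier = {p. keys p \<subseteq> G},
     monoid.mult = (*), monoid.one = single 0 1, ring.zero = 0, ring.add = (+)\<rparr>"

lemma monoid_algebra_simps [simp]:
  "carrier (monoid_algebra G) = {p. keys p \<subseteq> G}"
  "monoid.mult (monoid_algebra G) = (*)" "monoid.one (monoid_algebra G) = single 0 1"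
  "ring.zero (monoid_algebra G) = 0" "ring.add (monoid_algebra G) = (+)"
  by (simp_all add: monoid_algebra_def)

lemma mpoly_ring_eq: "mpoly_ring V = monoid_algebra (monomials V)"
  by (simp add: mpoly_ring_def monoid_algebra_def)

lemma keys_uminus [simp]: "keys (- p) = keys (p :: 'm \<Rightarrow>\<^sub>0 'r::ab_group_add)"
  by (auto simp: in_keys_iff)

lemma keys_add_subset: "keys p \<subseteq> G \<Longrightarrow> keys q \<subseteq> G \<Longrightarrow> keys (p + q) \<subseteq> G"
  using keys_add[of p q] by blast

lemma keys_diff_subset:
  "keys p \<subseteq> G \<Longrightarrow> keys q \<subseteq> G \<Longrightarrow> keys (p - q :: 'm \<Rightarrow>\<^sub>0 'r::ab_group_add) \<subseteq> G"
  using keys_add_subset[of p G "- q"] by simp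

lemma keys_mult_subset:
  assumes "\<And>a b. a \<in> G \<Longrightarrow> b \<in> G \<Longrightarrow> a + b \<in> G" "keys p \<subseteq> G" "keys q \<subseteq> G"
  shows "keys (p * q :: 'm::comm_monoid_add \<Rightarrow>\<^sub>0 'r::comm_ring) \<subseteq> G"
  using keys_mult[of p q] assms by blast

lemma monoid_algebra_cring:
  assumes "0 \<in> G" "\<And>a b. a \<in> G \<Longrightarrow> b \<in> G \<Longrightarrow> a + b \<in> G"
  shows "cring (monoid_algebra G :: ('m::comm_monoid_add \<Rightarrow>\<^sub>0 'r::{comm_ring, comm_monoid_mult}) ring)"
proof (rule cringI)
  show "abelian_group (monoid_algebra G :: ('m \<Rightarrow>\<^sub>0 'r) ring)"
  proof (rule abelian_groupI)
    fix x :: "'m \<Rightarrow>\<^sub>0 'r" assume "x \<in> carrier (monoid_algebra G)"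
    then show "\<exists>y\<in>carrier (monoid_algebra G). y \<oplus>\<^bsub>monoid_algebra G\<^esub> x = \<zero>\<^bsub>monoid_algebra G\<^esub>"
      by (intro bexI[of _ "- x"]) auto
  qed (auto simp: keys_add_subset add.assoc add.commute)
  show "Group.comm_monoid (monoid_algebra G :: ('m \<Rightarrow>\<^sub>0 'r) ring)"
    by (rule comm_monoidI) (auto simp: assms keys_mult_subset ac_simps split: if_splits)
qed (simp add: distrib_right)

lemma monoid_algebra_a_inv:
  assumes "ring (monoid_algebra G :: ('m::comm_monoid_add \<Rightarrow>\<^sub>0 'r::{comm_ring, comm_monoid_mult}) ring)"
    "keys (p :: 'm \<Rightarrow>\<^sub>0 'r) \<subseteq> G"
  shows "\<ominus>\<^bsub>monoid_algebra G\<^esub> p = - p"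
proof -
  interpret ring "monoid_algebra G :: ('m \<Rightarrow>\<^sub>0 'r) ring" by fact
  show ?thesis using assms(2) by (intro minus_equality) auto
qed

text \<open>
The action is required to behave well for strictly increasing maps only, because \<open>inc_act\<close> is
meaningful only for these. The map \<open>\<alpha>\<close> acts on exponents, \<open>push \<circ> \<alpha>\<close> on polynomials.
\<close>

locale inc_monoid =
  fixes G :: "'m::comm_monoid_add set" and \<alpha> :: "(nat \<Rightarrow> nat) \<Rightarrow> 'm \<Rightarrow> 'm"
  assumes zero_in: "0 \<in> G" and add_in: "g \<in> G \<Longrightarrow> h \<in> G \<Longrightarrow> g + h \<in> G"
    and act_in: "strict_mono \<pi> \<Longrightarrow> g \<in> G \<Longrightarrow> \<alpha> \<pi> g \<in> G"
    and act_zero: "strict_mono \<pi> \<Longrightarrow> \<alpha> \<pi> 0 = 0"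
    and act_add: "strict_mono \<pi> \<Longrightarrow> g \<in> G \<Longrightarrow> h \<in> G \<Longrightarrow> \<alpha> \<pi> (g + h) = \<alpha> \<pi> g + \<alpha> \<pi> h"
    and act_id: "g \<in> G \<Longrightarrow> \<alpha> id g = g"
    and act_comp: "strict_mono \<pi> \<Longrightarrow> strict_mono \<rho> \<Longrightarrow> g \<in> G \<Longrightarrow> \<alpha> (\<pi> \<circ> \<rho>) g = \<alpha> \<pi> (\<alpha> \<rho> g)"
begin

definition stable :: "('m \<Rightarrow>\<^sub>0 'r::{comm_ring, comm_monoid_mult}) set \<Rightarrow> bool" where
  "stable I \<longleftrightarrow> (\<forall>f\<in>I. keys f \<subseteq> G) \<and> 0 \<in> I \<and> (\<forall>f\<in>I. \<forall>g\<in>I. f + g \<in> I) \<and>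
     (\<forall>f\<in>I. \<forall>c\<in>G. \<forall>r. single c r * f \<in> I) \<and>
     (\<forall>f\<in>I. \<forall>\<pi>. strict_mono \<pi> \<longrightarrow> push (\<alpha> \<pi>) f \<in> I)"

definition gen :: "('m \<Rightarrow>\<^sub>0 'r::{comm_ring, comm_monoid_mult}) set \<Rightarrow> ('m \<Rightarrow>\<^sub>0 'r) set" where
  "gen F = \<Inter>{I. stable I \<and> F \<subseteq> I}"

lemma stableD:
  assumes "stable I"
  shows "f \<in> I \<Longrightarrow> keys f \<subseteq> G" "0 \<in> I" "f \<in> I \<Longrightarrow> g \<in> I \<Longrightarrow> f + g \<in> I"
    "f \<in> I \<Longrightarrow> c \<in> G \<Longrightarrow> single c r * f \<in> I"
    "f \<in> I \<Longrightarrow> strict_mono \<pi> \<Longrightarrow> push (\<alpha> \<pi>) f \<in> I"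
  using assms by (auto simp: stable_def)

lemma stable_mult:
  assumes "stable I" "f \<in> I" "keys p \<subseteq> G"
  shows "p * f \<in> I"
  using assms(3)
  by (induction p rule: poly_mapping_induct_on) (auto simp: distrib_right intro: stableD[OF assms(1)] assms(2))

lemma stable_uminus:
  assumes "stable I" "f \<in> I"
  shows "- f \<in> I"
proof -
  have "single 0 (- 1) * f = - f" by (simp add: single_uminus)
  then show ?thesis using stableD(4)[OF assms zero_in, of "- 1"] by simp
qed

lemma stable_diff: "stable I \<Longrightarrow> f \<in> I \<Longrightarrow> g \<in> I \<Longrightarrow> f - g \<in> I"
  using stableD(3)[of I f "- g"] stable_uminus[of I g] by simp

lemma stable_sum: "stable I \<Longrightarrow> (\<And>a. a \<in> A \<Longrightarrow> f a \<in> I) \<Longrightarrow> sum f A \<in> I"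
  by (induction A rule: infinite_finite_induct) (auto intro: stableD)

lemma keys_push_act: "strict_mono \<pi> \<Longrightarrow> keys f \<subseteq> G \<Longrightarrow> keys (push (\<alpha> \<pi>) f) \<subseteq> G"
  using keys_push[of "\<alpha> \<pi>" f] act_in by blast

lemma push_act_mult:
  fixes p q :: "'m \<Rightarrow>\<^sub>0 'r::comm_ring"
  shows "strict_mono \<pi> \<Longrightarrow> keys p \<subseteq> G \<Longrightarrow> keys q \<subseteq> G \<Longrightarrow>
    push (\<alpha> \<pi>) (p * q) = push (\<alpha> \<pi>) p * push (\<alpha> \<pi>) q"
  using act_add by (rule push_mult[where G = G])

lemma stable_carrier: "stable {p :: 'm \<Rightarrow>\<^sub>0 'r::{comm_ring, comm_monoid_mult}. keys p \<subseteq> G}"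
  unfolding stable_def
proof (intro conjI ballI allI impI)
  fix f c and r :: 'r
  assume "f \<in> {p :: 'm \<Rightarrow>\<^sub>0 'r. keys p \<subseteq> G}" "c \<in> G"
  then show "single c r * f \<in> {p. keys p \<subseteq> G}"
    using keys_mult_subset[of G "single c r" f] add_in by (auto split: if_splits)
qed (simp_all add: keys_add_subset keys_push_act)

lemma gen_superset: "F \<subseteq> gen F"
  by (auto simp: gen_def)

lemma gen_least: "stable I \<Longrightarrow> F \<subseteq> I \<Longrightarrow> gen F \<subseteq> I"
  by (auto simp: gen_def)

lemma stable_gen:
  assumes "\<And>f. f \<in> F \<Longrightarrow> keys f \<subseteq> G"
  shows "stable (gen F)"
proof -
  have "gen F \<subseteq> {p. keys p \<subseteq> G}" using assms by (intro gen_least stable_carrier) auto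
  then show ?thesis unfolding stable_def by (auto simp: gen_def stableD(2-5))
qed

lemma gen_mono:
  assumes "F \<subseteq> F'"
  shows "gen F \<subseteq> gen F'"
  using assms by (auto simp: gen_def)

text \<open>
The elements that lie in a stable ideal generated by finitely many members of \<open>C\<close> form a stable ideal.
\<close>

lemma gen_finitary:
  fixes C :: "('m \<Rightarrow>\<^sub>0 'r::{comm_ring, comm_monoid_mult}) set"
  assumes C: "\<And>f. f \<in> C \<Longrightarrow> keys f \<subseteq> G" and F: "finite F" "F \<subseteq> gen C"
  shows "\<exists>C0\<subseteq>C. finite C0 \<and> F \<subseteq> gen C0"
proof -
  have st: "stable (gen C0)" if "C0 \<subseteq> C" for C0 using that C by (intro stable_gen) blast
  define U where "U = {f. \<exists>C0\<subseteq>C. finite C0 \<and> f \<in> gen C0}"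
  have "stable U"
    unfolding stable_def
  proof (intro conjI ballI allI impI)
    show "0 \<in> U" unfolding U_def using stableD(2)[OF st, of "{}"] by (auto intro!: exI[of _ "{}"])
    fix f g assume "f \<in> U" "g \<in> U"
    then obtain A B where AB: "A \<subseteq> C" "finite A" "f \<in> gen A" "B \<subseteq> C" "finite B" "g \<in> gen B" by (auto simp: U_def)
    then have "f \<in> gen (A \<union> B)" "g \<in> gen (A \<union> B)" using gen_mono[of A "A \<union> B"] gen_mono[of B "A \<union> B"] by auto
    then have "f + g \<in> gen (A \<union> B)" using AB by (intro stableD(3)[OF st]) auto
    then show "f + g \<in> U" unfolding U_def using AB by (intro CollectI exI[of _ "A \<union> B"]) auto
  qed (use st in \<open>auto simp: U_def dest: stableD intro: stableD(4,5)\<close>)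
  moreover have "C \<subseteq> U"
  proof
    fix f assume "f \<in> C"
    then show "f \<in> U" unfolding U_def using gen_superset[of "{f}"] by (intro CollectI exI[of _ "{f}"]) auto
  qed
  ultimately have "gen C \<subseteq> U" by (rule gen_least)
  with F show ?thesis
  proof (induction F rule: finite_induct)
    case empty
    show ?case by (intro exI[of _ "{}"]) simp
  next
    case (insert f F)
    then obtain A B where AB: "A \<subseteq> C" "finite A" "F \<subseteq> gen A" "B \<subseteq> C" "finite B" "f \<in> gen B"
      by (auto simp: U_def)
    then have "insert f F \<subseteq> gen (A \<union> B)" using gen_mono[of A "A \<union> B"] gen_mono[of B "A \<union> B"] by auto
    then show ?case using AB by (intro exI[of _ "A \<union> B"]) simp
  qed
qed

lemma monoid_algebra_ring: "ring (monoid_algebra G :: ('m \<Rightarrow>\<^sub>0 'r::{comm_ring, comm_monoid_mult}) ring)"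
  using monoid_algebra_cring[of G] zero_in add_in by (blast intro: cring.axioms(1))

lemma stable_imp_ideal:
  fixes I :: "('m \<Rightarrow>\<^sub>0 'r::{comm_ring, comm_monoid_mult}) set"
  assumes "stable I"
  shows "ideal I (monoid_algebra G)"
proof (rule idealI[OF monoid_algebra_ring])
  interpret R: ring "monoid_algebra G :: ('m \<Rightarrow>\<^sub>0 'r) ring" by (rule monoid_algebra_ring)
  show "subgroup I (add_monoid (monoid_algebra G))"
  proof (rule R.add.subgroupI)
    fix f assume "f \<in> I"
    then show "\<ominus>\<^bsub>monoid_algebra G\<^esub> f \<in> I"
      using monoid_algebra_a_inv[OF monoid_algebra_ring, of f] stable_uminus[OF assms, of f] stableD(1)[OF assms]
      by simp
  qed (use stableD[OF assms] in auto)
qed (use stable_mult[OF assms] in \<open>auto simp: mult.commute\<close>)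

lemma ideal_imp_stable:
  assumes "ideal I (monoid_algebra G)" and "\<And>\<pi> f. strict_mono \<pi> \<Longrightarrow> f \<in> I \<Longrightarrow> push (\<alpha> \<pi>) f \<in> I"
  shows "stable I"
proof -
  interpret ideal I "monoid_algebra G" by fact
  have "single c r * f \<in> I" if "f \<in> I" "c \<in> G" for f c r
    using I_l_closed[of f "single c r"] that by (auto split: if_splits)
  then show ?thesis
    unfolding stable_def using a_subset additive_subgroup.zero_closed[OF additive_subgroup_axioms]
      additive_subgroup.a_closed[OF additive_subgroup_axioms] assms(2) by auto
qed

text \<open>
What needs proof is that the ideal generated by the orbits is itself stable: the elements all of whose
translates lie in it form an ideal that contains the orbits.
\<close>

lemma Idl_orbits_eq_gen:
  fixes F :: "('m \<Rightarrow>\<^sub>0 'r::{comm_ring, comm_monoid_mult}) set"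
  assumes F: "\<And>f. f \<in> F \<Longrightarrow> keys f \<subseteq> G"
  shows "Idl\<^bsub>monoid_algebra G\<^esub> (\<Union>f\<in>F. orbit IncN (\<lambda>\<pi>. push (\<alpha> \<pi>)) f) = gen F"
proof
  let ?R = "monoid_algebra G :: ('m \<Rightarrow>\<^sub>0 'r) ring"
  interpret R: ring ?R by (rule monoid_algebra_ring)
  let ?O = "\<Union>f\<in>F. orbit IncN (\<lambda>\<pi>. push (\<alpha> \<pi>)) f"
  have orb: "?O = {push (\<alpha> \<pi>) f | f \<pi>. f \<in> F \<and> strict_mono \<pi>}" by (auto simp: orbit_def IncN_def)
  have O: "?O \<subseteq> carrier ?R"
  proof
    fix x assume "x \<in> ?O"
    then obtain f \<pi> where "x = push (\<alpha> \<pi>) f" "f \<in> F" "strict_mono \<pi>" unfolding orb by blast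
    then show "x \<in> carrier ?R" using keys_push_act[of \<pi> f] F by simp
  qed
  note st = stable_gen[of F, OF F]
  show "Idl\<^bsub>?R\<^esub> ?O \<subseteq> gen F"
    by (rule R.genideal_minimal[OF stable_imp_ideal[OF st]]) (use gen_superset[of F] stableD(5)[OF st] orb in auto)
  let ?J = "Idl\<^bsub>?R\<^esub> ?O"
  have J: "ideal ?J ?R" by (rule R.genideal_ideal[OF O])
  interpret J: ideal ?J ?R by (rule J)
  define J' where "J' = {f \<in> ?J. \<forall>\<pi>. strict_mono \<pi> \<longrightarrow> push (\<alpha> \<pi>) f \<in> ?J}"
  have keysJ: "f \<in> ?J \<Longrightarrow> keys f \<subseteq> G" for f using J.a_subset by auto
  have minusJ: "f \<in> ?J \<Longrightarrow> - f \<in> ?J" for f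
    using J.a_inv_closed[of f] monoid_algebra_a_inv[OF monoid_algebra_ring keysJ, of f] by simp
  have addJ: "f \<in> ?J \<Longrightarrow> g \<in> ?J \<Longrightarrow> f + g \<in> ?J" for f g 
    using additive_subgroup.a_closed[OF J.additive_subgroup_axioms, of f g] by simp
  have multJ: "f \<in> ?J \<Longrightarrow> keys p \<subseteq> G \<Longrightarrow> p * f \<in> ?J" for f p using J.I_l_closed[of f p] by simp
  have multJ': "p * f \<in> J'" if f: "f \<in> J'" and p: "keys p \<subseteq> G" for f p
  proof -
    have "push (\<alpha> \<pi>) (p * f) \<in> ?J" if \<pi>: "strict_mono \<pi>" for \<pi>
    proof -
      have "push (\<alpha> \<pi>) (p * f) = push (\<alpha> \<pi>) p * push (\<alpha> \<pi>) f"
        using f by (intro push_act_mult \<pi> p keysJ) (simp add: J'_def)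
      then show ?thesis using f \<pi> multJ[OF _ keys_push_act[OF \<pi> p]] by (simp add: J'_def)
    qed
    then show ?thesis using f p multJ by (simp add: J'_def)
  qed
  have "ideal J' ?R"
  proof (rule idealI[OF monoid_algebra_ring])
    show "subgroup J' (add_monoid ?R)"
    proof (rule R.add.subgroupI)
      show "J' \<noteq> {}" using additive_subgroup.zero_closed[OF J.additive_subgroup_axioms] by (auto simp: J'_def)
      fix f assume "f \<in> J'"
      then show "\<ominus>\<^bsub>?R\<^esub> f \<in> J'"
        using monoid_algebra_a_inv[OF monoid_algebra_ring, of f] keysJ minusJ by (simp add: J'_def)
    qed (use keysJ addJ in \<open>auto simp: J'_def\<close>)
  qed (use multJ' in \<open>auto simp: mult.commute\<close>)
  moreover have "?O \<subseteq> J'"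
  proof
    fix f assume f: "f \<in> ?O"
    then obtain f0 \<pi> where f0: "f = push (\<alpha> \<pi>) f0" "f0 \<in> F" "strict_mono \<pi>" unfolding orb by blast
    have "push (\<alpha> \<rho>) f \<in> ?O" if "strict_mono \<rho>" for \<rho>
    proof -
      have "push (\<alpha> \<rho>) f = push (\<alpha> (\<rho> \<circ> \<pi>)) f0"
        unfolding f0(1) push_push using F[OF f0(2)] f0(3) that by (intro push_cong) (auto simp: act_comp)
      then show ?thesis unfolding orb using f0 that strict_mono_o by blast
    qed
    then show "f \<in> J'" using f R.genideal_self[OF O] by (auto simp: J'_def)
  qed
  ultimately have "?J \<subseteq> J'" by (rule R.genideal_minimal)
  then have "stable ?J" by (intro ideal_imp_stable[OF J]) (auto simp: J'_def)
  moreover have "F \<subseteq> ?J"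
  proof
    fix f assume "f \<in> F"
    then have "push (\<alpha> id) f \<in> ?O" unfolding orb using strict_mono_id by blast
    moreover have "push (\<alpha> id) f = push (\<lambda>m. m) f" using F[OF \<open>f \<in> F\<close>] by (intro push_cong) (auto simp: act_id)
    ultimately show "f \<in> ?J" using R.genideal_self[OF O] by auto
  qed
  ultimately show "gen F \<subseteq> ?J" by (rule gen_least)
qed

lemma ring_action_monoid_algebra:
  "ring_action IncN (monoid_algebra G :: ('m \<Rightarrow>\<^sub>0 'r::{comm_ring, comm_monoid_mult}) ring) (\<lambda>\<pi>. push (\<alpha> \<pi>))"
proof -
  interpret R: ring "monoid_algebra G :: ('m \<Rightarrow>\<^sub>0 'r) ring" by (rule monoid_algebra_ring)
  interpret M: monoid IncN
    by (rule monoidI) (auto simp: IncN_def strict_mono_o strict_mono_id)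
  show ?thesis
  proof unfold_locales
    fix \<pi> assume "\<pi> \<in> carrier IncN"
    then show "push (\<alpha> \<pi>) \<in> ring_hom (monoid_algebra G :: ('m \<Rightarrow>\<^sub>0 'r) ring) (monoid_algebra G)"
      by (intro ring_hom_memI) (auto simp: IncN_def push_act_mult act_zero dest: keys_push_act)
  next
    fix f :: "'m \<Rightarrow>\<^sub>0 'r" assume "f \<in> carrier (monoid_algebra G)"
    then have "push (\<alpha> id) f = push (\<lambda>m. m) f" by (intro push_cong) (auto simp: act_id)
    then show "push (\<alpha> \<one>\<^bsub>IncN\<^esub>) f = f" by (simp add: IncN_def)
  next
    fix \<pi> \<rho> and f :: "'m \<Rightarrow>\<^sub>0 'r"
    assume "\<pi> \<in> carrier IncN" "\<rho> \<in> carrier IncN" "f \<in> carrier (monoid_algebra G)"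
    then show "push (\<alpha> (\<pi> \<otimes>\<^bsub>IncN\<^esub> \<rho>)) f = push (\<alpha> \<pi>) (push (\<alpha> \<rho>) f)"
      unfolding push_push by (intro push_cong) (auto simp: IncN_def act_comp)
  qed
qed

text \<open>
The generators can be chosen inside any given generating set \<open>C\<close>; this is what makes it possible to find
binomial generators of the kernel.
\<close>

definition noetherian :: "'r::{comm_ring, comm_monoid_mult} itself \<Rightarrow> bool" where
  "noetherian _ \<longleftrightarrow> (\<forall>C :: ('m \<Rightarrow>\<^sub>0 'r) set. (\<forall>f\<in>C. keys f \<subseteq> G) \<longrightarrow>
     (\<exists>F\<subseteq>C. finite F \<and> C \<subseteq> gen F))"

lemma noetherianD:
  fixes C :: "('m \<Rightarrow>\<^sub>0 'r::{comm_ring, comm_monoid_mult}) set"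
  assumes "noetherian TYPE('r)" "\<And>f. f \<in> C \<Longrightarrow> keys f \<subseteq> G"
  shows "\<exists>F\<subseteq>C. finite F \<and> C \<subseteq> gen F"
  using assms(1)[unfolded noetherian_def, THEN spec, of C] assms(2) by simp

lemma noetherian_imp_noetherian_ring_action:
  assumes "noetherian TYPE('r::{comm_ring, comm_monoid_mult})"
  shows "noetherian_ring_action IncN (monoid_algebra G :: ('m \<Rightarrow>\<^sub>0 'r) ring) (\<lambda>\<pi>. push (\<alpha> \<pi>))"
proof (intro noetherian_ring_action.intro ring_action_monoid_algebra noetherian_ring_action_axioms.intro)
  fix I :: "('m \<Rightarrow>\<^sub>0 'r) set"
  assume I: "ideal I (monoid_algebra G)" and closed: "\<And>\<pi> f. \<pi> \<in> carrier IncN \<Longrightarrow> f \<in> I \<Longrightarrow> push (\<alpha> \<pi>) f \<in> I"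
  have st: "stable I" by (rule ideal_imp_stable[OF I closed]) (auto simp: IncN_def)
  have "\<exists>F\<subseteq>I. finite F \<and> I \<subseteq> gen F"
    by (rule noetherianD[OF assms]) (rule stableD(1)[OF st])
  then obtain F where F: "F \<subseteq> I" "finite F" "I \<subseteq> gen F" by (elim exE conjE)
  have "gen F = I" using F gen_least[OF st F(1)] by blast
  moreover have keys: "keys f \<subseteq> G" if "f \<in> F" for f using F(1) that stableD(1)[OF st] by blast
  ultimately show "\<exists>F. finite F \<and> F \<subseteq> carrier (monoid_algebra G) \<and>
      I = Idl\<^bsub>monoid_algebra G\<^esub> (\<Union>f\<in>F. orbit IncN (\<lambda>\<pi>. push (\<alpha> \<pi>)) f)"
    using F(2) Idl_orbits_eq_gen[OF keys] by (intro exI[of _ F]) auto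
qed

end

text \<open>
Generators of the full preimage of \<open>C'\<close> are mapped to generators of \<open>C'\<close>.
\<close>

lemma noetherian_image:
  assumes G: "inc_monoid G \<alpha>" and G': "inc_monoid G' \<alpha>'"
    and surj: "\<Psi> ` G = G'" and add: "\<And>g h. g \<in> G \<Longrightarrow> h \<in> G \<Longrightarrow> \<Psi> (g + h) = \<Psi> g + \<Psi> h"
    and equiv: "\<And>\<pi> g. strict_mono \<pi> \<Longrightarrow> g \<in> G \<Longrightarrow> \<Psi> (\<alpha> \<pi> g) = \<alpha>' \<pi> (\<Psi> g)"
    and noeth: "inc_monoid.noetherian G \<alpha> TYPE('r::{comm_ring, comm_monoid_mult})"
  shows "inc_monoid.noetherian G' \<alpha>' TYPE('r)"
proof -
  interpret G: inc_monoid G \<alpha> by fact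
  interpret G': inc_monoid G' \<alpha>' by fact
  show ?thesis
    unfolding G'.noetherian_def
  proof (intro allI impI)
    fix C' :: "('b \<Rightarrow>\<^sub>0 'r) set" assume C': "\<forall>f\<in>C'. keys f \<subseteq> G'"
    define C where "C = {p. keys p \<subseteq> G \<and> push \<Psi> p \<in> C'}"
    have "\<exists>F\<subseteq>C. finite F \<and> C \<subseteq> G.gen F"
      by (rule G.noetherianD[OF noeth]) (simp add: C_def)
    then obtain F where F: "F \<subseteq> C" "finite F" "C \<subseteq> G.gen F" by (elim exE conjE)
    let ?F' = "push \<Psi> ` F"
    have F': "?F' \<subseteq> C'" using F(1) by (auto simp: C_def)
    then have st: "G'.stable (G'.gen ?F')" using C' by (intro G'.stable_gen) blast
    have "G.stable {p. keys p \<subseteq> G \<and> push \<Psi> p \<in> G'.gen ?F'}" (is "G.stable ?I")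
      unfolding G.stable_def
    proof (intro conjI ballI allI impI)
      fix f c and r :: 'r assume f: "f \<in> ?I" and c: "c \<in> G"
      have "push \<Psi> (single c r * f) = single (\<Psi> c) r * push \<Psi> f"
        using f c push_mult[of G \<Psi> "single c r" f] add by (auto split: if_splits)
      moreover have "\<Psi> c \<in> G'" using c surj by blast
      moreover have "keys (single c r * f) \<subseteq> G"
        using f c by (intro keys_mult_subset G.add_in) (auto split: if_splits)
      ultimately show "single c r * f \<in> ?I" using f G'.stableD(4)[OF st] by auto
    next
      fix f and \<pi> :: "nat \<Rightarrow> nat" assume f: "f \<in> ?I" and \<pi>: "strict_mono \<pi>"
      have "push \<Psi> (push (\<alpha> \<pi>) f) = push (\<alpha>' \<pi>) (push \<Psi> f)"
        unfolding push_push using f equiv[OF \<pi>] by (intro push_cong) auto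
      then show "push (\<alpha> \<pi>) f \<in> ?I" using f \<pi> G'.stableD(5)[OF st] G.keys_push_act[OF \<pi>, of f] by simp
    qed (simp_all add: G'.stableD(2,3)[OF st] keys_add_subset)
    then have "G.gen F \<subseteq> ?I" using F(1) G'.gen_superset[of ?F'] by (intro G.gen_least) (auto simp: C_def)
    have "C' \<subseteq> G'.gen ?F'"
    proof
      fix f assume f: "f \<in> C'"
      define s where "s = inv_into G \<Psi>"
      have s: "s m \<in> G" "\<Psi> (s m) = m" if "m \<in> G'" for m
        using that surj by (auto simp: s_def inv_into_into f_inv_into_f)
      have "push \<Psi> (push s f) = push (\<lambda>m. m) f" unfolding push_push using f C' s by (intro push_cong) auto
      moreover have "keys (push s f) \<subseteq> G"
        using keys_push[of s f] f C' s(1) by blast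
      ultimately have "push s f \<in> C" using f by (simp add: C_def)
      then have "push s f \<in> ?I" using F(3) \<open>G.gen F \<subseteq> ?I\<close> by blast
      then show "f \<in> G'.gen ?F'" using \<open>push \<Psi> (push s f) = push (\<lambda>m. m) f\<close> by simp
    qed
    then show "\<exists>F\<subseteq>C'. finite F \<and> C' \<subseteq> G'.gen F" using F' F(2) by blast
  qed
qed

section \<open>Noetherianity from leading monomials\<close>

lemma coeff_ring_simps [simp]:
  "carrier coeff_ring = UNIV" "monoid.mult coeff_ring = (*)" "monoid.one coeff_ring = 1"
  "ring.zero coeff_ring = 0" "ring.add coeff_ring = (+)"
  by (simp_all add: coeff_ring_def)

text \<open>
The ideals of the combinations of the first \<open>n\<close> terms form a chain, which becomes stationary.
\<close>

lemma noetherian_coeff_sequence: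
  fixes r :: "nat \<Rightarrow> 'r::{comm_ring, comm_monoid_mult}"
  assumes noeth: "noetherian_ring (coeff_ring :: 'r ring)"
  shows "\<exists>n a. r n = (\<Sum>i<n. a i * r i)"
proof -
  interpret noetherian_ring "coeff_ring :: 'r ring" by fact
  define J where "J n = {\<Sum>i<n. a i * r i | a. True}" for n
  have J_I: "(\<Sum>i<n. a i * r i) \<in> J n" for n a by (auto simp: J_def)
  have "ideal (J n) coeff_ring" for n
  proof (rule idealI[OF ring_axioms])
    show "subgroup (J n) (add_monoid coeff_ring)"
    proof (rule add.subgroupI)
      fix x assume "x \<in> J n"
      then obtain a where a: "x = (\<Sum>i<n. a i * r i)" by (auto simp: J_def)
      have "\<ominus>\<^bsub>coeff_ring\<^esub> x = - x" by (intro minus_equality) auto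
      also have "\<dots> = (\<Sum>i<n. (- a i) * r i)" by (simp add: a sum_negf)
      also have "\<dots> \<in> J n" by (rule J_I)
      finally show "\<ominus>\<^bsub>coeff_ring\<^esub> x \<in> J n" .
    next
      fix x y assume "x \<in> J n" "y \<in> J n"
      then obtain a b where "x = (\<Sum>i<n. a i * r i)" "y = (\<Sum>i<n. b i * r i)" by (auto simp: J_def)
      then have "x + y = (\<Sum>i<n. (a i + b i) * r i)" by (simp add: distrib_right sum.distrib)
      also have "\<dots> \<in> J n" by (rule J_I)
      finally show "x \<oplus>\<^bsub>coeff_ring\<^esub> y \<in> J n" by simp
    qed (use J_I in auto)
  next
    fix x c assume "x \<in> J n"
    then obtain a where a: "x = (\<Sum>i<n. a i * r i)" by (auto simp: J_def)
    have "c * x = (\<Sum>i<n. (c * a i) * r i)" by (simp add: a sum_distrib_left mult.assoc)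
    also have "\<dots> \<in> J n" by (rule J_I)
    finally have "c * x \<in> J n" .
    then show "c \<otimes>\<^bsub>coeff_ring\<^esub> x \<in> J n" "x \<otimes>\<^bsub>coeff_ring\<^esub> c \<in> J n" by (simp_all add: mult.commute)
  qed
  moreover have mono: "J n \<subseteq> J m" if "n \<le> m" for n m
  proof
    fix x assume "x \<in> J n"
    then obtain a where a: "x = (\<Sum>i<n. a i * r i)" by (auto simp: J_def)
    also have "\<dots> = (\<Sum>i<m. (if i < n then a i else 0) * r i)"
      using that by (intro sum.mono_neutral_cong_left) auto
    also have "\<dots> \<in> J m" by (rule J_I)
    finally show "x \<in> J m" .
  qed
  ultimately have "subset.chain {I. ideal I coeff_ring} (range J)"
    by (auto simp: subset_chain_def) (metis nle_le subsetD)
  then have "\<Union> (range J) \<in> range J" by (intro ideal_chain_is_trivial) auto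
  then obtain n where n: "\<Union> (range J) = J n" by auto
  \<comment> \<open>the term \<open>r n\<close> lies in the next ideal of the chain, hence in the stationary one\<close>
  have "r n = (\<Sum>i<Suc n. (if i = n then 1 else 0) * r i)" by (simp add: if_distrib[of "\<lambda>x. x * _"] cong: if_cong)
  also have "\<dots> \<in> J (Suc n)" by (rule J_I)
  also have "\<dots> \<subseteq> J n" using n by blast
  finally show ?thesis by (auto simp: J_def)
qed

locale ordered_inc_monoid = inc_monoid G \<alpha>
  for G :: "'m::{wellorder, ordered_cancel_comm_monoid_add} set" and \<alpha> +
  assumes act_less: "strict_mono \<pi> \<Longrightarrow> g \<in> G \<Longrightarrow> h \<in> G \<Longrightarrow> g < h \<Longrightarrow> \<alpha> \<pi> g < \<alpha> \<pi> h"
begin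

text \<open>
The quotient \<open>c\<close> has to lie in \<open>G\<close>: this is divisibility up to increasing maps in \<open>G\<close>, not in an ambient free
monoid.
\<close>

definition inc_dvd :: "'m \<Rightarrow> 'm \<Rightarrow> bool" where
  "inc_dvd g h \<longleftrightarrow> g \<in> G \<and> h \<in> G \<and> (\<exists>\<pi> c. strict_mono \<pi> \<and> c \<in> G \<and> h = \<alpha> \<pi> g + c)"

lemma transp_inc_dvd: "transp inc_dvd"
proof (rule transpI)
  fix x y z assume "inc_dvd x y" "inc_dvd y z"
  then obtain \<pi> c \<rho> d where *: "x \<in> G" "z \<in> G" "strict_mono \<pi>" "c \<in> G" "y = \<alpha> \<pi> x + c"
    "strict_mono \<rho>" "d \<in> G" "z = \<alpha> \<rho> y + d" by (auto simp: inc_dvd_def)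
  then have "z = \<alpha> (\<rho> \<circ> \<pi>) x + (\<alpha> \<rho> c + d)" by (simp add: act_add act_in act_comp add.assoc)
  moreover have "strict_mono (\<rho> \<circ> \<pi>)" "\<alpha> \<rho> c + d \<in> G" using * by (simp_all add: strict_mono_o act_in add_in)
  ultimately show "inc_dvd x z" unfolding inc_dvd_def using *(1,2) by (intro conjI exI)
qed

definition lead :: "('m \<Rightarrow>\<^sub>0 'r::zero) \<Rightarrow> 'm" where
  "lead f = Max (keys f)"

lemma lead_in: "f \<noteq> 0 \<Longrightarrow> lead f \<in> keys f"
  and lead_ge: "m \<in> keys f \<Longrightarrow> m \<le> lead f"
proof -
  show "lead f \<in> keys f" if "f \<noteq> 0"
    unfolding lead_def using that by (intro Max_in) (auto simp: poly_mapping_eq_iff fun_eq_iff in_keys_iff)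
qed (simp add: lead_def)

lemma translate_eq_sum:
  fixes f :: "'m \<Rightarrow>\<^sub>0 'r::{comm_ring, comm_monoid_mult}" and c :: 'm
  shows "single c a * push h f =
    (\<Sum>m\<in>keys f. single (h m + c) (a * lookup f m))"
  unfolding push_def sum_distrib_left mult_single by (rule sum.cong) (simp_all add: add.commute)

text \<open>
Translation by an increasing map and by a monomial keeps the order of the exponents of \<open>f\<close>, so it moves the
leading term to the leading term.
\<close>

lemma translate_lead:
  fixes f :: "'m \<Rightarrow>\<^sub>0 'r::{comm_ring, comm_monoid_mult}" and a :: 'r and c :: 'm
  assumes f: "f \<noteq> 0" "keys f \<subseteq> G" and \<pi>: "strict_mono \<pi>"
  defines "T \<equiv> single c a * push (\<alpha> \<pi>) f"
  shows "lookup T (\<alpha> \<pi> (lead f) + c) = a * lookup f (lead f)"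
    and "m \<in> keys T \<Longrightarrow> m \<le> \<alpha> \<pi> (lead f) + c"
proof -
  let ?K = "keys f"
  have less: "\<alpha> \<pi> m + c < \<alpha> \<pi> (lead f) + c" if "m \<in> ?K" "m \<noteq> lead f" for m
    using that lead_in[OF f(1)] lead_ge[of m f] f(2) \<pi>
    by (intro add_strict_right_mono act_less) auto
  have "lookup T (\<alpha> \<pi> (lead f) + c) =
      (\<Sum>m\<in>?K. if m = lead f then a * lookup f m else 0)"
    unfolding T_def translate_eq_sum lookup_sum
  proof (intro sum.cong refl)
    fix m assume "m \<in> ?K"
    then show "lookup (single (\<alpha> \<pi> m + c) (a * lookup f m)) (\<alpha> \<pi> (lead f) + c) =
        (if m = lead f then a * lookup f m else 0)"
      using less[of m] by (cases "m = lead f") (auto simp: lookup_single when_def)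
  qed
  then show "lookup T (\<alpha> \<pi> (lead f) + c) = a * lookup f (lead f)"
    using lead_in[OF f(1)] by simp
  assume "m \<in> keys T"
  then have "m \<in> (\<Union>m\<in>?K. keys (single (\<alpha> \<pi> m + c) (a * lookup f m)))"
    unfolding T_def translate_eq_sum by (rule subsetD[OF keys_sum])
  then obtain m' where "m' \<in> ?K" "m = \<alpha> \<pi> m' + c" by (auto split: if_splits)
  then show "m \<le> \<alpha> \<pi> (lead f) + c" using less[of m'] by (cases "m' = lead f") auto
qed

text \<open>
Otherwise choose \<open>f n\<close> with least leading exponent among the elements of \<open>I\<close> outside the stable ideal of the
earlier ones. Along a subsequence the leading exponents divide each other, and some leading coefficient is a
combination of the earlier ones. Subtracting the corresponding combination of translates cancels the leading
term, against minimality.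
\<close>

lemma stable_finitely_generated:
  fixes I :: "('m \<Rightarrow>\<^sub>0 'r::{comm_ring, comm_monoid_mult}) set"
  assumes noeth: "noetherian_ring (coeff_ring :: 'r ring)" and af: "almost_full_on G inc_dvd" and I: "stable I"
  shows "\<exists>F\<subseteq>I. finite F \<and> I \<subseteq> gen F"
proof (rule ccontr)
  assume not: "\<not> ?thesis"
  have st: "stable (gen F)" if "F \<subseteq> I" for F
    using that stableD(1)[OF I] by (intro stable_gen) blast
  define least where "least F f \<longleftrightarrow> f \<in> I - gen F \<and> (\<forall>g\<in>I - gen F. lead f \<le> lead g)" for F f
  have ex: "\<exists>f. least F f" if "finite F" "F \<subseteq> I" for F
  proof -
    have "\<exists>f. f \<in> I - gen F" using not that by blast
    then have "\<exists>x. \<exists>f\<in>I - gen F. lead f = x" by blast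
    from exists_least_iff[THEN iffD1, OF this]
    obtain x where x: "\<exists>f\<in>I - gen F. lead f = x" "\<forall>y<x. \<not> (\<exists>f\<in>I - gen F. lead f = y)" by blast
    then obtain f where f: "f \<in> I - gen F" "lead f = x" by blast
    have "lead f \<le> lead g" if "g \<in> I - gen F" for g
      unfolding f(2) using x(2)[rule_format, of "lead g"] that by (intro leI notI) blast
    then show ?thesis unfolding least_def using f(1) by (intro exI[of _ f] conjI ballI)
  qed
  define pick where "pick F = (SOME f. least F f)" for F
  have pick: "least F (pick F)" if "finite F" "F \<subseteq> I" for F
    unfolding pick_def using ex[OF that] by (rule someI_ex)
  define S where "S = rec_nat {} (\<lambda>_ F. insert (pick F) F)"
  have S: "S 0 = {}" "S (Suc n) = insert (pick (S n)) (S n)" for n by (simp_all add: S_def)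
  have SI: "finite (S n) \<and> S n \<subseteq> I" for n
  proof (induction n)
    case (Suc n)
    then have "least (S n) (pick (S n))" by (intro pick) simp_all
    then show ?case using Suc by (simp add: S least_def)
  qed (simp add: S)
  define f where "f n = pick (S n)" for n
  have f: "f n \<in> I" "f n \<notin> gen (S n)" "\<And>g. g \<in> I \<Longrightarrow> g \<notin> gen (S n) \<Longrightarrow> lead (f n) \<le> lead g" for n
    using pick[of "S n"] SI[of n] by (simp_all add: f_def least_def)
  have f_S: "f i \<in> S n" if "i < n" for i n
    using that by (induction n) (auto simp: S(2) f_def less_Suc_eq)
  have nz: "f n \<noteq> 0" for n
  proof
    assume "f n = 0"
    moreover have "0 \<in> gen (S n)" using SI[of n] by (intro stableD(2)[OF st]) simp
    ultimately show False using f(2)[of n] by simp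
  qed
  have keys: "keys (f n) \<subseteq> G" for n using stableD(1)[OF I f(1)] .
  have "lead (f n) \<in> G" for n using lead_in[OF nz] keys by blast
  from almost_full_on_chain[where f = "\<lambda>n. lead (f n)", OF af transp_inc_dvd this]
  obtain r :: "nat \<Rightarrow> nat" where r: "strict_mono r" "\<And>i j. i < j \<Longrightarrow> inc_dvd (lead (f (r i))) (lead (f (r j)))" by blast
  obtain n a where na: "lookup (f (r n)) (lead (f (r n))) =
      (\<Sum>i<n. a i * lookup (f (r i)) (lead (f (r i))))"
    using noetherian_coeff_sequence[OF noeth, of "\<lambda>i. lookup (f (r i)) (lead (f (r i)))"] by blast
  define M where "M = lead (f (r n))"
  have "\<forall>i<n. \<exists>\<pi> c. strict_mono \<pi> \<and> c \<in> G \<and> M = \<alpha> \<pi> (lead (f (r i))) + c"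
    using r(2) by (auto simp: inc_dvd_def M_def)
  then obtain \<pi> c where \<pi>c: "\<And>i. i < n \<Longrightarrow> strict_mono (\<pi> i)" "\<And>i. i < n \<Longrightarrow> c i \<in> G"
    "\<And>i. i < n \<Longrightarrow> M = \<alpha> (\<pi> i) (lead (f (r i))) + c i" by metis
  define T where "T i = single (c i) (a i) * push (\<alpha> (\<pi> i)) (f (r i))" for i
  have T_lead: "lookup (T i) M = a i * lookup (f (r i)) (lead (f (r i)))" if "i < n" for i
    unfolding T_def \<pi>c(3)[OF that] by (rule translate_lead(1)[OF nz keys \<pi>c(1)[OF that]])
  have T_le: "m \<le> M" if "i < n" "m \<in> keys (T i)" for i m
    using that(2) unfolding T_def \<pi>c(3)[OF that(1)] by (rule translate_lead(2)[OF nz keys \<pi>c(1)[OF that(1)]])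
  define h where "h = (\<Sum>i<n. T i)"
  have T: "T i \<in> J" if "i < n" "stable J" "f (r i) \<in> J" for i J
    unfolding T_def using that \<pi>c by (intro stableD(4)[OF that(2)] stableD(5)[OF that(2)]) auto
  have hJ: "h \<in> J" if J: "stable J" "\<And>i. i < n \<Longrightarrow> f (r i) \<in> J" for J
    unfolding h_def using J T by (intro stable_sum[OF J(1)]) auto
  have "h \<in> I" by (rule hJ[OF I f(1)])
  have st_S: "stable (gen (S (r n)))" using SI by (intro st) blast
  have h_gen: "h \<in> gen (S (r n))"
    using r(1) gen_superset[of "S (r n)"] f_S by (intro hJ[OF st_S]) (auto simp: strict_mono_less)
  define g where "g = f (r n) - h"
  have "g \<in> I" unfolding g_def using f(1) \<open>h \<in> I\<close> by (rule stable_diff[OF I])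
  have "f (r n) = g + h" by (simp add: g_def)
  then have g_gen: "g \<notin> gen (S (r n))" using f(2)[of "r n"] stableD(3)[OF st_S _ h_gen, of g] by auto
  then have "g \<noteq> 0" using stableD(2)[OF st_S] by auto
  have "lookup h M = (\<Sum>i<n. a i * lookup (f (r i)) (lead (f (r i))))"
    unfolding h_def lookup_sum using T_lead by (intro sum.cong refl) simp
  then have "lookup g M = 0" using na by (simp add: g_def M_def lookup_minus)
  moreover have "m \<le> M" if "m \<in> keys g" for m
  proof (cases "m \<in> keys (f (r n))")
    case True
    then show ?thesis by (simp add: M_def lead_ge)
  next
    case False
    then have "m \<in> keys h" using that by (auto simp: g_def in_keys_iff lookup_minus)
    then obtain i where i: "i < n" "m \<in> keys (T i)" unfolding h_def using keys_sum[of T "{..<n}"] by blast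
    then show ?thesis by (rule T_le)
  qed
  ultimately have "lead g < M" using lead_in[OF \<open>g \<noteq> 0\<close>] by (auto simp: in_keys_iff order.strict_iff_order)
  moreover have "M \<le> lead g" unfolding M_def using \<open>g \<in> I\<close> g_gen by (rule f(3))
  ultimately show False by simp
qed

theorem noetherian_if_almost_full:
  assumes noeth: "noetherian_ring (coeff_ring :: 'r::{comm_ring, comm_monoid_mult} ring)" and af: "almost_full_on G inc_dvd"
  shows "noetherian TYPE('r)"
  unfolding noetherian_def
proof (intro allI impI)
  fix C :: "('m \<Rightarrow>\<^sub>0 'r) set" assume C: "\<forall>f\<in>C. keys f \<subseteq> G"
  then have st: "stable (gen C)" by (intro stable_gen) blast
  from stable_finitely_generated[OF noeth af this]
  obtain F where F: "F \<subseteq> gen C" "finite F" "gen C \<subseteq> gen F" by (elim exE conjE)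
  have "\<exists>C0\<subseteq>C. finite C0 \<and> F \<subseteq> gen C0" using C by (intro gen_finitary F(1,2)) simp
  then obtain C0 where C0: "C0 \<subseteq> C" "finite C0" "F \<subseteq> gen C0" by (elim exE conjE)
  have "stable (gen C0)" using C C0(1) by (intro stable_gen) blast
  then have "gen F \<subseteq> gen C0" using C0(3) by (rule gen_least)
  then have "C \<subseteq> gen C0" using F(3) gen_superset[of C] by (meson order_trans)
  then show "\<exists>F\<subseteq>C. finite F \<and> C \<subseteq> gen F" using C0(1,2) by (intro exI[of _ C0] conjI)
qed

end

section \<open>Division in the matching monoid\<close>

definition shift :: "(nat \<Rightarrow> nat) \<Rightarrow> nat \<times> nat \<times> nat \<Rightarrow> nat \<times> nat \<times> nat" where
  "shift \<pi> x = (fst x, fst (snd x), \<pi> (snd (snd x)))"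

definition move :: "(nat \<Rightarrow> nat) \<Rightarrow> nat \<times> nat list \<Rightarrow> nat \<times> nat list" where
  "move \<pi> t = (fst t, map \<pi> (snd t))"

lemma move_in: "inj \<pi> \<Longrightarrow> t \<in> matchings N K \<Longrightarrow> move \<pi> t \<in> matchings N K"
  by (auto simp: matchings_def move_def distinct_map intro: inj_on_subset)

lemma cells_move: "length (snd t) = K \<Longrightarrow> cells K (move \<pi> t) = image_mset (shift \<pi>) (cells K t)"
  unfolding cells_def multiset.map_comp by (rule image_mset_cong) (auto simp: move_def shift_def)

lemma cell_sum_move:
  assumes "set_mset M \<subseteq> matchings N K"
  shows "cell_sum K (image_mset (move \<pi>) M) = image_mset (shift \<pi>) (cell_sum K M)"
  using assms by (induction M) (auto simp: cells_move matchings_def)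

text \<open>
Multisets over the lexicographically ordered cells are well-ordered by the multiset order, and a map that
is increasing on the columns is increasing on the cells.
\<close>

lemma matching_monoid_ordered:
  "ordered_inc_monoid (matching_monoid N K) (\<lambda>\<pi>. image_mset (shift \<pi>))"
proof unfold_locales
  show "0 \<in> matching_monoid N K"
    unfolding matching_monoid_def by (intro image_eqI[of _ _ "{#}"]) auto
  show "g + h \<in> matching_monoid N K" if "g \<in> matching_monoid N K" "h \<in> matching_monoid N K" for g h
  proof -
    from that obtain M M' where "g = cell_sum K M" "h = cell_sum K M'" "set_mset M \<subseteq> matchings N K" "set_mset M' \<subseteq> matchings N K"
      by (auto simp: matching_monoid_def)
    then show ?thesis unfolding matching_monoid_def by (intro image_eqI[of _ _ "M + M'"]) auto
  qed
  show "image_mset (shift \<pi>) g \<in> matching_monoid N K" if "strict_mono \<pi>" "g \<in> matching_monoid N K" for \<pi> g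
  proof -
    from that obtain M where M: "g = cell_sum K M" "set_mset M \<subseteq> matchings N K"
      by (auto simp: matching_monoid_def)
    then have "set_mset (image_mset (move \<pi>) M) \<subseteq> matchings N K"
      using move_in[of \<pi> _ N K] that(1) strict_mono_imp_inj_on[of \<pi>] by auto
    then show ?thesis
      unfolding matching_monoid_def M(1) cell_sum_move[OF M(2), symmetric] by blast
  qed
  show "image_mset (shift \<pi>) g < image_mset (shift \<pi>) h" if "strict_mono \<pi>" "g < h" for \<pi> g h
    using that by (intro image_mset_strict_mono) (auto simp: shift_def less_prod_def less_eq_prod_def strict_mono_less)
  show "image_mset (shift (\<pi> \<circ> \<rho>)) g = image_mset (shift \<pi>) (image_mset (shift \<rho>) g)" for \<pi> \<rho> g
    unfolding multiset.map_comp by (rule image_mset_cong) (simp add: shift_def)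
qed (auto simp: shift_def intro: trans[OF image_mset_cong multiset.map_ident])

lemma count_image_mset_inj: "inj f \<Longrightarrow> count (image_mset f M) (f x) = count M x"
  by (induction M) (auto simp: inj_eq)

lemma row_shift [simp]: "row p l (image_mset (shift \<pi>) g) = row p l g"
  by (simp add: row_def filter_mset_image_mset shift_def)

lemma col_shift:
  assumes "inj \<pi>"
  shows "col p (\<pi> b) (image_mset (shift \<pi>) g) = col p b g"
  using assms by (simp add: col_def filter_mset_image_mset shift_def inj_eq)

lemma col_shift_outside: "j \<notin> range \<pi> \<Longrightarrow> col p j (image_mset (shift \<pi>) g) = 0"
  by (auto simp: col_def filter_mset_image_mset shift_def filter_mset_eq_mempty_iff)

lemma sum_col_le:
  assumes "finite S"
  shows "(\<Sum>b\<in>S. col p b g) \<le> size (filter_mset (\<lambda>x. fst x = p) g)"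
proof (induction g)
  case (add x g)
  have "(\<Sum>b\<in>S. col p b (add_mset x g)) = (\<Sum>b\<in>S. col p b g + (if b = snd (snd x) then if fst x = p then 1 else 0 else 0))"
    by (rule sum.cong) (auto simp: col_def)
  also have "\<dots> \<le> (\<Sum>b\<in>S. col p b g) + (if fst x = p then 1 else 0)"
    using assms by (simp add: sum.distrib)
  finally show ?case using add by auto
qed (simp add: col_def)

lemma size_eq_sum_row:
  assumes "\<And>x. x \<in># g \<Longrightarrow> fst (snd x) < K"
  shows "size (filter_mset (\<lambda>x. fst x = p) g) = (\<Sum>l<K. row p l g)"
  using assms
proof (induction g)
  case (add x g)
  have "(\<Sum>l<K. row p l (add_mset x g)) = (\<Sum>l<K. row p l g + (if l = fst (snd x) then if fst x = p then 1 else 0 else 0))"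
    by (rule sum.cong) (auto simp: row_def)
  also have "\<dots> = (\<Sum>l<K. row p l g) + (if fst x = p then 1 else 0)"
    using add.prems[of x] by (simp add: sum.distrib)
  finally show ?case using add by auto
qed (simp add: row_def)

lemma col_eq_0: "(\<And>x. x \<in># g \<Longrightarrow> snd (snd x) < b) \<Longrightarrow> b \<le> j \<Longrightarrow> col p j g = 0"
  by (fastforce simp: col_def filter_mset_eq_mempty_iff)

lemma matching_monoidD:
  assumes "g \<in> matching_monoid N K" "0 < K"
  shows "x \<in># g \<Longrightarrow> fst x < N \<and> fst (snd x) < K"
    and "p < N \<Longrightarrow> l < K \<Longrightarrow> row p l g = row p 0 g" and "p < N \<Longrightarrow> col p j g \<le> row p 0 g"
    and "p < N \<Longrightarrow> finite S \<Longrightarrow> (\<Sum>b\<in>S. col p b g) \<le> K * row p 0 g"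
proof -
  from assms(1) obtain d where d: "\<And>x. x \<in># g \<Longrightarrow> fst x < N \<and> fst (snd x) < K"
    "\<And>p l. p < N \<Longrightarrow> l < K \<Longrightarrow> row p l g = d p" "\<And>p j. p < N \<Longrightarrow> col p j g \<le> d p"
    unfolding matching_monoid_iff by blast
  then show 1: "x \<in># g \<Longrightarrow> fst x < N \<and> fst (snd x) < K" for x by blast
  show 2: "row p l g = row p 0 g" if "p < N" "l < K" for p l using that d(2) assms(2) by simp
  show "p < N \<Longrightarrow> col p j g \<le> row p 0 g" using d(2,3) assms(2) by simp
  assume "p < N" "finite S"
  then have "(\<Sum>b\<in>S. col p b g) \<le> (\<Sum>l<K. row p l g)"
    using sum_col_le[of S p g] size_eq_sum_row[of g K p] 1 by simp
  also have "\<dots> = (\<Sum>l<K. row p 0 g)" using \<open>p < N\<close> by (intro sum.cong refl 2) auto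
  finally show "(\<Sum>b\<in>S. col p b g) \<le> K * row p 0 g" by simp
qed

text \<open>
By \<open>matching_monoid_iff\<close> the quotient lies in the monoid if its column sums are at most the difference
of the row sums. In a column hit by \<open>\<pi>\<close> this says that the room left by \<open>A\<close> is at most the room left by \<open>A'\<close>. In
the other columns nothing is subtracted from \<open>A'\<close>.
\<close>

lemma inc_dvd_matching_monoid:
  assumes A: "A \<in> matching_monoid N K" "A' \<in> matching_monoid N K" and K: "0 < K" and \<pi>: "strict_mono \<pi>"
    and count: "\<And>p l b. p < N \<Longrightarrow> l < K \<Longrightarrow> count A (p, l, b) \<le> count A' (p, l, \<pi> b)"
    and inside: "\<And>p b. p < N \<Longrightarrow> col p (\<pi> b) A' + row p 0 A \<le> row p 0 A' + col p b A"
    and outside: "\<And>p j. p < N \<Longrightarrow> j \<notin> range \<pi> \<Longrightarrow> col p j A' + row p 0 A \<le> row p 0 A'"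
  shows "ordered_inc_monoid.inc_dvd (matching_monoid N K) (\<lambda>\<pi>. image_mset (shift \<pi>)) A A'"
proof -
  interpret ordered_inc_monoid "matching_monoid N K" "\<lambda>\<pi>. image_mset (shift \<pi>)" by (rule matching_monoid_ordered)
  have inj: "inj \<pi>" using \<pi> by (rule strict_mono_imp_inj_on)
  have inj_shift: "inj (shift \<pi>)" using inj by (auto simp: inj_def shift_def)
  define B where "B = image_mset (shift \<pi>) A"
  have "B \<subseteq># A'"
  proof (rule mset_subset_eqI)
    fix x
    show "count B x \<le> count A' x"
    proof (cases "x \<in># B")
      case True
      then obtain y where y: "y \<in># A" "x = shift \<pi> y" by (auto simp: B_def)
      obtain p l b where "y = (p, l, b)" by (cases y)
      moreover have "count B x = count A y"
        unfolding B_def y(2) by (rule count_image_mset_inj[OF inj_shift])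
      moreover have "p < N" "l < K" using matching_monoidD(1)[OF A(1) K y(1)] \<open>y = (p, l, b)\<close> by auto
      ultimately show ?thesis using count[of p l b] y(2) by (simp add: shift_def)
    qed (simp add: not_in_iff)
  qed
  define C where "C = A' - B"
  have A': "A' = B + C" using \<open>B \<subseteq># A'\<close> by (simp add: C_def)
  have "C \<in> matching_monoid N K"
    unfolding matching_monoid_iff
  proof (intro conjI exI[of _ "\<lambda>p. row p 0 A' - row p 0 A"] ballI allI impI)
    fix x assume "x \<in># C"
    then have "x \<in># A'" by (simp add: A')
    then show "fst x < N" "fst (snd x) < K" using matching_monoidD(1)[OF A(2) K] by auto
  next
    fix p l assume "p < N" "l < K"
    then have "row p l A' = row p 0 A'" "row p l A = row p 0 A"
      by (rule matching_monoidD(2)[OF A(2) K], rule matching_monoidD(2)[OF A(1) K])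
    moreover have "row p l A' = row p l A + row p l C" by (simp add: A' B_def)
    ultimately show "row p l C = row p 0 A' - row p 0 A" by linarith
  next
    fix p j assume p: "p < N"
    show "col p j C \<le> row p 0 A' - row p 0 A"
    proof (cases "j \<in> range \<pi>")
      case True
      then obtain b where b: "j = \<pi> b" by blast
      have "col p j A' = col p b A + col p j C" by (simp add: A' B_def b col_shift[OF inj])
      then show ?thesis using inside[OF p, of b] b by simp
    next
      case False
      then have "col p j A' = col p j C" by (simp add: A' B_def col_shift_outside)
      then show ?thesis using outside[OF p False] by simp
    qed
  qed
  then have "strict_mono \<pi> \<and> C \<in> matching_monoid N K \<and> A' = image_mset (shift \<pi>) A + C"
    using \<pi> A' by (simp add: B_def)
  then have "\<exists>\<pi> c. strict_mono \<pi> \<and> c \<in> matching_monoid N K \<and> A' = image_mset (shift \<pi>) A + c" 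
    by (intro exI[of _ \<pi>] exI[of _ C])
  then show ?thesis unfolding inc_dvd_def using A by (intro conjI)
qed

text \<open>
A column of the larger array that is not matched must have room for the row sums of the smaller one. If the
row sums of a colour double, this holds for columns that are at most half full in this colour; if they are
constant, for columns that are empty in it. The other columns are called wide, and a column is big if it is
wide for some colour. The row sums bound the number of wide columns by the constant \<open>cap\<close>. So it suffices that \<open>\<pi>\<close>
maps big columns to big columns and reaches all of them, which it does if the larger array does not have more
of them than the smaller one.
\<close>

theorem matching_monoid_almost_full:
  assumes K: "0 < K"
  shows "almost_full_on (matching_monoid N K)
    (ordered_inc_monoid.inc_dvd (matching_monoid N K) (\<lambda>\<pi>. image_mset (shift \<pi>)))"
  unfolding almost_full_on_def
proof (intro allI impI)
  fix f :: "nat \<Rightarrow> (nat \<times> nat \<times> nat) multiset"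
  assume "\<forall>n. f n \<in> matching_monoid N K"
  obtain r :: "nat \<Rightarrow> nat" where r: "strict_mono r"
    "\<forall>p\<in>{..<N}. (\<forall>i j. row p 0 (f (r i)) = row p 0 (f (r j))) \<or>
       (\<forall>i j. i < j \<longrightarrow> 2 * row p 0 (f (r i)) \<le> row p 0 (f (r j)))"
    using nat_seqs_constant_or_doubling[of "{..<N}" "\<lambda>p n. row p 0 (f n)"] by auto
  define g where "g n = f (r n)" for n
  have g: "g n \<in> matching_monoid N K" for n using \<open>\<forall>n. f n \<in> matching_monoid N K\<close> by (simp add: g_def)
  note gD = matching_monoidD[OF g K]
  define const where "const p \<longleftrightarrow> (\<forall>i j. row p 0 (g i) = row p 0 (g j))" for p
  have const_eq: "row p 0 (g i) = row p 0 (g j)" if "const p" for p i j using that unfolding const_def by blast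
  have doubling: "2 * row p 0 (g i) \<le> row p 0 (g j)" if "p < N" "\<not> const p" "i < j" for p i j
    using r(2) that by (auto simp: const_def g_def)
  define wide where "wide p n b \<longleftrightarrow> (if const p then 0 < col p b (g n) else row p 0 (g n) < 2 * col p b (g n))" for p n b
  define big where "big n b \<longleftrightarrow> (\<exists>p<N. wide p n b)" for n b
  define cap where "cap p = (if const p then K * row p 0 (g 0) else 2 * K)" for p
  obtain L where L: "\<And>n x. x \<in># g n \<Longrightarrow> snd (snd x) < L n"
  proof -
    have "\<exists>b. \<forall>x\<in>#g n. snd (snd x) < b" for n
      using finite_nat_set_iff_bounded[of "(\<lambda>x. snd (snd x)) ` set_mset (g n)"] by auto
    then have "\<exists>L. \<forall>n. \<forall>x\<in>#g n. snd (snd x) < L n" by (intro choice allI)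
    then show thesis using that by blast
  qed
  have col0: "col p b (g n) = 0" if "L n \<le> b" for p b n using L that by (rule col_eq_0)
  have wide_L: "b < L n" if "wide p n b" for p n b
    using that col0[of n b p] by (cases "b < L n") (auto simp: wide_def split: if_splits)
  then have wide_fin: "finite {b. wide p n b}" for p n
    by (intro finite_subset[OF _ finite_lessThan[of "L n"]]) auto
  have card_wide: "card {b. wide p n b} \<le> cap p" if p: "p < N" for p n
  proof (cases "const p")
    case True
    have "card {b. wide p n b} = (\<Sum>b | wide p n b. 1)" by simp
    also have "\<dots> \<le> (\<Sum>b | wide p n b. col p b (g n))" using True by (intro sum_mono) (auto simp: wide_def)
    also have "\<dots> \<le> K * row p 0 (g n)" by (rule gD(4)[OF p wide_fin])
    also have "\<dots> = K * row p 0 (g 0)" using const_eq[OF True, of n 0] by simp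
    finally show ?thesis using True by (simp add: cap_def)
  next
    case False
    have "card {b. wide p n b} * (row p 0 (g n) + 1) = (\<Sum>b | wide p n b. row p 0 (g n) + 1)" by simp
    also have "\<dots> \<le> (\<Sum>b | wide p n b. 2 * col p b (g n))" using False by (intro sum_mono) (auto simp: wide_def)
    also have "\<dots> = 2 * (\<Sum>b | wide p n b. col p b (g n))" by (simp add: sum_distrib_left)
    also have "\<dots> \<le> 2 * (K * row p 0 (g n))" by (intro mult_le_mono2 gD(4)[OF p wide_fin])
    also have "\<dots> \<le> (2 * K) * (row p 0 (g n) + 1)" by simp
    finally have "card {b. wide p n b} \<le> 2 * K" by (simp only: mult_le_cancel2)
    then show ?thesis using False by (simp add: cap_def)
  qed
  have big_UN: "{b. big n b} = (\<Union>p<N. {b. wide p n b})" for n by (auto simp: big_def)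
  have big_fin: "finite {b. big n b}" for n unfolding big_UN using wide_fin by blast
  have card_big: "card {b. big n b} \<le> (\<Sum>p<N. cap p)" for n
  proof -
    have "card {b. big n b} \<le> (\<Sum>p<N. card {b. wide p n b})" unfolding big_UN by (rule card_UN_le) simp
    also have "\<dots> \<le> (\<Sum>p<N. cap p)" by (intro sum_mono card_wide) simp
    finally show ?thesis .
  qed
  \<comment> \<open>the entries of column \<open>b\<close>, and at row \<open>K\<close> the room that is left in it\<close>
  define vec where "vec n b x = (if snd x < K then count (g n) (fst x, snd x, b) else row (fst x) 0 (g n) - col (fst x) b (g n))"
    for n b and x :: "nat \<times> nat"
  define word where "word n = map (\<lambda>b. (big n b, vec n b)) [0..<L n]" for n
  define R where "R x y \<longleftrightarrow> fst x = fst y \<and> (\<forall>i\<in>{..<N} \<times> {..K}. snd x i \<le> snd y i)"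
    for x y :: "bool \<times> (nat \<times> nat \<Rightarrow> nat)"
  have "almost_full (\<lambda>x y :: bool \<times> (nat \<times> nat \<Rightarrow> nat). fst x = fst y \<and> (\<forall>i\<in>{..<N} \<times> {..K}. snd x i \<le> snd y i))"
    by (rule almost_full_prod[OF almost_full_eq_bool _ dickson]) (simp_all add: transp_def)
  then have "almost_full R" unfolding R_def .
  moreover have "transp R" unfolding transp_def R_def by (meson order_trans)
  ultimately have "almost_full (list_emb R)" by (rule higman)
  \<comment> \<open>the first component makes the number of big columns weakly decreasing\<close>
  then have af: "almost_full (\<lambda>x y :: nat \<times> _ list. fst x \<le> fst y \<and> list_emb R (snd x) (snd y))"
    by (intro almost_full_prod[OF almost_full_nat_le]) (simp_all add: transp_def)
  have "\<exists>i j :: nat. i < j \<and> fst ((\<Sum>p<N. cap p) - card {b. big i b}, word i) \<le> fst ((\<Sum>p<N. cap p) - card {b. big j b}, word j) \<and>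
      list_emb R (snd ((\<Sum>p<N. cap p) - card {b. big i b}, word i)) (snd ((\<Sum>p<N. cap p) - card {b. big j b}, word j))"
    using almost_full_onD[OF af, of "\<lambda>n. ((\<Sum>p<N. cap p) - card {b. big n b}, word n)"] by simp
  then obtain i j :: nat where ij: "i < j" "(\<Sum>p<N. cap p) - card {b. big i b} \<le> (\<Sum>p<N. cap p) - card {b. big j b}"
    "list_emb R (word i) (word j)" unfolding fst_conv snd_conv by (elim exE conjE)
  have card_le: "card {b. big j b} \<le> card {b. big i b}" using ij(2) card_big[of i] card_big[of j] by linarith
  from list_emb_positions[OF ij(3)]
  obtain h where h0: "strict_mono_on {..<length (word i)} h" "h ` {..<length (word i)} \<subseteq> {..<length (word j)}"
    "\<forall>b<length (word i). R (word i ! b) (word j ! h b)" by (elim exE conjE)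
  have h: "strict_mono_on {..<L i} h" "\<And>b. b < L i \<Longrightarrow> h b < L j"
    using h0(1,2) by (auto simp: word_def image_subset_iff)
  have hR: "R (big i b, vec i b) (big j (h b), vec j (h b))" if "b < L i" for b
    using h0(3)[rule_format, of b] h(2)[OF that] that by (simp add: word_def)
  \<comment> \<open>\<open>h\<close> matches the columns of the word; beyond the words all columns are empty\<close>
  define \<pi> where "\<pi> b = (if b < L i then h b else L j + b)" for b
  have \<pi>: "strict_mono \<pi>"
  proof (rule strict_monoI)
    fix a b :: nat assume "a < b"
    then show "\<pi> a < \<pi> b"
      using strict_mono_onD[OF h(1), of a b] h(2)[of a] by (auto simp: \<pi>_def)
  qed
  have small: "big j (\<pi> b) = big i b" "\<And>x. x \<in> {..<N} \<times> {..K} \<Longrightarrow> vec i b x \<le> vec j (\<pi> b) x" if "b < L i" for b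
    using hR[OF that] that by (auto simp: R_def \<pi>_def)
  have "big j (\<pi> b)" if "big i b" for b
    using that small(1)[of b] wide_L by (auto simp: big_def)
  then have "\<pi> ` {b. big i b} \<subseteq> {b. big j b}" by blast
  moreover have "card (\<pi> ` {b. big i b}) = card {b. big i b}"
    using \<pi> by (intro card_image inj_on_subset[OF strict_mono_imp_inj_on]) auto
  ultimately have all_big: "\<pi> ` {b. big i b} = {b. big j b}"
    using card_le by (intro card_seteq big_fin) simp_all
  have "ordered_inc_monoid.inc_dvd (matching_monoid N K) (\<lambda>\<pi>. image_mset (shift \<pi>)) (g i) (g j)"
  proof (rule inc_dvd_matching_monoid[OF g g K \<pi>])
    fix p l b assume "p < N" "l < K"
    show "count (g i) (p, l, b) \<le> count (g j) (p, l, \<pi> b)"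
    proof (cases "b < L i")
      case True
      then show ?thesis using small(2)[of b "(p, l)"] \<open>p < N\<close> \<open>l < K\<close> by (simp add: vec_def)
    next
      case False
      then have "(p, l, b) \<notin># g i" using L[of "(p, l, b)" i] by auto
      then show ?thesis by (simp add: not_in_iff)
    qed
  next
    fix p b assume p: "p < N"
    have deg: "row p 0 (g i) \<le> row p 0 (g j)"
      using doubling[OF p _ ij(1)] const_eq[of p i j] by (cases "const p") auto
    show "col p (\<pi> b) (g j) + row p 0 (g i) \<le> row p 0 (g j) + col p b (g i)"
    proof (cases "b < L i")
      case True
      then have "row p 0 (g i) - col p b (g i) \<le> row p 0 (g j) - col p (\<pi> b) (g j)"
        using small(2)[of b "(p, K)"] p by (simp add: vec_def)
      then show ?thesis using gD(3)[OF p, of b i] gD(3)[OF p, of "\<pi> b" j] by linarith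
    next
      case False
      then have "col p (\<pi> b) (g j) = 0" by (intro col0) (simp add: \<pi>_def)
      then show ?thesis using deg by simp
    qed
  next
    fix p b assume p: "p < N" and b: "b \<notin> range \<pi>"
    have "\<not> big j b" using all_big b by blast
    then have "\<not> wide p j b" using p by (auto simp: big_def)
    then show "col p b (g j) + row p 0 (g i) \<le> row p 0 (g j)"
      using doubling[OF p _ ij(1)] const_eq[of p i j] by (cases "const p") (auto simp: wide_def)
  qed
  then show "\<exists>i j. i < j \<and> ordered_inc_monoid.inc_dvd (matching_monoid N K) (\<lambda>\<pi>. image_mset (shift \<pi>)) (f i) (f j)"
    using ij(1) r(1) by (intro exI[of _ "r i"] exI[of _ "r j"]) (simp add: g_def strict_mono_less)
qed

section \<open>Moves of bounded size between sums of matchings\<close>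

lemma size_cell_sum: "size (cell_sum K M) = K * size M"
  by (induction M) (auto simp: cells_def)

lemma count_cells_le: "count (cells K t) x \<le> 1"
proof -
  have "\<forall>l\<in>{l \<in> {..<K}. (fst t, l, snd t ! l) = x}. l = fst (snd x)" by auto
  then have "card {l \<in> {..<K}. (fst t, l, snd t ! l) = x} \<le> Suc 0" by (auto simp: card_le_Suc0_iff_eq)
  then show ?thesis by (simp add: cells_def count_image_mset_set)
qed

text \<open>
If all matchings of this colour in \<open>M\<close> used column \<open>j\<close>, the column would be full; the array is also the sum
of \<open>M'\<close>, where \<open>t\<close> leaves a gap.
\<close>

lemma matching_avoiding_column:
  assumes M: "set_mset M \<subseteq> matchings N K" "set_mset M' \<subseteq> matchings N K" "cell_sum K M = cell_sum K M'" and K: "0 < K"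
    and t: "t \<in># M'" "j \<notin> set (snd t)"
  shows "\<exists>u\<in>#M. fst u = fst t \<and> j \<notin> set (snd u)"
proof (rule ccontr)
  assume not: "\<not> ?thesis"
  define p where "p = fst t"
  let ?Q = "\<lambda>u. fst u = p \<and> j \<in> set (snd u)"
  have "filter_mset ?Q M = filter_mset (\<lambda>u. fst u = p) M"
    using not by (intro filter_mset_cong) (auto simp: p_def)
  then have "col p j (cell_sum K M) = row p 0 (cell_sum K M)"
    unfolding col_cell_sum[OF M(1)] row_cell_sum using K by simp
  then have eq: "size (filter_mset ?Q M') = size (filter_mset (\<lambda>u. fst u = p) M')"
    unfolding M(3) col_cell_sum[OF M(2)] row_cell_sum using K by simp
  have "filter_mset ?Q M' \<subseteq># filter_mset (\<lambda>u. fst u = p) M'" by (rule filter_mset_mono_strong) auto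
  moreover have t_in: "t \<in># filter_mset (\<lambda>u. fst u = p) M'" "t \<notin># filter_mset ?Q M'" using t by (auto simp: p_def)
  moreover have "filter_mset ?Q M' \<noteq> filter_mset (\<lambda>u. fst u = p) M'"
  proof
    assume "filter_mset ?Q M' = filter_mset (\<lambda>u. fst u = p) M'"
    from t_in(2)[unfolded this] t_in(1) show False by (rule notE)
  qed
  ultimately have "filter_mset ?Q M' \<subset># filter_mset (\<lambda>u. fst u = p) M'" by (simp only: subset_mset.less_le simp_thms)
  then show False using mset_subset_size[of "filter_mset ?Q M'" "filter_mset (\<lambda>u. fst u = p) M'"] eq by simp
qed

text \<open>
At most \<open>K\<close> matchings of \<open>M\<close> cover the cells of \<open>t\<close>. A column outside \<open>t\<close> may be full in their sum. All such
columns are used by the first of these matchings, so there are at most \<open>K\<close> of them, and for each one a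
matching that avoids it is added. Then the cells of \<open>t\<close> can be subtracted and the rest still satisfies the
conditions of \<open>matching_monoid_iff\<close>.
\<close>

lemma exchange:
  assumes M: "set_mset M \<subseteq> matchings N K" "set_mset M' \<subseteq> matchings N K" "cell_sum K M = cell_sum K M'" and K: "0 < K"
    and t: "t \<in># M'"
  shows "\<exists>A B. A \<subseteq># M \<and> size A \<le> 2 * K \<and> set_mset B \<subseteq> matchings N K \<and> cell_sum K A = cells K t + cell_sum K B"
proof -
  obtain p a where pa: "t = (p, a)" by (cases t)
  have t_in: "p < N" "length a = K" "distinct a" using M(2) t by (auto simp: pa matchings_def)
  have "\<exists>J. (p, J) \<in># M \<and> J ! l = a ! l" if "l < K" for l
  proof -
    have "(p, l, a ! l) \<in># cell_sum K M" unfolding M(3) in_cell_sum_iff using t that by (auto simp: pa intro!: bexI[of _ t])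
    then show ?thesis by (auto simp: in_cell_sum_iff)
  qed
  then obtain J where J: "\<And>l. l < K \<Longrightarrow> (p, J l) \<in># M" "\<And>l. l < K \<Longrightarrow> J l ! l = a ! l" by metis
  have "\<exists>I. (p, I) \<in># M \<and> j \<notin> set I" if "j \<notin> set a" for j
    using matching_avoiding_column[OF M K t, of j] that by (auto simp: pa)
  then obtain I where I: "\<And>j. j \<notin> set a \<Longrightarrow> (p, I j) \<in># M" "\<And>j. j \<notin> set a \<Longrightarrow> j \<notin> set (I j)" by metis
  define S where "S = (\<lambda>l. (p, J l)) ` {..<K} \<union> (\<lambda>j. (p, I j)) ` (set (J 0) - set a)"
  have S: "finite S" "S \<subseteq> set_mset M" "\<And>u. u \<in> S \<Longrightarrow> fst u = p" using J I by (auto simp: S_def)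
  have misses: "\<exists>u\<in>S. j \<notin> set (snd u)" if "j \<notin> set a" for j
  proof (cases "j \<in> set (J 0)")
    case True
    then have "(p, I j) \<in> S" using that by (auto simp: S_def)
    then show ?thesis using I(2)[OF that] by (intro bexI[of _ "(p, I j)"]) auto
  next
    case False
    then show ?thesis using K by (intro bexI[of _ "(p, J 0)"]) (auto simp: S_def)
  qed
  have "card S \<le> 2 * K"
  proof -
    have "length (J 0) = K" using J(1)[OF K] M(1) by (auto simp: matchings_def)
    have "card S \<le> card ((\<lambda>l. (p, J l)) ` {..<K}) + card ((\<lambda>j. (p, I j)) ` (set (J 0) - set a))"
      unfolding S_def by (rule card_Un_le)
    also have "\<dots> \<le> card {..<K} + card (set (J 0) - set a)" by (intro add_mono card_image_le) auto
    also have "card (set (J 0) - set a) \<le> card (set (J 0))" by (intro card_mono) auto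
    also have "card (set (J 0)) \<le> K" using card_length[of "J 0"] \<open>length (J 0) = K\<close> by simp
    finally show ?thesis by simp
  qed
  define A where "A = mset_set S"
  have "A \<subseteq># mset_set (set_mset M)" unfolding A_def using S by (intro subset_imp_msubset_mset_set) auto
  then have AM: "A \<subseteq># M" using mset_set_set_mset_msubset[of M] by (rule subset_mset.order_trans)
  have A_in: "set_mset A \<subseteq> matchings N K" using M(1) AM by (meson order_trans set_mset_mono)
  have "cells K t \<subseteq># cell_sum K A"
  proof (rule mset_subset_eqI)
    fix x
    show "count (cells K t) x \<le> count (cell_sum K A) x"
    proof (cases "x \<in># cells K t")
      case True
      then obtain l where l: "l < K" "x = (p, l, a ! l)" by (auto simp: cells_def pa)
      then have "x \<in># cell_sum K A"
        unfolding in_cell_sum_iff using J(2)[of l] S(1) by (intro bexI[of _ "(p, J l)"]) (auto simp: A_def S_def)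
      then have "1 \<le> count (cell_sum K A) x" by (simp add: Suc_le_eq)
      then show ?thesis using count_cells_le[of K t x] by linarith
    qed (simp add: not_in_iff)
  qed
  define g where "g = cell_sum K A - cells K t"
  have g: "cell_sum K A = cells K t + g" using \<open>cells K t \<subseteq># cell_sum K A\<close> by (simp add: g_def)
  have filter_A: "filter_mset (\<lambda>u. fst u = q) A = (if q = p then A else {#})" for q
  proof -
    have "filter_mset (\<lambda>u. fst u = q) A = filter_mset (\<lambda>u. q = p) A"
      using S by (intro filter_mset_cong) (auto simp: A_def)
    then show ?thesis by simp
  qed
  have "g \<in> matching_monoid N K"
    unfolding matching_monoid_iff
  proof (intro conjI ballI exI[of _ "\<lambda>q. if q = p then card S - 1 else 0"] allI impI)
    fix x assume "x \<in># g"
    then have "x \<in># cell_sum K A" by (simp add: g)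
    then show "fst x < N" "fst (snd x) < K" using A_in by (auto simp: in_cell_sum_iff matchings_def)
  next
    fix q l assume "q < N" "l < K"
    have "row q l (cell_sum K A) = (if q = p then card S else 0)"
      unfolding row_cell_sum filter_A using \<open>l < K\<close> by (simp add: A_def)
    then show "row q l g = (if q = p then card S - 1 else 0)"
      unfolding g row_add row_cells using \<open>l < K\<close> by (auto simp: pa split: if_splits)
  next
    fix q j :: nat assume "q < N"
    let ?Q = "\<lambda>u. fst u = q \<and> j \<in> set (snd u)"
    have cs: "col q j (cell_sum K A) = card {u \<in> S. ?Q u}"
      unfolding col_cell_sum[OF A_in] by (simp add: A_def S(1))
    have ct: "col q j (cells K t) = (if p = q \<and> j \<in> set a then 1 else 0)"
      using t_in by (simp add: col_cells pa)
    show "col q j g \<le> (if q = p then card S - 1 else 0)"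
    proof (cases "q = p")
      case True
      have "card {u \<in> S. ?Q u} \<le> card S" using S(1) by (intro card_mono) auto
      moreover have "card {u \<in> S. ?Q u} < card S" if "j \<notin> set a"
        using misses[OF that] S(1) by (intro psubset_card_mono) auto
      ultimately show ?thesis using cs ct True unfolding g col_add by (cases "j \<in> set a") auto
    next
      case False
      then have "{u \<in> S. ?Q u} = {}" using S(3) by auto
      then have "col q j (cell_sum K A) = 0" unfolding cs by (simp only: card.empty)
      then show ?thesis using False unfolding g col_add by simp
    qed
  qed
  then obtain B where "set_mset B \<subseteq> matchings N K" "g = cell_sum K B" by (auto simp: matching_monoid_def)
  then show ?thesis using AM \<open>card S \<le> 2 * K\<close> g by (intro exI[of _ A] exI[of _ B]) (simp add: A_def)
qed

text \<open>
Matchings of \<open>M'\<close> are created in \<open>M\<close> one at a time by bounded exchanges and then split off. The relation \<open>E\<close>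
stands for congruence modulo a given ideal.
\<close>

theorem connected_by_bounded_moves:
  fixes E :: "(nat \<times> nat list) multiset \<Rightarrow> (nat \<times> nat list) multiset \<Rightarrow> bool"
  assumes K: "0 < K" and trans: "\<And>A B C. E A B \<Longrightarrow> E B C \<Longrightarrow> E A C"
    and cong: "\<And>A B C. E A B \<Longrightarrow> set_mset C \<subseteq> matchings N K \<Longrightarrow> E (A + C) (B + C)"
    and bounded: "\<And>A B. set_mset A \<subseteq> matchings N K \<Longrightarrow> set_mset B \<subseteq> matchings N K \<Longrightarrow>
      size A \<le> 2 * K \<Longrightarrow> size B \<le> 2 * K \<Longrightarrow> cell_sum K A = cell_sum K B \<Longrightarrow> E A B"
    and M: "set_mset M \<subseteq> matchings N K" "set_mset M' \<subseteq> matchings N K" "cell_sum K M = cell_sum K M'"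
  shows "E M M'"
  using M
proof (induction M' arbitrary: M)
  case empty
  then have "K * size M = 0" using size_cell_sum[of K M] by simp
  then have "M = {#}" using K by simp
  then show ?case by (simp add: bounded)
next
  case (add t M')
  from exchange[OF add.prems K, of t]
  obtain A B where AB: "A \<subseteq># M" "size A \<le> 2 * K" "set_mset B \<subseteq> matchings N K" "cell_sum K A = cells K t + cell_sum K B"
    by auto
  have A: "set_mset A \<subseteq> matchings N K" using AB(1) add.prems(1) by (meson order_trans set_mset_mono)
  define C where "C = M - A"
  have M: "M = A + C" using AB(1) by (simp add: C_def)
  have C: "set_mset C \<subseteq> matchings N K" using add.prems(1) by (simp add: M)
  have "cell_sum K A = cell_sum K (add_mset t B)" using AB(4) by simp
  then have "K * size A = K * size (add_mset t B)" by (metis size_cell_sum)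
  then have "size A = size (add_mset t B)" using K by (simp only: mult_cancel1) simp
  then have "E A (add_mset t B)" using A AB add.prems(2) by (intro bounded) auto
  then have 1: "E M (add_mset t B + C)" unfolding M by (rule cong[OF _ C])
  have "cell_sum K (B + C) = cell_sum K M'" using add.prems(3) AB(4) by (simp add: M)
  then have "E (B + C) M'" using AB(3) C add.prems(2) by (intro add.IH) auto
  then have "E (B + C + {#t#}) (M' + {#t#})" using add.prems(2) by (intro cong) auto
  then have "E (add_mset t B + C) (add_mset t M')" by simp
  with 1 show ?case by (rule trans)
qed

lemma strict_mono_onto_initial:
  assumes "finite (S :: nat set)"
  shows "\<exists>\<pi>. strict_mono \<pi> \<and> \<pi> ` {..<card S} = S"
  using assms
proof (induction S rule: finite_linorder_max_induct)
  case empty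
  show ?case by (intro exI[of _ id]) (simp add: strict_mono_def)
next
  case (insert b A)
  then obtain \<pi> where \<pi>: "strict_mono \<pi>" "\<pi> ` {..<card A} = A" by blast
  define \<pi>' where "\<pi>' i = (if i < card A then \<pi> i else b + (i - card A))" for i
  have lt: "\<pi> i < b" if "i < card A" for i using \<pi>(2) insert.hyps(2) that by blast
  have "strict_mono \<pi>'"
  proof (rule strict_monoI)
    fix i j :: nat assume "i < j"
    then show "\<pi>' i < \<pi>' j" using lt[of i] \<pi>(1) by (auto simp: \<pi>'_def strict_mono_less)
  qed
  moreover have "\<pi>' ` {..<card (insert b A)} = insert b A"
  proof -
    have "{..<card (insert b A)} = insert (card A) {..<card A}" using insert.hyps by (auto simp: card_insert_if)
    moreover have "\<pi>' ` {..<card A} = \<pi> ` {..<card A}" by (rule image_cong) (auto simp: \<pi>'_def)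
    moreover have "\<pi>' (card A) = b" by (simp add: \<pi>'_def)
    ultimately show ?thesis using \<pi>(2) by simp
  qed
  ultimately show ?case by blast
qed

definition small_matchings :: "nat \<Rightarrow> nat \<Rightarrow> nat \<Rightarrow> (nat \<times> nat list) set" where
  "small_matchings N K W = {t \<in> matchings N K. set (snd t) \<subseteq> {..<W}}"

lemma finite_small_multisets: "finite {A. set_mset A \<subseteq> small_matchings N K W \<and> size A \<le> n}"
proof -
  have "small_matchings N K W \<subseteq> {..<N} \<times> {J. set J \<subseteq> {..<W} \<and> length J = K}"
    by (auto simp: small_matchings_def matchings_def)
  then have "finite (small_matchings N K W)"
    by (rule finite_subset) (intro finite_cartesian_product finite_lists_length_eq finite_lessThan)
  then have "finite (mset ` {xs. set xs \<subseteq> small_matchings N K W \<and> length xs \<le> n})"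
    by (intro finite_imageI finite_lists_length_le)
  moreover have "{A. set_mset A \<subseteq> small_matchings N K W \<and> size A \<le> n} \<subseteq> mset ` {xs. set xs \<subseteq> small_matchings N K W \<and> length xs \<le> n}"
  proof
    fix A assume A: "A \<in> {A. set_mset A \<subseteq> small_matchings N K W \<and> size A \<le> n}"
    obtain xs where "A = mset xs" using ex_mset by metis
    then show "A \<in> mset ` {xs. set xs \<subseteq> small_matchings N K W \<and> length xs \<le> n}" using A by auto
  qed
  ultimately show ?thesis by (rule finite_subset[rotated])
qed

lemma card_set_mset_le_size: "card (set_mset M) \<le> size M"
  by (induction M) (auto simp: card_insert_if)

text \<open>
The two sides of a bounded move involve boundedly many columns, and an increasing map carries an initial
segment of the natural numbers onto these columns.
\<close>

lemma move_from_small: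
  assumes AB: "set_mset A \<subseteq> matchings N K" "set_mset B \<subseteq> matchings N K" "size A \<le> n" "size B \<le> n"
    and eq: "cell_sum K A = cell_sum K B"
  shows "\<exists>\<pi> A' B'. strict_mono \<pi> \<and> A = image_mset (move \<pi>) A' \<and> B = image_mset (move \<pi>) B' \<and>
    set_mset A' \<subseteq> small_matchings N K (2 * n * K) \<and> set_mset B' \<subseteq> small_matchings N K (2 * n * K) \<and>
    size A' \<le> n \<and> size B' \<le> n \<and> cell_sum K A' = cell_sum K B'"
proof -
  define S where "S = (\<Union>t\<in>set_mset (A + B). set (snd t))"
  have "finite S" by (simp add: S_def)
  have "card S \<le> (\<Sum>t\<in>set_mset (A + B). card (set (snd t)))" unfolding S_def by (rule card_UN_le) simp
  also have "\<dots> \<le> (\<Sum>t\<in>set_mset (A + B). K)"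
  proof (rule sum_mono)
    fix t assume "t \<in> set_mset (A + B)"
    then have "length (snd t) = K" using AB(1,2) by (auto simp: matchings_def)
    then show "card (set (snd t)) \<le> K" using card_length[of "snd t"] by simp
  qed
  also have "\<dots> = card (set_mset (A + B)) * K" by simp
  also have "card (set_mset (A + B)) \<le> size (A + B)" by (rule card_set_mset_le_size)
  also have "size (A + B) \<le> 2 * n" using AB(3,4) by simp
  finally have "card S \<le> 2 * n * K" by simp
  from strict_mono_onto_initial[OF \<open>finite S\<close>]
  obtain \<pi> where \<pi>: "strict_mono \<pi>" "\<pi> ` {..<card S} = S" by blast
  have inj: "inj \<pi>" using \<pi>(1) by (rule strict_mono_imp_inj_on)
  define \<rho> where "\<rho> = inv_into UNIV \<pi>"
  have \<rho>: "\<pi> (\<rho> j) = j" "\<rho> j < 2 * n * K" if j: "j \<in> S" for j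
  proof -
    obtain b where "b < card S" "j = \<pi> b" using \<pi>(2) j by blast
    then show "\<pi> (\<rho> j) = j" "\<rho> j < 2 * n * K" using \<open>card S \<le> 2 * n * K\<close> inj by (auto simp: \<rho>_def)
  qed
  have inj\<rho>: "inj_on \<rho> S" using \<rho>(1) by (rule inj_on_inverseI)
  have main: "image_mset (move \<pi>) (image_mset (move \<rho>) Q) = Q \<and> set_mset (image_mset (move \<rho>) Q) \<subseteq> small_matchings N K (2 * n * K)"
    if Q: "set_mset Q \<subseteq> matchings N K" "set_mset Q \<subseteq> set_mset (A + B)" for Q
  proof
    have S: "set (snd t) \<subseteq> S" if "t \<in># Q" for t using Q(2) that by (auto simp: S_def)
    have "image_mset (\<lambda>t. move \<pi> (move \<rho> t)) Q = image_mset (\<lambda>t. t) Q"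
    proof (rule image_mset_cong)
      fix t assume "t \<in># Q"
      then show "move \<pi> (move \<rho> t) = t" using S \<rho>(1) by (auto simp: move_def map_idI subset_iff prod_eq_iff)
    qed
    then show "image_mset (move \<pi>) (image_mset (move \<rho>) Q) = Q" by (simp add: multiset.map_comp comp_def)
    show "set_mset (image_mset (move \<rho>) Q) \<subseteq> small_matchings N K (2 * n * K)"
    proof
      fix u assume "u \<in> set_mset (image_mset (move \<rho>) Q)"
      then obtain t where t: "t \<in># Q" "u = move \<rho> t" by auto
      then show "u \<in> small_matchings N K (2 * n * K)"
        using Q(1) S[OF t(1)] \<rho>(2) inj_on_subset[OF inj\<rho> S[OF t(1)]]
        by (auto simp: small_matchings_def matchings_def move_def distinct_map)
    qed
  qed
  define A' B' where "A' = image_mset (move \<rho>) A" and "B' = image_mset (move \<rho>) B"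
  have A': "image_mset (move \<pi>) A' = A" "set_mset A' \<subseteq> small_matchings N K (2 * n * K)"
    using main[OF AB(1)] by (auto simp: A'_def)
  have B': "image_mset (move \<pi>) B' = B" "set_mset B' \<subseteq> small_matchings N K (2 * n * K)"
    using main[OF AB(2)] by (auto simp: B'_def)
  have "set_mset A' \<subseteq> matchings N K" "set_mset B' \<subseteq> matchings N K" using A'(2) B'(2) by (auto simp: small_matchings_def)
  then have "image_mset (shift \<pi>) (cell_sum K A') = image_mset (shift \<pi>) (cell_sum K B')"
    using eq by (simp add: cell_sum_move[symmetric] A'(1) B'(1))
  moreover have "inj (image_mset (shift \<pi>))" using inj by (intro multiset.inj_map) (auto simp: inj_def shift_def)
  ultimately have "cell_sum K A' = cell_sum K B'" by (simp add: inj_eq)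
  moreover have "size A' \<le> n" "size B' \<le> n" using AB(3,4) by (simp_all add: A'_def B'_def)
  ultimately show ?thesis using \<pi>(1) A' B' by (intro exI[of _ \<pi>] exI[of _ A'] exI[of _ B']) simp
qed

section \<open>Equivariant monomial maps\<close>

lemma carrier_SymN: "\<sigma> \<in> carrier SymN \<longleftrightarrow> bij \<sigma>"
  by (auto simp: BijGroup_def Bij_def)

lemma mult_SymN: "\<sigma> \<in> carrier SymN \<Longrightarrow> \<tau> \<in> carrier SymN \<Longrightarrow> \<sigma> \<otimes>\<^bsub>SymN\<^esub> \<tau> = \<sigma> \<circ> \<tau>"
  by (auto simp: BijGroup_def compose_def comp_def)

text \<open>
On the finite set \<open>A \<union> f ` A\<close> the complements of \<open>A\<close> and of \<open>f ` A\<close> have the same size.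
\<close>

lemma injection_extends_to_permutation:
  fixes f :: "nat \<Rightarrow> nat"
  assumes "finite A" "inj_on f A"
  shows "\<exists>\<sigma> \<in> carrier SymN. \<forall>i\<in>A. \<sigma> i = f i"
proof -
  define B where "B = A \<union> f ` A"
  have fin: "finite B" using assms by (simp add: B_def)
  have "card (B - A) = card (B - f ` A)"
    using assms by (subst (1 2) card_Diff_subset) (auto simp: B_def card_image)
  then obtain h where h: "bij_betw h (B - A) (B - f ` A)"
    using fin finite_same_card_bij[of "B - A" "B - f ` A"] by auto
  define \<sigma> where "\<sigma> i = (if i \<in> A then f i else if i \<in> B then h i else i)" for i
  have "bij_betw \<sigma> A (f ` A)" using assms(2) by (auto simp: bij_betw_def \<sigma>_def inj_on_def)
  moreover have "bij_betw \<sigma> (B - A) (B - f ` A)"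
    using h by (rule bij_betw_cong[THEN iffD1, rotated]) (auto simp: \<sigma>_def)
  ultimately have "bij_betw \<sigma> (A \<union> (B - A)) (f ` A \<union> (B - f ` A))" by (rule bij_betw_combine) auto
  moreover have "bij_betw \<sigma> (- B) (- B)" by (rule bij_betw_cong[THEN iffD1, of _ "\<lambda>i. i"]) (auto simp: \<sigma>_def B_def bij_betw_def)
  ultimately have "bij_betw \<sigma> (A \<union> (B - A) \<union> - B) (f ` A \<union> (B - f ` A) \<union> - B)"
    by (rule bij_betw_combine) (auto simp: B_def)
  moreover have "A \<union> (B - A) \<union> - B = UNIV" "f ` A \<union> (B - f ` A) \<union> - B = UNIV" by (auto simp: B_def)
  ultimately have "bij \<sigma>" by simp
  then show ?thesis unfolding carrier_SymN[symmetric] by (rule bexI[rotated]) (simp add: \<sigma>_def)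
qed

lemma z_act_action: "group_action SymN UNIV z_act"
proof -
  have bij: "bij (z_act \<sigma>)" if \<sigma>: "bij \<sigma>" for \<sigma>
  proof (rule bijI)
    show "inj (z_act \<sigma>)" using bij_is_inj[OF \<sigma>] by (auto simp: inj_def z_act_def)
    have "\<exists>x. z_act \<sigma> x = y" for y
    proof -
      obtain c where "\<sigma> c = snd y" using bij_is_surj[OF \<sigma>] by (metis surjD)
      then show ?thesis by (intro exI[of _ "(fst y, c)"]) (simp add: z_act_def)
    qed
    then show "surj (z_act \<sigma>)" unfolding surj_def by metis
  qed
  then have "z_act \<in> hom SymN (BijGroup UNIV)"
    by (auto simp: hom_def BijGroup_def Bij_def compose_def z_act_def fun_eq_iff)
  then show ?thesis unfolding group_action_def by (intro group_hom.intro group_BijGroup group_hom_axioms.intro)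
qed

lemma inc_act_z:
  assumes "strict_mono \<pi>"
  shows "inc_act z_act \<pi> = z_act \<pi>"
proof
  fix x :: "nat \<times> nat"
  obtain \<sigma> where \<sigma>: "\<sigma> \<in> carrier SymN" "\<forall>i\<in>{..<Suc (snd x)}. \<sigma> i = \<pi> i"
    using injection_extends_to_permutation[of "{..<Suc (snd x)}" \<pi>] strict_mono_imp_inj_on[OF assms] inj_on_subset by blast
  have "supported_by z_act x (Suc (snd x))" by (auto simp: supported_by_def z_act_def split: prod.splits)
  then have "inc_act z_act \<pi> x = z_act \<sigma> x" using \<sigma> by (intro inc_act_eq[OF z_act_action]) auto
  also have "\<dots> = z_act \<pi> x" using \<sigma>(2) by (auto simp: z_act_def split: prod.splits)
  finally show "inc_act z_act \<pi> x = z_act \<pi> x" .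
qed

text \<open>
The function \<open>m\<close> gives the exponent of the image of each variable, and \<open>rep p\<close> for \<open>p < N\<close> represent the orbits.
All representatives have the same support \<open>K\<close>, so that all variables are described by matchings with
\<open>K\<close> rows. The number \<open>K\<close> is positive because an array with no rows does not determine how many matchings were added.
\<close>

locale toric_data =
  fixes Y :: "'y set" and act :: "(nat \<Rightarrow> nat) \<Rightarrow> 'y \<Rightarrow> 'y" and m :: "'y \<Rightarrow> (nat \<times> nat \<Rightarrow>\<^sub>0 nat)"
    and N K :: nat and rep :: "nat \<Rightarrow> 'y"
  assumes action: "group_action SymN Y act"
    and support: "y \<in> Y \<Longrightarrow> \<exists>n. supported_by act y n"
    and K_pos: "0 < K"
    and rep_in: "p < N \<Longrightarrow> rep p \<in> Y" and rep_support: "p < N \<Longrightarrow> supported_by act (rep p) K"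
    and rep_orbit: "y \<in> Y \<Longrightarrow> \<exists>p<N. \<exists>\<sigma>\<in>carrier SymN. y = act \<sigma> (rep p)"
    and m_equivariant: "\<sigma> \<in> carrier SymN \<Longrightarrow> y \<in> Y \<Longrightarrow> m (act \<sigma> y) = push (z_act \<sigma>) (m y)"
begin

text \<open>
The variable \<open>\<sigma> y\<^sub>p\<close> for any permutation \<open>\<sigma>\<close> with \<open>\<sigma> l = J\<^sub>l\<close> for \<open>l < K\<close>.
\<close>

definition elt :: "nat \<times> nat list \<Rightarrow> 'y" where
  "elt t = inc_act act (\<lambda>l. snd t ! l) (rep (fst t))"

lemma elt_eq:
  assumes "t \<in> matchings N K" "\<sigma> \<in> carrier SymN" "\<And>l. l < K \<Longrightarrow> \<sigma> l = snd t ! l"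
  shows "elt t = act \<sigma> (rep (fst t))"
  unfolding elt_def using assms by (intro inc_act_eq[OF action rep_in _ rep_support]) (auto simp: matchings_def)

lemma permutation_of_matching:
  assumes "t \<in> matchings N K"
  shows "\<exists>\<sigma> \<in> carrier SymN. \<forall>l<K. \<sigma> l = snd t ! l"
proof -
  have "inj_on (\<lambda>l. snd t ! l) {..<K}" using assms by (auto simp: matchings_def inj_on_def nth_eq_iff_index_eq)
  from injection_extends_to_permutation[OF finite_lessThan this] show ?thesis by auto
qed

lemma elt_in: "t \<in> matchings N K \<Longrightarrow> elt t \<in> Y"
  using permutation_of_matching[of t] elt_eq[of t] group_action.element_image[OF action _ rep_in]
  by (fastforce simp: matchings_def)

lemma elt_surj:
  assumes "y \<in> Y"
  shows "\<exists>t\<in>matchings N K. elt t = y"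
proof -
  obtain p \<sigma> where p: "p < N" "\<sigma> \<in> carrier SymN" "y = act \<sigma> (rep p)" using rep_orbit[OF assms] by blast
  define t where "t = (p, map \<sigma> [0..<K])"
  have "inj \<sigma>" using p(2) by (simp add: carrier_SymN bij_is_inj)
  then have "t \<in> matchings N K" using p(1) by (auto simp: t_def matchings_def distinct_map intro: inj_on_subset)
  moreover have "elt t = y" using elt_eq[OF \<open>t \<in> matchings N K\<close> p(2)] p(3) by (simp add: t_def)
  ultimately show ?thesis by blast
qed

lemma elt_move:
  assumes t: "t \<in> matchings N K" and \<pi>: "strict_mono \<pi>"
  shows "elt (move \<pi> t) = inc_act act \<pi> (elt t)"
proof -
  have inj: "inj \<pi>" using \<pi> by (rule strict_mono_imp_inj_on)
  obtain \<sigma> where \<sigma>: "\<sigma> \<in> carrier SymN" "\<forall>l<K. \<sigma> l = snd t ! l" using permutation_of_matching[OF t] by blast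
  obtain n where n: "supported_by act (elt t) n" using support[OF elt_in[OF t]] by blast
  obtain \<tau> where \<tau>: "\<tau> \<in> carrier SymN" "\<forall>i\<in>{..<n} \<union> set (snd t). \<tau> i = \<pi> i"
    using injection_extends_to_permutation[of "{..<n} \<union> set (snd t)" \<pi>] inj_on_subset[OF inj] by blast
  have "inc_act act \<pi> (elt t) = act \<tau> (elt t)"
    using \<tau> by (intro inc_act_eq[OF action elt_in[OF t] _ n]) auto
  also have "\<dots> = act \<tau> (act \<sigma> (rep (fst t)))" using elt_eq[OF t \<sigma>(1)] \<sigma>(2) by simp
  also have "\<dots> = act (\<tau> \<circ> \<sigma>) (rep (fst t))"
    using group_action.composition_rule[OF action rep_in \<tau>(1) \<sigma>(1)] t mult_SymN[OF \<tau>(1) \<sigma>(1)]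
    by (auto simp: matchings_def)
  also have "\<dots> = elt (move \<pi> t)"
  proof -
    have "\<tau> \<circ> \<sigma> \<in> carrier SymN" using \<tau>(1) \<sigma>(1) by (simp add: carrier_SymN bij_comp)
    moreover have "(\<tau> \<circ> \<sigma>) l = snd (move \<pi> t) ! l" if "l < K" for l
      using that \<sigma>(2) \<tau>(2) t by (auto simp: move_def matchings_def)
    ultimately show ?thesis using elt_eq[OF move_in[OF inj t]] by (simp add: move_def)
  qed
  finally show ?thesis by simp
qed

lemma inc_act_in: "strict_mono \<pi> \<Longrightarrow> y \<in> Y \<Longrightarrow> inc_act act \<pi> y \<in> Y"
  by (metis elt_surj elt_move elt_in move_in strict_mono_imp_inj_on)

lemma inc_act_id: "y \<in> Y \<Longrightarrow> inc_act act id y = y"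
proof -
  assume "y \<in> Y"
  then obtain t where t: "t \<in> matchings N K" "y = elt t" using elt_surj by blast
  have "move id t = t" by (simp add: move_def)
  then show ?thesis using elt_move[OF t(1) strict_mono_id] t(2) by simp
qed

lemma inc_act_comp:
  assumes "strict_mono \<pi>" "strict_mono \<rho>" "y \<in> Y"
  shows "inc_act act (\<pi> \<circ> \<rho>) y = inc_act act \<pi> (inc_act act \<rho> y)"
proof -
  obtain t where t: "t \<in> matchings N K" "y = elt t" using elt_surj[OF assms(3)] by blast
  have "move (\<pi> \<circ> \<rho>) t = move \<pi> (move \<rho> t)" by (simp add: move_def)
  moreover have "move \<rho> t \<in> matchings N K" using assms(2) t(1) by (intro move_in strict_mono_imp_inj_on)
  ultimately show ?thesis
    using elt_move[OF t(1) strict_mono_o[OF assms(1,2)]] elt_move[OF t(1) assms(2)] elt_move[OF _ assms(1)] t(2) by metis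
qed

text \<open>
The prefixes \<open>Y\<close>, \<open>X\<close> and \<open>Z\<close> stand for \<open>R[Y]\<close>, for the algebra of the matching monoid and for the image in
\<open>R[Z]\<close>.
\<close>

sublocale Y: inc_monoid "monomials Y" "\<lambda>\<pi>. push (inc_act act \<pi>)"
proof
  show "0 \<in> monomials Y" by (simp add: monomials_def)
  show "a + b \<in> monomials Y" if "a \<in> monomials Y" "b \<in> monomials Y" for a b
    using that keys_add_subset by (simp add: monomials_def)
  show "push (inc_act act \<pi>) a \<in> monomials Y" if "strict_mono \<pi>" "a \<in> monomials Y" for \<pi> a
    using that keys_push[of "inc_act act \<pi>" a] inc_act_in[OF that(1)] by (auto simp: monomials_def)
  show "push (inc_act act id) a = a" if "a \<in> monomials Y" for a
  proof -
    have "push (inc_act act id) a = push (\<lambda>y. y) a"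
      using that by (intro push_cong inc_act_id) (auto simp: monomials_def)
    then show ?thesis by simp
  qed
  show "push (inc_act act (\<pi> \<circ> \<rho>)) a = push (inc_act act \<pi>) (push (inc_act act \<rho>) a)"
    if "strict_mono \<pi>" "strict_mono \<rho>" "a \<in> monomials Y" for \<pi> \<rho> a
    unfolding push_push using that by (intro push_cong inc_act_comp) (auto simp: monomials_def)
qed simp_all

text \<open>
The part of the monomial of \<open>rep p\<close> that lies in column \<open>l\<close>, moved to column \<open>j\<close>.
\<close>

definition cell_monomial :: "nat \<times> nat \<times> nat \<Rightarrow> (nat \<times> nat \<Rightarrow>\<^sub>0 nat)" where
  "cell_monomial x = (\<Sum>v\<in>keys (m (rep (fst x))).
     if snd v = fst (snd x) then single (fst v, snd (snd x)) (lookup (m (rep (fst x))) v) else 0)"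

definition factor_map :: "(nat \<times> nat \<times> nat) multiset \<Rightarrow> (nat \<times> nat \<Rightarrow>\<^sub>0 nat)" where
  "factor_map g = (\<Sum>x\<in>#g. cell_monomial x)"

text \<open>
The exponent of the product of the variables that are described by the matchings in \<open>M\<close>.
\<close>

definition lift :: "(nat \<times> nat list) multiset \<Rightarrow> ('y \<Rightarrow>\<^sub>0 nat)" where
  "lift M = (\<Sum>t\<in>#M. single (elt t) 1)"

text \<open>
The additive extension of \<open>m\<close>; the inner sum is a multiple of \<open>m y\<close>.
\<close>

definition monomial_map :: "('y \<Rightarrow>\<^sub>0 nat) \<Rightarrow> (nat \<times> nat \<Rightarrow>\<^sub>0 nat)" where
  "monomial_map a = (\<Sum>y\<in>keys a. \<Sum>_<lookup a y. m y)"

lemma factor_map_add [simp]: "factor_map (g + h) = factor_map g + factor_map h"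
  and factor_map_empty [simp]: "factor_map {#} = 0"
  by (simp_all add: factor_map_def)

lemma lift_add [simp]: "lift (A + B) = lift A + lift B"
  and lift_empty [simp]: "lift {#} = 0"
  and lift_add_mset [simp]: "lift (add_mset t A) = single (elt t) 1 + lift A"
  by (simp_all add: lift_def)

lemma monomial_map_superset:
  assumes "finite A" "keys a \<subseteq> A"
  shows "monomial_map a = (\<Sum>y\<in>A. \<Sum>_<lookup a y. m y)"
  unfolding monomial_map_def using assms by (intro sum.mono_neutral_left) (auto simp: in_keys_iff)

lemma sum_lessThan_add_const: "(\<Sum>_<i + j. c) = (\<Sum>_<i. c) + (\<Sum>_<j. c :: 'a::comm_monoid_add)" for i j :: nat
  by (induction j) (simp_all add: add.assoc)

lemma monomial_map_add [simp]: "monomial_map (a + b) = monomial_map a + monomial_map b"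
proof -
  let ?A = "keys a \<union> keys b"
  have "keys (a + b) \<subseteq> ?A" by (rule keys_add)
  then show ?thesis by (simp add: monomial_map_superset[of ?A] lookup_add sum_lessThan_add_const sum.distrib)
qed

lemma monomial_map_zero [simp]: "monomial_map 0 = 0"
  by (simp add: monomial_map_def)

lemma monomial_map_single [simp]: "monomial_map (single y (Suc 0)) = m y"
  by (simp add: monomial_map_def)

text \<open>
A transposition of a column beyond the support with an unused column fixes \<open>rep p\<close>, but would change a
monomial that involves the former column.
\<close>

lemma keys_m_rep:
  assumes p: "p < N" and v: "v \<in> keys (m (rep p))"
  shows "snd v < K"
proof (rule ccontr)
  assume "\<not> snd v < K"
  obtain b where b: "\<forall>u\<in>keys (m (rep p)). snd u < b"
    using finite_nat_set_iff_bounded[of "snd ` keys (m (rep p))"] by auto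
  \<comment> \<open>the column \<open>K + b\<close> lies outside the support of \<open>rep p\<close> and of its monomial\<close>
  define \<sigma> where "\<sigma> = Transposition.transpose (snd v) (K + b)"
  have \<sigma>: "\<sigma> \<in> carrier SymN" by (simp add: carrier_SymN \<sigma>_def)
  have "\<forall>i<K. \<sigma> i = i" using \<open>\<not> snd v < K\<close> by (auto simp: \<sigma>_def transpose_def)
  then have "act \<sigma> (rep p) = rep p" using rep_support[OF p] \<sigma> by (auto simp: supported_by_def)
  then have eq: "m (rep p) = push (z_act \<sigma>) (m (rep p))" using m_equivariant[OF \<sigma> rep_in[OF p]] by simp
  have "v \<in> z_act \<sigma> ` keys (m (rep p))" using v keys_push[of "z_act \<sigma>" "m (rep p)"] eq by auto
  then obtain u where u: "u \<in> keys (m (rep p))" "v = z_act \<sigma> u" by blast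
  then have "\<sigma> (snd u) = snd v" by (auto simp: z_act_def split: prod.splits)
  then have "snd u = K + b" unfolding \<sigma>_def by (metis transpose_apply_first transpose_involutory)
  then show False using b u(1) by auto
qed

lemma factor_map_cells:
  assumes t: "t \<in> matchings N K"
  shows "factor_map (cells K t) = m (elt t)"
proof -
  let ?q = "m (rep (fst t))"
  have p: "fst t < N" using t by (auto simp: matchings_def)
  obtain \<sigma> where \<sigma>: "\<sigma> \<in> carrier SymN" "\<forall>l<K. \<sigma> l = snd t ! l" using permutation_of_matching[OF t] by blast
  have "factor_map (cells K t) = (\<Sum>l<K. cell_monomial (fst t, l, snd t ! l))"
    by (simp add: factor_map_def cells_def multiset.map_comp comp_def sum_unfold_sum_mset)
  also have "\<dots> = (\<Sum>v\<in>keys ?q. \<Sum>l<K. if snd v = l then single (fst v, snd t ! l) (lookup ?q v) else 0)"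
    unfolding cell_monomial_def fst_conv snd_conv by (rule sum.swap)
  also have "\<dots> = (\<Sum>v\<in>keys ?q. single (z_act \<sigma> v) (lookup ?q v))"
    using keys_m_rep[OF p] \<sigma>(2) by (intro sum.cong refl) (auto simp: z_act_def)
  also have "\<dots> = push (z_act \<sigma>) ?q" by (simp add: push_def)
  also have "\<dots> = m (elt t)" using m_equivariant[OF \<sigma>(1) rep_in[OF p]] elt_eq[OF t \<sigma>(1)] \<sigma>(2) by simp
  finally show ?thesis .
qed

lemma factor_map_cell_sum:
  assumes "set_mset M \<subseteq> matchings N K"
  shows "factor_map (cell_sum K M) = monomial_map (lift M)"
  using assms by (induction M) (auto simp: factor_map_cells)

lemma factor_map_shift: "factor_map (image_mset (shift \<pi>) g) = push (z_act \<pi>) (factor_map g)"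
proof -
  have "cell_monomial (shift \<pi> x) = push (z_act \<pi>) (cell_monomial x)" for x
    unfolding cell_monomial_def push_sum shift_def
    by (intro sum.cong) (auto simp: z_act_def)
  then show ?thesis by (induction g) (simp_all add: factor_map_def)
qed

lemma lift_in: "set_mset M \<subseteq> matchings N K \<Longrightarrow> lift M \<in> monomials Y"
  using elt_in by (induction M) (auto simp: Y.zero_in intro!: Y.add_in, auto simp: monomials_def)

lemma lift_surj:
  assumes "a \<in> monomials Y"
  shows "\<exists>M. set_mset M \<subseteq> matchings N K \<and> lift M = a"
proof -
  have "keys a \<subseteq> Y" using assms by (simp add: monomials_def)
  then show ?thesis
  proof (induction a rule: poly_mapping_induct_on)
    case zero
    show ?case by (intro exI[of _ "{#}"]) simp
  next
    case (single y c)
    then obtain t where t: "t \<in> matchings N K" "elt t = y" using elt_surj by blast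
    have "lift (replicate_mset c t) = single y c"
      by (induction c) (simp_all add: t(2) single_add[symmetric])
    then show ?case using t(1) by (intro exI[of _ "replicate_mset c t"]) auto
  next
    case (add p q)
    then obtain A B where "set_mset A \<subseteq> matchings N K" "lift A = p" "set_mset B \<subseteq> matchings N K" "lift B = q" by blast
    then show ?case by (intro exI[of _ "A + B"]) simp
  qed
qed

lemma lift_move:
  assumes "set_mset M \<subseteq> matchings N K" "strict_mono \<pi>"
  shows "lift (image_mset (move \<pi>) M) = push (inc_act act \<pi>) (lift M)"
  using assms by (induction M) (auto simp: elt_move)

lemma monomial_map_image: "monomial_map ` monomials Y = factor_map ` matching_monoid N K"
proof
  show "monomial_map ` monomials Y \<subseteq> factor_map ` matching_monoid N K"
  proof
    fix z assume "z \<in> monomial_map ` monomials Y"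
    then obtain M where "set_mset M \<subseteq> matchings N K" "z = monomial_map (lift M)" using lift_surj by blast
    then show "z \<in> factor_map ` matching_monoid N K"
      by (intro image_eqI[of _ factor_map "cell_sum K M"]) (auto simp: matching_monoid_def factor_map_cell_sum)
  qed
  show "factor_map ` matching_monoid N K \<subseteq> monomial_map ` monomials Y"
    using lift_in factor_map_cell_sum by (auto simp: matching_monoid_def)
qed

sublocale X: ordered_inc_monoid "matching_monoid N K" "\<lambda>\<pi>. image_mset (shift \<pi>)"
  by (rule matching_monoid_ordered)

sublocale Z: inc_monoid "monomial_map ` monomials Y" "\<lambda>\<pi>. push (inc_act z_act \<pi>)"
proof
  show "0 \<in> monomial_map ` monomials Y" using Y.zero_in monomial_map_zero by (metis image_eqI)
  show "a + b \<in> monomial_map ` monomials Y" if "a \<in> monomial_map ` monomials Y" "b \<in> monomial_map ` monomials Y" for a b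
  proof -
    from that obtain a' b' where "a = monomial_map a'" "b = monomial_map b'" "a' \<in> monomials Y" "b' \<in> monomials Y" by blast
    then show ?thesis using Y.add_in by (intro image_eqI[of _ _ "a' + b'"]) auto
  qed
  show "push (inc_act z_act \<pi>) a \<in> monomial_map ` monomials Y" if "strict_mono \<pi>" "a \<in> monomial_map ` monomials Y" for \<pi> a
  proof -
    from that(2) obtain g where g: "g \<in> matching_monoid N K" "a = factor_map g" unfolding monomial_map_image by blast
    have "push (inc_act z_act \<pi>) a = factor_map (image_mset (shift \<pi>) g)"
      unfolding inc_act_z[OF that(1)] factor_map_shift g(2) ..
    then show ?thesis unfolding monomial_map_image using X.act_in[OF that(1) g(1)] by (rule image_eqI)
  qed
  show "push (inc_act z_act id) a = a" for a
  proof -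
    have "z_act id = (\<lambda>x. x)" by (auto simp: z_act_def)
    then show ?thesis by (simp add: inc_act_z[OF strict_mono_id])
  qed
  show "push (inc_act z_act (\<pi> \<circ> \<rho>)) a = push (inc_act z_act \<pi>) (push (inc_act z_act \<rho>) a)"
    if "strict_mono \<pi>" "strict_mono \<rho>" for \<pi> \<rho> a
  proof -
    have "z_act (\<pi> \<circ> \<rho>) = (\<lambda>x. z_act \<pi> (z_act \<rho> x))" by (auto simp: z_act_def)
    then show ?thesis using that by (simp add: inc_act_z strict_mono_o push_push)
  qed
qed simp_all

lemma image_noetherian:
  assumes "noetherian_ring (coeff_ring :: 'r::{comm_ring, comm_monoid_mult} ring)"
  shows "Z.noetherian TYPE('r)"
proof (rule noetherian_image[OF X.inc_monoid_axioms Z.inc_monoid_axioms])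
  show "factor_map ` matching_monoid N K = monomial_map ` monomials Y" by (simp only: monomial_map_image)
  show "factor_map (image_mset (shift \<pi>) g) = push (inc_act z_act \<pi>) (factor_map g)" if "strict_mono \<pi>" for \<pi> g
    unfolding inc_act_z[OF that] by (rule factor_map_shift)
  show "X.noetherian TYPE('r)" by (rule X.noetherian_if_almost_full[OF assms matching_monoid_almost_full[OF K_pos]])
qed simp

text \<open>
A monomial in the variables \<open>Y\<close> over a given element of the matching monoid. The choice is arbitrary, and
additive and equivariant only modulo \<open>move_binomials\<close>.
\<close>

definition section_of :: "(nat \<times> nat \<times> nat) multiset \<Rightarrow> ('y \<Rightarrow>\<^sub>0 nat)" where
  "section_of g = lift (SOME M. set_mset M \<subseteq> matchings N K \<and> cell_sum K M = g)"

lemma section_ofE: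
  assumes "g \<in> matching_monoid N K"
  obtains M where "set_mset M \<subseteq> matchings N K" "cell_sum K M = g" "section_of g = lift M"
proof -
  have "\<exists>M. set_mset M \<subseteq> matchings N K \<and> cell_sum K M = g" using assms by (auto simp: matching_monoid_def)
  from someI_ex[OF this] show thesis
    by (intro that[of "SOME M. set_mset M \<subseteq> matchings N K \<and> cell_sum K M = g"]) (simp_all add: section_of_def)
qed

text \<open>
Two multisets of at most \<open>2 K\<close> matchings involve at most \<open>2 (2 K) K\<close> columns. This bound makes the set finite,
while its translates under increasing maps still contain all bounded moves.
\<close>

definition move_binomials :: "('y, 'r::{comm_ring, comm_monoid_mult}) mpoly set" where
  "move_binomials = {mmonom (lift A) - mmonom (lift B) | A B.
     set_mset A \<subseteq> small_matchings N K (2 * (2 * K) * K) \<and> size A \<le> 2 * K \<and>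
     set_mset B \<subseteq> small_matchings N K (2 * (2 * K) * K) \<and> size B \<le> 2 * K \<and> cell_sum K A = cell_sum K B}"

lemma finite_move_binomials: "finite (move_binomials :: ('y, 'r::{comm_ring, comm_monoid_mult}) mpoly set)"
proof -
  let ?S = "{A. set_mset A \<subseteq> small_matchings N K (2 * (2 * K) * K) \<and> size A \<le> 2 * K}"
  have "(move_binomials :: ('y, 'r) mpoly set) \<subseteq> (\<lambda>(A, B). mmonom (lift A) - mmonom (lift B)) ` (?S \<times> ?S)"
    by (auto simp: move_binomials_def)
  then show ?thesis
    by (rule finite_subset) (intro finite_imageI finite_cartesian_product finite_small_multisets)
qed

text \<open>
Modulo the bounded moves a monomial depends only on the array of its matchings.
\<close>

lemma lift_congruent:
  fixes I :: "('y, 'r::{comm_ring, comm_monoid_mult}) mpoly set"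
  assumes I: "Y.stable I" "move_binomials \<subseteq> I"
    and AB: "set_mset A \<subseteq> matchings N K" "set_mset B \<subseteq> matchings N K" "cell_sum K A = cell_sum K B"
  shows "mmonom (lift A) - mmonom (lift B) \<in> I"
proof (rule connected_by_bounded_moves[where E = "\<lambda>A B. mmonom (lift A) - mmonom (lift B) \<in> I", OF K_pos _ _ _ AB])
  fix A B C assume "mmonom (lift A) - mmonom (lift B) \<in> I" "mmonom (lift B) - mmonom (lift C) \<in> I"
  from Y.stableD(3)[OF I(1) this] show "mmonom (lift A) - mmonom (lift C) \<in> I" by simp
next
  fix A B C assume E: "mmonom (lift A) - mmonom (lift B) \<in> I" and C: "set_mset C \<subseteq> matchings N K"
  have "mmonom (lift C) * (mmonom (lift A) - mmonom (lift B)) \<in> I"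
    by (rule Y.stableD(4)[OF I(1) E lift_in[OF C]])
  then show "mmonom (lift (A + C)) - mmonom (lift (B + C)) \<in> I"
    by (simp add: right_diff_distrib mult_single add.commute)
next
  fix A B assume AB: "set_mset A \<subseteq> matchings N K" "set_mset B \<subseteq> matchings N K"
      "size A \<le> 2 * K" "size B \<le> 2 * K" "cell_sum K A = cell_sum K B"
  from move_from_small[OF this] obtain \<pi> A' B' where *: "strict_mono \<pi>" "A = image_mset (move \<pi>) A'" "B = image_mset (move \<pi>) B'"
    "set_mset A' \<subseteq> small_matchings N K (2 * (2 * K) * K)" "set_mset B' \<subseteq> small_matchings N K (2 * (2 * K) * K)"
    "size A' \<le> 2 * K" "size B' \<le> 2 * K" "cell_sum K A' = cell_sum K B'" by (elim exE conjE)
  have "(mmonom (lift A') - mmonom (lift B') :: ('y, 'r) mpoly) \<in> move_binomials"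
    unfolding move_binomials_def using *(4-8) by blast
  then have "mmonom (lift A') - mmonom (lift B') \<in> I" using I(2) by (rule subsetD[rotated])
  then have "push (push (inc_act act \<pi>)) (mmonom (lift A') - mmonom (lift B')) \<in> I"
    by (rule Y.stableD(5)[OF I(1) _ *(1)])
  moreover have "set_mset A' \<subseteq> matchings N K" "set_mset B' \<subseteq> matchings N K"
    using *(4,5) by (auto simp: small_matchings_def)
  ultimately show "mmonom (lift A) - mmonom (lift B) \<in> I"
    by (simp add: *(2,3) lift_move[OF _ *(1)])
qed

lemma single_diff_in:
  fixes I :: "('y, 'r::{comm_ring, comm_monoid_mult}) mpoly set"
  assumes "Y.stable I" "mmonom a - mmonom b \<in> I"
  shows "single a c - single b c \<in> I"
  using Y.stableD(4)[OF assms Y.zero_in, of c] by (simp add: right_diff_distrib mult_single)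

text \<open>
Modulo \<open>I\<close> the linear extension of \<open>section_of\<close> is multiplicative and equivariant, because the two
monomials to be compared have the same array.
\<close>

lemma section_pullback_stable:
  fixes I :: "('y, 'r::{comm_ring, comm_monoid_mult}) mpoly set"
  assumes I: "Y.stable I" "move_binomials \<subseteq> I"
  shows "X.stable {f :: _ \<Rightarrow>\<^sub>0 'r. keys f \<subseteq> matching_monoid N K \<and> push section_of f \<in> I}"
    (is "X.stable ?J")
  unfolding X.stable_def
proof (intro conjI ballI allI impI)
  fix f c and r :: 'r assume f: "f \<in> ?J" and c: "c \<in> matching_monoid N K"
  from c obtain C where C: "set_mset C \<subseteq> matchings N K" "cell_sum K C = c" "section_of c = lift C" by (rule section_ofE)
  have "keys f \<subseteq> matching_monoid N K" using f by simp
  then have "push section_of (single c r * f) - single (section_of c) r * push section_of f \<in> I"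
  proof (induction f rule: poly_mapping_induct_on)
    case (single g q)
    obtain A where A: "set_mset A \<subseteq> matchings N K" "cell_sum K A = g" "section_of g = lift A"
      using single by (rule section_ofE)
    obtain B where B: "set_mset B \<subseteq> matchings N K" "cell_sum K B = c + g" "section_of (c + g) = lift B"
      using X.add_in[OF c single] by (rule section_ofE)
    have "mmonom (lift B) - mmonom (lift (C + A)) \<in> I"
      using A B C by (intro lift_congruent[OF I]) auto
    then show ?case
      using A(3) B(3) C(3) single_diff_in[OF I(1)] by (simp add: mult_single)
  next
    case (add p q)
    from Y.stableD(3)[OF I(1) this] show ?case by (simp add: distrib_left algebra_simps)
  qed (simp add: Y.stableD(2)[OF I(1)])
  moreover have "single (section_of c) r * push section_of f \<in> I"
    using f C by (intro Y.stableD(4)[OF I(1)]) (auto intro: lift_in)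
  ultimately have "push section_of (single c r * f) \<in> I"
    using Y.stableD(3)[OF I(1)] by fastforce
  moreover have "keys (single c r * f) \<subseteq> matching_monoid N K"
    using X.stableD(4)[OF X.stable_carrier _ c, of f r] f by simp
  ultimately show "single c r * f \<in> ?J" by simp
next
  fix f and \<pi> :: "nat \<Rightarrow> nat" assume f: "f \<in> ?J" and \<pi>: "strict_mono \<pi>"
  have "keys f \<subseteq> matching_monoid N K" using f by simp
  then have "push section_of (push (image_mset (shift \<pi>)) f) - push (push (inc_act act \<pi>)) (push section_of f) \<in> I"
  proof (induction f rule: poly_mapping_induct_on)
    case (single g q)
    obtain A where A: "set_mset A \<subseteq> matchings N K" "cell_sum K A = g" "section_of g = lift A"
      using single by (rule section_ofE)
    obtain B where B: "set_mset B \<subseteq> matchings N K" "cell_sum K B = image_mset (shift \<pi>) g" "section_of (image_mset (shift \<pi>) g) = lift B"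
      using X.act_in[OF \<pi> single] by (rule section_ofE)
    have "set_mset (image_mset (move \<pi>) A) \<subseteq> matchings N K"
      using A(1) move_in[OF strict_mono_imp_inj_on[OF \<pi>]] by auto
    then have "mmonom (lift B) - mmonom (lift (image_mset (move \<pi>) A)) \<in> I"
      using A B cell_sum_move[OF A(1)] by (intro lift_congruent[OF I]) auto
    then show ?case
      using A(3) B(3) single_diff_in[OF I(1)] by (simp add: lift_move[OF A(1) \<pi>])
  next
    case (add p q)
    from Y.stableD(3)[OF I(1) this] show ?case by (simp add: algebra_simps)
  qed (simp add: Y.stableD(2)[OF I(1)])
  moreover have "push (push (inc_act act \<pi>)) (push section_of f) \<in> I"
    using f by (intro Y.stableD(5)[OF I(1) _ \<pi>]) simp
  ultimately have "push section_of (push (image_mset (shift \<pi>)) f) \<in> I"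
    using Y.stableD(3)[OF I(1)] by fastforce
  then show "push (image_mset (shift \<pi>)) f \<in> ?J" using f X.keys_push_act[OF \<pi>, of f] by simp
qed (simp_all add: Y.stableD(2,3)[OF I(1)] keys_add_subset)

text \<open>
Moving from \<open>a\<close> to the chosen monomial with the same array, on to that of \<open>b\<close>, and from there to \<open>b\<close>
separates the relations between matchings from the relations between arrays.
\<close>

lemma monomial_map_fibre_congruent:
  fixes I :: "('y, 'r::{comm_ring, comm_monoid_mult}) mpoly set"
  assumes I: "Y.stable I" "move_binomials \<subseteq> I"
    and binom: "\<And>g h. g \<in> matching_monoid N K \<Longrightarrow> h \<in> matching_monoid N K \<Longrightarrow> factor_map g = factor_map h \<Longrightarrow>
      mmonom (section_of g) - mmonom (section_of h) \<in> I"
    and ab: "a \<in> monomials Y" "b \<in> monomials Y" "monomial_map a = monomial_map b"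
  shows "mmonom a - mmonom b \<in> I"
proof -
  obtain A B where A: "set_mset A \<subseteq> matchings N K" "lift A = a" and B: "set_mset B \<subseteq> matchings N K" "lift B = b"
    using lift_surj ab(1,2) by metis
  define g h where "g = cell_sum K A" and "h = cell_sum K B"
  have gh: "g \<in> matching_monoid N K" "h \<in> matching_monoid N K" using A(1) B(1) by (auto simp: g_def h_def matching_monoid_def)
  have "factor_map g = factor_map h" using ab(3) A B by (simp add: g_def h_def factor_map_cell_sum)
  with gh have 1: "mmonom (section_of g) - mmonom (section_of h) \<in> I" by (rule binom)
  obtain A' where A': "set_mset A' \<subseteq> matchings N K" "cell_sum K A' = g" "section_of g = lift A'" using gh(1) by (rule section_ofE)
  obtain B' where B': "set_mset B' \<subseteq> matchings N K" "cell_sum K B' = h" "section_of h = lift B'" using gh(2) by (rule section_ofE)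
  have 2: "mmonom a - mmonom (section_of g) \<in> I"
    unfolding A'(3) A(2)[symmetric] using A(1) A'(1,2) by (intro lift_congruent[OF I]) (auto simp: g_def)
  have 3: "mmonom (section_of h) - mmonom b \<in> I"
    unfolding B'(3) B(2)[symmetric] using B(1) B'(1,2) by (intro lift_congruent[OF I]) (auto simp: h_def)
  from Y.stableD(3)[OF I(1) Y.stableD(3)[OF I(1) 2 1] 3] show ?thesis by simp
qed

text \<open>
Replacing every monomial of \<open>f\<close> by a fixed one with the same image changes \<open>f\<close> by a combination of
binomials in the kernel. The result is the image of \<open>push monomial_map f\<close> under a linear map, hence zero.
\<close>

lemma kernel_in:
  fixes I :: "('y, 'r::{comm_ring, comm_monoid_mult}) mpoly set"
  assumes I: "Y.stable I"
    and fibre: "\<And>a b. a \<in> monomials Y \<Longrightarrow> b \<in> monomials Y \<Longrightarrow> monomial_map a = monomial_map b \<Longrightarrow> mmonom a - mmonom b \<in> I"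
    and f: "keys f \<subseteq> monomials Y" "push monomial_map f = 0"
  shows "f \<in> I"
proof -
  define \<theta> where "\<theta> = inv_into (monomials Y) monomial_map"
  have \<theta>: "\<theta> (monomial_map a) \<in> monomials Y" "monomial_map (\<theta> (monomial_map a)) = monomial_map a" if "a \<in> monomials Y" for a
    using that by (auto simp: \<theta>_def inv_into_into f_inv_into_f)
  have "f - push \<theta> (push monomial_map f) \<in> I"
    using f(1)
  proof (induction f rule: poly_mapping_induct_on)
    case (single a c)
    then show ?case using fibre[of a "\<theta> (monomial_map a)"] \<theta>[of a] single_diff_in[OF I] by simp
  next
    case (add p q)
    from Y.stableD(3)[OF I this] show ?case by (simp add: algebra_simps)
  qed (simp add: Y.stableD(2)[OF I])
  then show ?thesis using f(2) by simp
qed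

lemma stable_kernel: "Y.stable {f :: ('y, 'r::{comm_ring, comm_monoid_mult}) mpoly. keys f \<subseteq> monomials Y \<and> push monomial_map f = 0}"
  (is "Y.stable ?I")
  unfolding Y.stable_def
proof (intro conjI ballI allI impI)
  fix f c and r :: 'r assume f: "f \<in> ?I" and c: "c \<in> monomials Y"
  have "push monomial_map (single c r * f) = push monomial_map (single c r) * push monomial_map f"
    by (rule push_mult[of UNIV]) simp_all
  moreover have "keys (single c r * f) \<subseteq> monomials Y"
    using Y.stableD(4)[OF Y.stable_carrier _ c, of f r] f by simp
  ultimately show "single c r * f \<in> ?I" using f by simp
next
  fix f and \<pi> :: "nat \<Rightarrow> nat" assume f: "f \<in> ?I" and \<pi>: "strict_mono \<pi>"
  have "monomial_map (push (inc_act act \<pi>) a) = push (inc_act z_act \<pi>) (monomial_map a)" if a: "a \<in> monomials Y" for a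
  proof -
    obtain M where M: "set_mset M \<subseteq> matchings N K" "lift M = a" using lift_surj[OF a] by blast
    have "set_mset (image_mset (move \<pi>) M) \<subseteq> matchings N K"
      using M(1) move_in[OF strict_mono_imp_inj_on[OF \<pi>]] by auto
    then have "monomial_map (push (inc_act act \<pi>) a) = factor_map (cell_sum K (image_mset (move \<pi>) M))"
      by (simp add: factor_map_cell_sum lift_move[OF M(1) \<pi>] M(2))
    also have "\<dots> = push (inc_act z_act \<pi>) (monomial_map a)"
      by (simp add: cell_sum_move[OF M(1)] factor_map_shift factor_map_cell_sum[OF M(1)] M(2) inc_act_z[OF \<pi>])
    finally show ?thesis .
  qed
  then have "push monomial_map (push (push (inc_act act \<pi>)) f) = push (push (inc_act z_act \<pi>)) (push monomial_map f)"
    unfolding push_push using f by (intro push_cong) auto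
  then show "push (push (inc_act act \<pi>)) f \<in> ?I" using f Y.keys_push_act[OF \<pi>, of f] by simp
qed (simp_all add: keys_add_subset)

theorem kernel_finitely_generated:
  assumes noeth: "noetherian_ring (coeff_ring :: 'r::{comm_ring, comm_monoid_mult} ring)"
  shows "\<exists>B. finite B \<and> B \<subseteq> (binomials Y :: ('y, 'r) mpoly set) \<and>
    {f. keys f \<subseteq> monomials Y \<and> push monomial_map f = 0} = Y.gen B"
proof -
  let ?G = "matching_monoid N K"
  define C :: "((nat \<times> nat \<times> nat) multiset \<Rightarrow>\<^sub>0 'r) set" where
    "C = {single g 1 - single h 1 | g h. g \<in> ?G \<and> h \<in> ?G \<and> factor_map g = factor_map h}"
  have C: "keys f \<subseteq> ?G" if "f \<in> C" for f
  proof -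
    from that obtain g h where "f = single g 1 - single h 1" "g \<in> ?G" "h \<in> ?G" by (auto simp: C_def)
    then show ?thesis using keys_diff_subset[of "single g 1" ?G "single h (1 :: 'r)"] by (auto split: if_splits)
  qed
  have "X.noetherian TYPE('r)" by (rule X.noetherian_if_almost_full[OF noeth matching_monoid_almost_full[OF K_pos]])
  then have "\<exists>F\<subseteq>C. finite F \<and> C \<subseteq> X.gen F" using C by (rule X.noetherianD)
  then obtain F where F: "F \<subseteq> C" "finite F" "C \<subseteq> X.gen F" by (elim exE conjE)
  define B where "B = move_binomials \<union> push section_of ` F"
  have "finite B" using F(2) finite_move_binomials by (simp add: B_def)
  have section_in: "section_of g \<in> monomials Y" "monomial_map (section_of g) = factor_map g" if g: "g \<in> ?G" for g
  proof -
    obtain M where "set_mset M \<subseteq> matchings N K" "cell_sum K M = g" "section_of g = lift M" using g by (rule section_ofE)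
    then show "section_of g \<in> monomials Y" "monomial_map (section_of g) = factor_map g" using lift_in[of M] factor_map_cell_sum[of M] by auto
  qed
  have moves: "f \<in> binomials Y \<and> push monomial_map f = 0" if "f \<in> (move_binomials :: ('y, 'r) mpoly set)" for f
  proof -
    from that obtain A B where AB: "f = mmonom (lift A) - mmonom (lift B)" "set_mset A \<subseteq> matchings N K" "set_mset B \<subseteq> matchings N K"
      "cell_sum K A = cell_sum K B" by (auto simp: move_binomials_def small_matchings_def)
    have "monomial_map (lift A) = monomial_map (lift B)" using AB(4) factor_map_cell_sum[OF AB(2)] factor_map_cell_sum[OF AB(3)] by simp
    then show ?thesis using lift_in[OF AB(2)] lift_in[OF AB(3)] by (auto simp: AB(1) binomials_def)
  qed
  have sections: "push section_of f \<in> binomials Y \<and> push monomial_map (push section_of f) = 0" if "f \<in> F" for f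
  proof -
    from that F(1) obtain g h where gh: "f = single g 1 - single h 1" "g \<in> ?G" "h \<in> ?G" "factor_map g = factor_map h"
      by (auto simp: C_def)
    then show ?thesis using section_in by (auto simp: binomials_def)
  qed
  have B: "f \<in> binomials Y \<and> push monomial_map f = 0" if "f \<in> B" for f using that moves sections by (auto simp: B_def)
  have keys_B: "keys f \<subseteq> monomials Y" if "f \<in> B" for f
  proof -
    from B[OF that] obtain a b where "f = mmonom a - mmonom b" "a \<in> monomials Y" "b \<in> monomials Y" by (auto simp: binomials_def)
    then show ?thesis using keys_diff_subset[of "mmonom a" "monomials Y" "mmonom b :: ('y, 'r) mpoly"] by (auto split: if_splits)
  qed
  have st: "Y.stable (Y.gen B)" using keys_B by (rule Y.stable_gen)
  have B_gen: "B \<subseteq> Y.gen B" by (rule Y.gen_superset)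
  then have moves_gen: "move_binomials \<subseteq> Y.gen B" by (simp add: B_def)
  let ?J = "{f. keys f \<subseteq> ?G \<and> push section_of f \<in> Y.gen B}"
  have "F \<subseteq> ?J" using F(1) C B_gen by (auto simp: B_def)
  then have "X.gen F \<subseteq> ?J" by (rule X.gen_least[OF section_pullback_stable[OF st moves_gen]])
  then have CJ: "C \<subseteq> ?J" using F(3) by (rule order_trans[rotated])
  have sec: "mmonom (section_of g) - mmonom (section_of h) \<in> Y.gen B" if "g \<in> ?G" "h \<in> ?G" "factor_map g = factor_map h" for g h
  proof -
    have "single g 1 - single h 1 \<in> C" using that by (auto simp: C_def)
    then have "single g 1 - single h 1 \<in> ?J" using CJ by (rule subsetD[rotated])
    then show ?thesis by simp
  qed
  have fibre: "mmonom a - mmonom b \<in> Y.gen B" if "a \<in> monomials Y" "b \<in> monomials Y" "monomial_map a = monomial_map b" for a b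
    by (rule monomial_map_fibre_congruent[OF st moves_gen sec that])
  have "{f. keys f \<subseteq> monomials Y \<and> push monomial_map f = 0} = Y.gen B"
  proof
    show "{f. keys f \<subseteq> monomials Y \<and> push monomial_map f = 0} \<subseteq> Y.gen B"
    proof
      fix f :: "('y, 'r) mpoly" assume f: "f \<in> {f. keys f \<subseteq> monomials Y \<and> push monomial_map f = 0}"
      show "f \<in> Y.gen B"
      proof (rule kernel_in[OF st])
        show "mmonom a - mmonom b \<in> Y.gen B" if "a \<in> monomials Y" "b \<in> monomials Y" "monomial_map a = monomial_map b" for a b
          using that by (rule fibre)
      qed (use f in simp_all)
    qed
    show "Y.gen B \<subseteq> {f. keys f \<subseteq> monomials Y \<and> push monomial_map f = 0}"
    proof (rule Y.gen_least[OF stable_kernel], rule subsetI)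
      fix f assume "f \<in> B"
      then show "f \<in> {f. keys f \<subseteq> monomials Y \<and> push monomial_map f = 0}" using B[of f] keys_B[of f] by simp
    qed
  qed
  moreover have "B \<subseteq> binomials Y" using B by (intro subsetI) simp
  ultimately show ?thesis using \<open>finite B\<close> by (intro exI[of _ B] conjI)
qed

end

section \<open>Kernel and image of the homomorphism\<close>

lemma supported_by_mono: "supported_by act y n \<Longrightarrow> n \<le> n' \<Longrightarrow> supported_by act y n'"
  by (auto simp: supported_by_def)

lemma finite_orbit_representatives:
  fixes Y :: "'y set"
  assumes action: "group_action SymN Y act" and support: "\<forall>y\<in>Y. \<exists>n. supported_by act y n"
    and fin: "finite (orbits SymN Y act)"
  shows "\<exists>(rep :: nat \<Rightarrow> 'y) (N :: nat) (K :: nat). 0 < K \<and> (\<forall>p<N. rep p \<in> Y \<and> supported_by act (rep p) K) \<and>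
    (\<forall>y\<in>Y. \<exists>p<N. \<exists>\<sigma>\<in>carrier SymN. y = act \<sigma> (rep p))"
proof -
  obtain r where r: "\<And>C. C \<in> orbits SymN Y act \<Longrightarrow> r C \<in> Y \<and> C = orbit SymN act (r C)"
    unfolding orbits_def by (atomize_elim, rule choice) auto
  define P where "P = r ` orbits SymN Y act"
  have "finite P" using fin by (simp add: P_def)
  obtain rep where rep: "bij_betw rep {0..<card P} P" using ex_bij_betw_nat_finite[OF \<open>finite P\<close>] by blast
  have rep_in: "rep p \<in> Y" if "p < card P" for p
  proof -
    have "rep p \<in> P" using bij_betwE[OF rep] that by simp
    then show ?thesis using r by (auto simp: P_def)
  qed
  have "\<exists>s. \<forall>y\<in>Y. supported_by act y (s y)" using support by (rule bchoice)
  then obtain s where s: "\<And>y. y \<in> Y \<Longrightarrow> supported_by act y (s y)" by blast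
  \<comment> \<open>a common support of all representatives, positive even if \<open>Y\<close> is empty\<close>
  define K where "K = Suc (\<Sum>p<card P. s (rep p))"
  have "supported_by act (rep p) K" if "p < card P" for p
  proof (rule supported_by_mono[OF s[OF rep_in[OF that]]])
    have "s (rep p) \<le> (\<Sum>p<card P. s (rep p))" using that by (intro member_le_sum) auto
    then show "s (rep p) \<le> K" by (simp add: K_def)
  qed
  moreover have "\<exists>p<card P. \<exists>\<sigma>\<in>carrier SymN. y = act \<sigma> (rep p)" if y: "y \<in> Y" for y
  proof -
    have C: "orbit SymN act y \<in> orbits SymN Y act" using y by (auto simp: orbits_def)
    then have "r (orbit SymN act y) \<in> P" by (simp add: P_def)
    then obtain p where p: "p < card P" "rep p = r (orbit SymN act y)"
      using bij_betw_imp_surj_on[OF rep] by (metis atLeastLessThan_iff imageE)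
    have "orbit SymN act (rep p) = orbit SymN act y"
      unfolding p(2) using conjunct2[OF r[OF C]] by (rule sym)
    then have "y \<in> orbit SymN act (rep p)" using group_action.orbit_refl[OF action y] by simp
    then show ?thesis using p(1) by (auto simp: orbit_def)
  qed
  moreover have "0 < K" by (simp add: K_def)
  ultimately show ?thesis using rep_in
    by - (rule exI[of _ rep], rule exI[of _ "card P"], rule exI[of _ K], simp)
qed

lemma zero_in_monomials: "0 \<in> monomials V"
  by (simp add: monomials_def)

lemma add_in_monomials: "a \<in> monomials V \<Longrightarrow> b \<in> monomials V \<Longrightarrow> a + b \<in> monomials V"
  using keys_add_subset[of a V b] by (simp add: monomials_def)

text \<open>
A homomorphism that fixes constants and sends variables to monomials is determined by the map that it
induces on exponents.
\<close>

lemma hom_eq_push: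
  fixes \<phi> :: "('y, 'r::{comm_ring, comm_monoid_mult}) mpoly \<Rightarrow> ('z, 'r) mpoly"
  assumes hom: "\<phi> \<in> ring_hom (mpoly_ring V) (mpoly_ring W)" and const: "\<And>c. \<phi> (const c) = const c"
    and \<mu>: "\<mu> 0 = 0" "\<And>a b. \<mu> (a + b) = \<mu> a + \<mu> b"
    and var: "\<And>y. y \<in> V \<Longrightarrow> \<phi> (mvar y) = mmonom (\<mu> (single y 1))"
    and f: "keys f \<subseteq> monomials V"
  shows "\<phi> f = push \<mu> f"
proof -
  have mult: "\<phi> (f * g) = \<phi> f * \<phi> g" if "keys f \<subseteq> monomials V" "keys g \<subseteq> monomials V" for f g
    using ring_hom_mult[OF hom, of f g] that by (simp add: mpoly_ring_eq)
  have hom_add: "\<phi> (f + g) = \<phi> f + \<phi> g" if "keys f \<subseteq> monomials V" "keys g \<subseteq> monomials V" for f g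
    using ring_hom_add[OF hom, of f g] that by (simp add: mpoly_ring_eq)
  have monom_add: "\<phi> (mmonom (a + b)) = mmonom (\<mu> (a + b))"
    if "a \<in> monomials V" "b \<in> monomials V" "\<phi> (mmonom a) = mmonom (\<mu> a)" "\<phi> (mmonom b) = mmonom (\<mu> b)" for a b
  proof -
    have "\<phi> (mmonom (a + b)) = \<phi> (mmonom a * mmonom b)" by (simp add: mult_single)
    also have "\<dots> = mmonom (\<mu> a) * mmonom (\<mu> b)" using that by (subst mult) (auto split: if_splits)
    finally show ?thesis by (simp add: mult_single \<mu>(2))
  qed
  have monom: "a \<in> monomials V \<and> \<phi> (mmonom a) = mmonom (\<mu> a)" if "keys a \<subseteq> V" for a
    using that
  proof (induction a rule: poly_mapping_induct_on)
    case zero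
    show ?case by (simp add: zero_in_monomials const \<mu>(1))
  next
    case (single y n)
    have y: "single y n \<in> monomials V" for n :: nat using single by (simp add: monomials_def)
    have "\<phi> (mmonom (single y n)) = mmonom (\<mu> (single y n))"
    proof (induction n)
      case 0
      show ?case by (simp add: const \<mu>(1))
    next
      case (Suc n)
      have "single y (Suc n) = single y 1 + single y n" by (simp add: single_add[symmetric])
      then show ?case using monom_add[OF y y var[OF single] Suc] by simp
    qed
    then show ?case using y by blast
  next
    case (add a b)
    then show ?case using add_in_monomials monom_add by blast
  qed
  have "keys f \<subseteq> monomials V \<and> \<phi> f = push \<mu> f"
    using f
  proof (induction f rule: poly_mapping_induct_on)
    case zero
    have "\<phi> (const 0) = const 0" by (rule const)
    then show ?case by simp
  next
    case (single a c)
    have "\<phi> (single a c) = \<phi> (const c * mmonom a)" by (simp add: mult_single)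
    also have "\<dots> = const c * mmonom (\<mu> a)"
      using monom[of a] single zero_in_monomials[of V] by (subst mult) (auto simp: const monomials_def split: if_splits)
    finally show ?case using single by (simp add: mult_single)
  next
    case (add p q)
    then show ?case using keys_add_subset[of p "monomials V" q] by (simp add: hom_add)
  qed
  then show ?thesis by blast
qed

text \<open>
Over the zero ring the image is the algebra of the trivial monoid.
\<close>

lemma noetherian_over_zero_ring:
  assumes triv: "(1 :: 'r::{comm_ring, comm_monoid_mult}) = 0"
  shows "inc_monoid {0 :: nat \<times> nat \<Rightarrow>\<^sub>0 nat} (\<lambda>\<pi>. push (inc_act z_act \<pi>))"
    and "inc_monoid.noetherian {0 :: nat \<times> nat \<Rightarrow>\<^sub>0 nat} (\<lambda>\<pi>. push (inc_act z_act \<pi>)) TYPE('r)"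
proof -
  show 1: "inc_monoid {0 :: nat \<times> nat \<Rightarrow>\<^sub>0 nat} (\<lambda>\<pi>. push (inc_act z_act \<pi>))" by unfold_locales simp_all
  interpret Z0: inc_monoid "{0 :: nat \<times> nat \<Rightarrow>\<^sub>0 nat}" "\<lambda>\<pi>. push (inc_act z_act \<pi>)" by (rule 1)
  have "f = 0" for f :: "(nat \<times> nat \<Rightarrow>\<^sub>0 nat) \<Rightarrow>\<^sub>0 'r"
    by (rule poly_mapping_eqI) (metis lookup_zero mult_1 mult_zero_left triv)
  then have "C \<subseteq> Z0.gen {}" for C :: "((nat \<times> nat \<Rightarrow>\<^sub>0 nat) \<Rightarrow>\<^sub>0 'r) set"
    using Z0.stableD(2)[OF Z0.stable_gen[of "{}"]] by (metis emptyE subsetI)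
  then show "Z0.noetherian TYPE('r)" unfolding Z0.noetherian_def by blast
qed

theorem theorem1p1:
  fixes Y :: "'y set"
    and act :: "(nat \<Rightarrow> nat) \<Rightarrow> 'y \<Rightarrow> 'y"
    and k :: nat
    and \<phi> :: "('y, 'r::{comm_ring, comm_monoid_mult}) mpoly \<Rightarrow> (nat \<times> nat, 'r) mpoly"
  defines "RY \<equiv> mpoly_ring Y"
    and "RZ \<equiv> mpoly_ring (z_vars k)"
  defines "K \<equiv> a_kernel RY RZ \<phi>"
    and "ImPhi \<equiv> RZ\<lparr>carrier := \<phi> ` carrier RY\<rparr>"
  assumes noeth: "noetherian_ring (coeff_ring :: 'r ring)"
    and action: "group_action SymN Y act"
    and support: "\<forall>y\<in>Y. \<exists>n. supported_by act y n"
    and fin_orbits: "finite (orbits SymN Y act)"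
    and hom: "\<phi> \<in> ring_hom RY RZ"
    and R_linear: "\<forall>c. \<phi> (const c) = const c"
    and equivariant: "\<forall>\<sigma> \<in> carrier SymN. \<forall>f \<in> carrier RY.
                        \<phi> (map_vars (act \<sigma>) f) = map_vars (z_act \<sigma>) (\<phi> f)"
    and monomial: "\<forall>y\<in>Y. \<exists>m \<in> monomials (z_vars k). \<phi> (mvar y) = mmonom m"
  shows "(\<exists>B. finite B \<and> B \<subseteq> binomials Y \<and>
              K = Idl\<^bsub>RY\<^esub> (\<Union>b\<in>B. orbit IncN (\<lambda>\<pi>. map_vars (inc_act act \<pi>)) b)) \<and>
         (\<exists>h \<in> ring_iso (RY Quot K) ImPhi. \<forall>f \<in> carrier RY. h (K +>\<^bsub>RY\<^esub> f) = \<phi> f) \<and>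
         noetherian_ring_action IncN ImPhi (\<lambda>\<pi>. map_vars (inc_act z_act \<pi>))"
proof -
  have RY: "RY = monoid_algebra (monomials Y)" and RZ: "RZ = monoid_algebra (monomials (z_vars k))"
    by (simp_all add: RY_def RZ_def mpoly_ring_eq)
  have ring: "ring RY" "ring RZ"
    unfolding RY RZ by (auto intro!: cring.axioms(1) monoid_algebra_cring zero_in_monomials add_in_monomials)
  have hom_ring: "ring_hom_ring RY RZ \<phi>" by (rule ring_hom_ringI2[OF ring hom])
  have K: "K = {f. keys f \<subseteq> monomials Y \<and> \<phi> f = 0}"
    unfolding K_def a_kernel_def' RY RZ by simp
  have "(\<lambda>C. the_elem (\<phi> ` C)) \<in> ring_iso (RY Quot K) ImPhi"
    unfolding K_def ImPhi_def by (rule ring_hom_ring.FactRing_iso_set_aux[OF hom_ring])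
  moreover have "the_elem (\<phi> ` (K +>\<^bsub>RY\<^esub> f)) = \<phi> f" if "f \<in> carrier RY" for f
    unfolding K_def using that by (rule ring_hom_ring.the_elem_simp[OF hom_ring])
  ultimately have iso: "\<exists>h \<in> ring_iso (RY Quot K) ImPhi. \<forall>f \<in> carrier RY. h (K +>\<^bsub>RY\<^esub> f) = \<phi> f" by (intro bexI ballI)
  have ImPhi: "ImPhi = monoid_algebra H" if "\<phi> ` carrier RY = {p. keys p \<subseteq> H}" for H
    unfolding ImPhi_def that by (simp add: RZ monoid_algebra_def)
  have "(\<exists>B. finite B \<and> B \<subseteq> binomials Y \<and> K = Idl\<^bsub>RY\<^esub> (\<Union>b\<in>B. orbit IncN (\<lambda>\<pi>. map_vars (inc_act act \<pi>)) b)) \<and>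
    noetherian_ring_action IncN ImPhi (\<lambda>\<pi>. map_vars (inc_act z_act \<pi>))"
  proof (cases "(1 :: 'r) = 0")
    case True
    have triv: "f = 0" for f :: "'v \<Rightarrow>\<^sub>0 'r"
      by (rule poly_mapping_eqI) (metis lookup_zero mult_1 mult_zero_left True)
    have triv_set: "A = B" if "0 \<in> A" "0 \<in> B" for A B :: "('v \<Rightarrow>\<^sub>0 'r) set"
      using that triv by (metis subsetI subset_antisym)
    have "additive_subgroup (Idl\<^bsub>RY\<^esub> {}) RY" by (rule ideal.axioms(1)[OF ring.genideal_ideal[OF ring(1)]]) simp
    then have "0 \<in> Idl\<^bsub>RY\<^esub> {}" using additive_subgroup.zero_closed by (fastforce simp: RY)
    moreover have "0 \<in> K" by (simp add: K triv)
    ultimately have "K = Idl\<^bsub>RY\<^esub> {}" by (intro triv_set)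
    moreover have "ImPhi = monoid_algebra {0 :: nat \<times> nat \<Rightarrow>\<^sub>0 nat}"
      by (intro ImPhi triv_set) (auto simp: RY triv intro: image_eqI[of _ _ 0])
    ultimately show ?thesis
      using inc_monoid.noetherian_imp_noetherian_ring_action[OF noetherian_over_zero_ring[OF True]]
      by (intro conjI exI[of _ "{}"]) (simp_all add: map_vars_eq_push)
  next
    case False
    define m where "m y = (SOME m. \<phi> (mvar y) = mmonom m)" for y
    have m: "\<phi> (mvar y) = mmonom (m y)" if "y \<in> Y" for y
      unfolding m_def using monomial that by (metis (mono_tags, lifting) someI)
    have var_in: "mvar y \<in> carrier RY" if "y \<in> Y" for y
      using that by (auto simp: RY monomials_def)
    have m_equivariant: "m (act \<sigma> y) = push (z_act \<sigma>) (m y)" if \<sigma>: "\<sigma> \<in> carrier SymN" and y: "y \<in> Y" for \<sigma> y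
    proof -
      have "act \<sigma> y \<in> Y" using group_action.element_image[OF action \<sigma> y] by blast
      then have "mmonom (m (act \<sigma> y)) = \<phi> (map_vars (act \<sigma>) (mvar y))" by (simp add: m map_vars_eq_push del: One_nat_def)
      also have "\<dots> = map_vars (z_act \<sigma>) (\<phi> (mvar y))" using equivariant \<sigma> var_in[OF y] by blast
      also have "\<dots> = mmonom (push (z_act \<sigma>) (m y))" by (simp add: m[OF y] map_vars_eq_push del: One_nat_def)
      finally have "keys (mmonom (m (act \<sigma> y)) :: (nat \<times> nat, 'r) mpoly) =
        keys (mmonom (push (z_act \<sigma>) (m y)) :: (nat \<times> nat, 'r) mpoly)" by simp
      then show ?thesis using False by simp
    qed
    obtain rep :: "nat \<Rightarrow> 'y" and N n :: nat where rep: "0 < n" "\<forall>p<N. rep p \<in> Y \<and> supported_by act (rep p) n"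
      "\<forall>y\<in>Y. \<exists>p<N. \<exists>\<sigma>\<in>carrier SymN. y = act \<sigma> (rep p)"
      using finite_orbit_representatives[OF action support fin_orbits] by (elim exE conjE)
    interpret toric_data Y act m N n rep
      by (rule toric_data.intro) (use action support rep m_equivariant in simp_all)
    have \<phi>: "\<phi> f = push monomial_map f" if "keys f \<subseteq> monomials Y" for f
      using hom[unfolded RY_def RZ_def] that R_linear m[simplified]
      by (intro hom_eq_push[of \<phi> Y "z_vars k" monomial_map]) simp_all
    obtain B where B: "finite B" "B \<subseteq> binomials Y"
      "{f :: ('y, 'r) mpoly. keys f \<subseteq> monomials Y \<and> push monomial_map f = 0} = Y.gen B"
      using kernel_finitely_generated[OF noeth] by (elim exE conjE)
    have "K = Y.gen B" unfolding B(3)[symmetric] K using \<phi> by auto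
    moreover have "keys f \<subseteq> monomials Y" if "f \<in> B" for f
      using that Y.gen_superset[of B] B(3) by blast
    ultimately have "K = Idl\<^bsub>RY\<^esub> (\<Union>b\<in>B. orbit IncN (\<lambda>\<pi>. map_vars (inc_act act \<pi>)) b)"
      by (simp add: RY map_vars_eq_push Y.Idl_orbits_eq_gen)
    moreover have "ImPhi = monoid_algebra (monomial_map ` monomials Y)"
    proof (intro ImPhi equalityI subsetI)
      fix p assume "p \<in> \<phi> ` carrier RY"
      then obtain f where "keys f \<subseteq> monomials Y" "p = push monomial_map f" using \<phi> by (auto simp: RY)
      then have "keys p \<subseteq> monomial_map ` monomials Y" using keys_push[of monomial_map f] by blast
      then show "p \<in> {p. keys p \<subseteq> monomial_map ` monomials Y}" by simp
    next
      fix p :: "(nat \<times> nat, 'r) mpoly" assume "p \<in> {p. keys p \<subseteq> monomial_map ` monomials Y}"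
      then have p: "keys p \<subseteq> monomial_map ` monomials Y" by simp
      define s where "s = inv_into (monomials Y) monomial_map"
      have s: "s a \<in> monomials Y" "monomial_map (s a) = a" if "a \<in> keys p" for a
        using that p by (auto simp: s_def inv_into_into f_inv_into_f)
      have keys: "keys (push s p) \<subseteq> monomials Y" using keys_push[of s p] s(1) by blast
      have "push monomial_map (push s p) = push (\<lambda>a. a) p" unfolding push_push by (rule push_cong) (rule s(2))
      then show "p \<in> \<phi> ` carrier RY" using \<phi>[OF keys] keys by (intro image_eqI[of _ _ "push s p"]) (simp_all add: RY)
    qed
    ultimately show ?thesis
      using B(1,2) Z.noetherian_imp_noetherian_ring_action[OF image_noetherian[OF noeth]]
      by (intro conjI exI[of _ B]) (simp_all add: map_vars_eq_push)
  qed
  with iso show ?thesis by blast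
qed

end
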